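(* Let $a\in\mathbb R$, $a\neq0$, and $$W(x)=e^{-x^2}\begin{pmatrix}a^4x^4+3a^2x^2+1&a^3x^3+2ax\\ a^3x^3+2ax&a^2x^2+1\end{pmatrix},\qquad x\in\mathbb R.$$ Then $W$ is a strong Darboux transformation of $\widetilde W(x)=e^{-x^2}I$ (of size $2\times2$, on $\mathbb R$). Moreover, $\mathcal D(W)$ contains a differential operator of order $4$ and contains no differential operator of positive order less than $4$; in particular $\mathcal D(W)$ contains no second-order differential operator, i.e. $W$ is not a solution of the Matrix Bochner Problem.
   Context: For a weight matrix $W$ of size $N$ on an interval $(x_0,x_1)$ put $\langle P,Q\rangle_W=\int_{x_0}^{x_1}P(x)W(x)Q(x)^*\,dx$ for $P,Q\in\operatorname{Mat}_N(\mathbb C[x])$. The monic orthogonal polynomials of $W$ are the unique $P_n\in\operatorname{Mat}_N(\mathbb C[x])$, $n\ge0$, of degree $n$ with leading coefficient $I$ and $\langle P_n,P_m\rangle_W=0$ for $n\ne m$. Differential operators $D=\sum_{i=0}^s\partial^iF_i(x)$, $\partial=d/dx$, act on the right on matrix functions: $P\cdot D=\sum_i P^{(i)}F_i$, and products satisfy $P\cdot(D_1D_2)=(P\cdot D_1)\cdot D_2$. The order of $D$ is the largest $s$ with $F_s\ne0$. $\operatorname{Mat}_N(\Omega[x])$ is the algebra of such operators with coefficients $F_i\in\operatorname{Mat}_N(\mathbb C[x])$. $$\mathcal D(W)=\{D\in\operatorname{Mat}_N(\Omega[x]): P_n\cdot D=\Lambda_n(D)P_n\text{ for some }\Lambda_n(D)\in\operatorname{Mat}_N(\mathbb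 C),\ \forall n\ge0\}.$$ A weight matrix $W$ is a solution of the Matrix Bochner Problem if $\mathcal D(W)$ contains a second-order differential operator. The formal adjoint ${}^*$ is the involution (reversing products) extending the Hermitian conjugate on matrix functions and sending $\partial I$ to $-\partial I$. An operator $\mathcal V\in\operatorname{Mat}_N(\Omega[x])$ is degree-preserving if $\deg(P\cdot\mathcal V)=\deg P$ for all $P\in\operatorname{Mat}_N(\mathbb C[x])$. Strong Darboux transformation (general definition): for weight matrices $W_1,W_2$ of size $N$ on the same interval, $W_2$ is a strong Darboux transformation of $W_1$ if there is a degree-preserving differential operator $\mathcal V\in\operatorname{Mat}_N(\Omega[x])$ with nonsingular leading coefficient (i.e. the coefficient of its highest power of $\partial$ is a matrix polynomial whose determinant is not identically zero) such that $D=\mathcal V\mathcal N\in\mathcal D(W_1)$, where $\mathcal N=W_2\mathcal V^*W_1^{-1}$ (so $Q\cdot\mathcal N=\sum_j(-1)^j(QW_2F_j^* )^{(j)}W_1^{-1}$ if $\mathcal V=\sum_j\partial^jF_j$) is a differential operator satisfying $\langle P\cdot\mathcal V,Q\rangle_{W_2}=\langle P,Q\cdot\mathcal N\rangle_{W_1}$ for all $P,Q\in\operatorname{Mat}_N(\mathbb C[x])$. *)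

theory Defs
  imports "HOL-Analysis.Analysis"
begin

section \<open>Matrix functions and matrix polynomials\<close>

definition adj_mat :: "complex^'n^'n \<Rightarrow> complex^'n^'n" where
  "adj_mat A = map_matrix cnj (transpose A)"

definition pos_def :: "complex^'n^'n \<Rightarrow> bool" where
  "pos_def A \<longleftrightarrow> adj_mat A = A \<and>
     (\<forall>v. v \<noteq> 0 \<longrightarrow> 0 < Re (\<Sum>i\<in>UNIV. \<Sum>j\<in>UNIV. cnj (v $ i) * A $ i $ j * v $ j))"

text \<open>The \<open>j\<close>-th derivative of a function of a real variable. It is only used for
  functions that are smooth on the open interval under consideration.\<close>

definition nth_deriv :: "nat \<Rightarrow> (real \<Rightarrow> complex^'n^'n) \<Rightarrow> real \<Rightarrow> complex^'n^'n" where
  "nth_deriv j f = ((\<lambda>g x. vector_derivative g (at x)) ^^ j) f"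

definition smooth_matrix_on :: "real set \<Rightarrow> (real \<Rightarrow> complex^'n^'n) \<Rightarrow> bool" where
  "smooth_matrix_on I f \<longleftrightarrow> (\<forall>j. \<forall>x\<in>I. nth_deriv j f differentiable (at x))"

type_synonym 'n mat_poly = "complex poly^'n^'n"

definition mat_eval :: "'n mat_poly \<Rightarrow> real \<Rightarrow> complex^'n^'n" where
  "mat_eval P x = map_matrix (\<lambda>p. poly p (of_real x)) P"

definition mat_const :: "complex^'n^'n \<Rightarrow> 'n mat_poly" where
  "mat_const A = map_matrix (\<lambda>c. [:c:]) A"

definition mat_coeff :: "'n mat_poly \<Rightarrow> nat \<Rightarrow> complex^'n^'n" where
  "mat_coeff P k = map_matrix (\<lambda>p. coeff p k) P"

text \<open>The value at the zero polynomial is a dummy.\<close>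

definition mat_degree :: "'n::finite mat_poly \<Rightarrow> nat" where
  "mat_degree P = Max (range (\<lambda>(i, j). degree (P $ i $ j)))"

definition mat_pderiv :: "'n::finite mat_poly \<Rightarrow> 'n mat_poly" where
  "mat_pderiv = map_matrix pderiv"


section \<open>Weight matrices and monic orthogonal polynomials\<close>

definition open_interval :: "real set \<Rightarrow> bool" where
  "open_interval I \<longleftrightarrow> is_interval I \<and> open I \<and> I \<noteq> {}"

definition weight_matrix :: "real set \<Rightarrow> (real \<Rightarrow> complex^'n::finite^'n) \<Rightarrow> bool" where
  "weight_matrix I W \<longleftrightarrow> smooth_matrix_on I W \<and> (\<forall>x\<in>I. pos_def (W x)) \<and>
     (\<forall>k::nat. set_integrable lborel I (\<lambda>x. x ^ k *\<^sub>R W x))"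

text \<open>The pairing is defined for arbitrary matrix functions, not just for polynomials,
  because the adjoint operator in a Darboux transformation need not a priori map
  polynomials to polynomials.\<close>

definition mat_inner ::
  "real set \<Rightarrow> (real \<Rightarrow> complex^'n::finite^'n) \<Rightarrow> (real \<Rightarrow> complex^'n^'n) \<Rightarrow> (real \<Rightarrow> complex^'n^'n)
     \<Rightarrow> complex^'n^'n" where
  "mat_inner I W f g = (LINT x:I|lborel. f x ** W x ** adj_mat (g x))"

definition monic_orthogonal ::
  "real set \<Rightarrow> (real \<Rightarrow> complex^'n::finite^'n) \<Rightarrow> (nat \<Rightarrow> 'n mat_poly) \<Rightarrow> bool" where
  "monic_orthogonal I W P \<longleftrightarrow>
     (\<forall>n. mat_degree (P n) = n \<and> mat_coeff (P n) n = mat 1) \<and>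
     (\<forall>n m. n \<noteq> m \<longrightarrow> mat_inner I W (mat_eval (P n)) (mat_eval (P m)) = 0)"

definition mops :: "real set \<Rightarrow> (real \<Rightarrow> complex^'n::finite^'n) \<Rightarrow> nat \<Rightarrow> 'n mat_poly" where
  "mops I W = (THE P. monic_orthogonal I W P)"


section \<open>Differential operators acting on the right\<close>

text \<open>An operator \<open>\<Sum>i. \<partial>\<^sup>i F\<^sub>i\<close> with matrix polynomial coefficients is stored as the polynomial
  in \<open>\<partial>\<close> with \<open>i\<close>-th coefficient \<open>F\<^sub>i\<close>, so that \<open>degree D\<close> is the order of \<open>D\<close> and
  \<open>lead_coeff D\<close> is its leading coefficient. The outer polynomial type serves only as a type of
  finite coefficient sequences: its multiplication is not the product of operators.\<close>

type_synonym 'n diff_op = "(complex poly^'n^'n) poly"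

definition act_poly :: "'n::finite mat_poly \<Rightarrow> 'n diff_op \<Rightarrow> 'n mat_poly" where
  "act_poly P D = (\<Sum>i\<le>degree D. (mat_pderiv ^^ i) P ** coeff D i)"

definition act_fun ::
  "(real \<Rightarrow> complex^'n::finite^'n) \<Rightarrow> 'n diff_op \<Rightarrow> real \<Rightarrow> complex^'n^'n" where
  "act_fun f D x = (\<Sum>i\<le>degree D. nth_deriv i f x ** mat_eval (coeff D i) x)"

text \<open>The action \<open>f \<mapsto> f \<cdot> D\<^sup>*\<close> of the formal adjoint: as the adjoint reverses products,
  \<open>(\<partial>\<^sup>j F\<^sub>j)\<^sup>* = F\<^sub>j\<^sup>* (-\<partial>)\<^sup>j\<close>, which acts on the right.\<close>

definition act_formal_adjoint ::
  "(real \<Rightarrow> complex^'n::finite^'n) \<Rightarrow> 'n diff_op \<Rightarrow> real \<Rightarrow> complex^'n^'n" where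
  "act_formal_adjoint f D x =
     (\<Sum>j\<le>degree D. (-1) ^ j *\<^sub>R nth_deriv j (\<lambda>y. f y ** adj_mat (mat_eval (coeff D j) y)) x)"

definition bochner_algebra :: "real set \<Rightarrow> (real \<Rightarrow> complex^'n::finite^'n) \<Rightarrow> 'n diff_op set" where
  "bochner_algebra I W =
     {D. \<forall>n. \<exists>\<Lambda>. act_poly (mops I W n) D = mat_const \<Lambda> ** mops I W n}"

definition solves_bochner_problem :: "real set \<Rightarrow> (real \<Rightarrow> complex^'n::finite^'n) \<Rightarrow> bool" where
  "solves_bochner_problem I W \<longleftrightarrow> (\<exists>D \<in> bochner_algebra I W. degree D = 2)"


section \<open>Strong Darboux transformations\<close>

text \<open>The conjunct \<open>act_poly P V \<noteq> 0\<close> accounts for the convention that the zero polynomial has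
  degree \<open>-\<infinity>\<close>.\<close>

definition degree_preserving :: "'n::finite diff_op \<Rightarrow> bool" where
  "degree_preserving V \<longleftrightarrow>
     (\<forall>P. P \<noteq> 0 \<longrightarrow> act_poly P V \<noteq> 0 \<and> mat_degree (act_poly P V) = mat_degree P)"

text \<open>The action \<open>f \<mapsto> f \<cdot> (W\<^sub>2 V\<^sup>* W\<^sub>1\<^sup>-\<^sup>1)\<close>. For smooth weights this is, by the Leibniz rule, a
  differential operator with smooth coefficients.\<close>

definition act_darboux_adjoint ::
  "(real \<Rightarrow> complex^'n::finite^'n) \<Rightarrow> (real \<Rightarrow> complex^'n^'n) \<Rightarrow> 'n diff_op
     \<Rightarrow> (real \<Rightarrow> complex^'n^'n) \<Rightarrow> real \<Rightarrow> complex^'n^'n" where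
  "act_darboux_adjoint W1 W2 V f x =
     act_formal_adjoint (\<lambda>y. f y ** W2 y) V x ** matrix_inv (W1 x)"

text \<open>\<open>strong_darboux I W1 W2\<close>: \<open>W2\<close> is a strong Darboux transformation of \<open>W1\<close>. Equality of
  operators, as in \<open>D = V N\<close>, is equality of their actions on smooth matrix functions on \<open>I\<close>.
  The integrability requirement says that \<open>\<langle>P, Q \<cdot> N\<rangle>\<close> is a convergent integral; without
  it the integral of a non-integrable function would be \<open>0\<close> by convention.\<close>

definition strong_darboux ::
  "real set \<Rightarrow> (real \<Rightarrow> complex^'n::finite^'n) \<Rightarrow> (real \<Rightarrow> complex^'n^'n) \<Rightarrow> bool" where
  "strong_darboux I W1 W2 \<longleftrightarrow> open_interval I \<and> weight_matrix I W1 \<and> weight_matrix I W2 \<and>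
     (\<exists>V. degree_preserving V \<and> det (lead_coeff V) \<noteq> 0 \<and>
        (\<exists>D \<in> bochner_algebra I W1. \<forall>f. smooth_matrix_on I f \<longrightarrow>
           (\<forall>x\<in>I. act_fun f D x = act_darboux_adjoint W1 W2 V (act_fun f V) x)) \<and>
        (\<forall>P Q. set_integrable lborel I
              (\<lambda>x. mat_eval P x ** W1 x ** adj_mat (act_darboux_adjoint W1 W2 V (mat_eval Q) x)) \<and>
           mat_inner I W2 (mat_eval (act_poly P V)) (mat_eval Q)
             = mat_inner I W1 (mat_eval P) (act_darboux_adjoint W1 W2 V (mat_eval Q))))"

end

(* Write W = e^{-x^2} M. The matrix M factors as T T^* with T a unimodular polynomial matrix, so
   P -> P T maps the pairing of W isometrically to the one of e^{-x^2} I. Expressing the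
   orthogonal complement of (polynomials of degree < n) T inside (polynomials of degree <= n) T
   in Hermite polynomials, which are eigenfunctions of d^2 - 2x d, produces an operator V of order
   4 which sends the n-th Hermite polynomial to an invertible multiple of P_n. All that is needed
   about V is that it and its adjoint N = W V^* W0^{-1} have i-th coefficients of degree at most i:
   then P_n := (multiple of) H_n V is orthogonal to all lower degrees, and V N is in D(W0).
   Similarly an explicit W-symmetric operator of order 4 with coefficients of such degrees is in
   D(W).

   Conversely let D in D(W) have order < 4. Its eigenvalues Lambda_n are polynomials of degree < 4
   in n, and comparing coefficients of x^(n-1) in P_n D = Lambda_n P_n, where the subleading
   coefficient of P_n is a rational function of n with denominators b = 2 + a^2 n and
   c = b^3 - a^4 b + 2 a^4, forces Lambda_n = k Lambda_n(D4) + const, with D4 the operator of order 4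
   above. As an operator is determined by its eigenvalues, D = k D4 + const, so k = 0. *)

theory Submission
  imports Defs "HOL-Probability.Distributions"
begin

section \<open>Calculus of matrix functions\<close>

text \<open>The bound 4 comes from the subleading coefficient of P_n. It is antidiagonal with
  entries s/b and s/c up to scaling, where s is a polynomial in n of degree exactly 3 and b, c, s
  are pairwise coprime. After clearing denominators, coprimality splits the coefficient equations
  into divisibilities, and in each of them s divides a polynomial whose degree is at most the order
  of D. Below order 4 the quotient is therefore a constant. What remains are difference equations
  for the entries of Lambda_n with right sides that are constant multiples of b and c, and these are
  solved by comparing coefficients.

  On the analytic side nothing leaves the class of polynomial matrices times e^(-x^2): d/dx becomes
  \<open>gderiv\<close> on the polynomial factor, and integration by parts becomes the vanishing of
  the integral of such a derivative, which is a recurrence between Gaussian moments. Adjointness of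
  operators is thus a finite list of polynomial matrix identities, and boundary terms never
  occur.\<close>

lemma matrix_eq_sum_axis:
  fixes M :: "'a::comm_monoid_add^'n::finite^'m::finite"
  shows "M = (\<Sum>i\<in>UNIV. \<Sum>j\<in>UNIV. axis i (axis j (M $ i $ j)))"
proof -
  have "(\<Sum>i\<in>UNIV. \<Sum>j\<in>UNIV. axis i (axis j (M $ i $ j)) $ k $ l) = M $ k $ l" for k l
  proof -
    have "(\<Sum>j\<in>UNIV. axis i (axis j (M $ i $ j)) $ k $ l) = (if i = k then M $ k $ l else 0)" for i
      by (cases "k = i") (simp_all add: axis_def)
    then show ?thesis by simp
  qed
  then show ?thesis by (simp add: vec_eq_iff)
qed

lemma bounded_linear_axis_axis: "bounded_linear (\<lambda>c::complex. axis i (axis j c) :: complex^'n::finite^'m::finite)"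
  by (rule linear_conv_bounded_linear[THEN iffD1])
     (simp add: linear_iff vec_eq_iff axis_def)

lemma bounded_linear_entry: "bounded_linear (\<lambda>M::complex^'n::finite^'m::finite. M $ i $ j)"
  by (rule linear_conv_bounded_linear[THEN iffD1]) (simp add: linear_iff)

lemma bounded_bilinear_matrix_mult:
  "bounded_bilinear ((**) :: complex^'n::finite^'n \<Rightarrow> complex^'n^'n \<Rightarrow> complex^'n^'n)"
  by (rule bilinear_conv_bounded_bilinear[THEN iffD1])
     (simp add: bilinear_def linear_iff vec_eq_iff matrix_matrix_mult_def algebra_simps
        sum.distrib scaleR_sum_right)

lemmas matrix_mult_scaleR_left = bounded_bilinear.scaleR_left[OF bounded_bilinear_matrix_mult]
lemmas matrix_mult_scaleR_right = bounded_bilinear.scaleR_right[OF bounded_bilinear_matrix_mult]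

text \<open>Differentiation passes through finite sums and bounded linear maps, so it is enough to
  rebuild the matrix from its entries by \<open>matrix_eq_sum_axis\<close>.
  \<open>integrable_matrixI\<close> rests on the same decomposition.\<close>

lemma has_vector_derivative_matrixI:
  fixes f :: "real \<Rightarrow> complex^'n::finite^'m::finite"
  assumes "\<And>i j. ((\<lambda>x. f x $ i $ j) has_vector_derivative D $ i $ j) F"
  shows "(f has_vector_derivative D) F"
proof -
  have "((\<lambda>x. \<Sum>i\<in>UNIV. \<Sum>j\<in>UNIV. axis i (axis j (f x $ i $ j)) :: complex^'n^'m) has_vector_derivative
      (\<Sum>i\<in>UNIV. \<Sum>j\<in>UNIV. axis i (axis j (D $ i $ j)))) F"
    by (intro has_vector_derivative_sum
        bounded_linear.has_vector_derivative[OF bounded_linear_axis_axis] assms)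
  then show ?thesis by (simp flip: matrix_eq_sum_axis)
qed

lemma integrable_matrixI:
  fixes f :: "'b \<Rightarrow> complex^'n::finite^'m::finite"
  assumes "\<And>i j. integrable M (\<lambda>x. f x $ i $ j)"
  shows "integrable M f"
proof -
  have "integrable M (\<lambda>x. \<Sum>i\<in>UNIV. \<Sum>j\<in>UNIV. axis i (axis j (f x $ i $ j)) :: complex^'n^'m)"
    by (intro Bochner_Integration.integrable_sum integrable_bounded_linear[OF bounded_linear_axis_axis] assms)
  then show ?thesis by (simp flip: matrix_eq_sum_axis)
qed

lemma integral_entry:
  fixes f :: "'b \<Rightarrow> complex^'n::finite^'m::finite"
  assumes "integrable M f"
  shows "(integral\<^sup>L M f) $ i $ j = (LINT x|M. f x $ i $ j)"
  using integral_bounded_linear[OF bounded_linear_entry assms] by simp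

section \<open>Iterated derivatives and the Leibniz rule\<close>

lemma nth_deriv_0 [simp]: "nth_deriv 0 f = f"
  by (simp add: nth_deriv_def)

lemma nth_deriv_Suc: "nth_deriv (Suc j) f = (\<lambda>x. vector_derivative (nth_deriv j f) (at x))"
  by (simp add: nth_deriv_def)

lemma smooth_nth_deriv:
  assumes "smooth_matrix_on UNIV f"
  shows "(nth_deriv j f has_vector_derivative nth_deriv (Suc j) f x) (at x)"
  using assms vector_derivative_works[of "nth_deriv j f" "at x"]
  by (auto simp: smooth_matrix_on_def nth_deriv_Suc)

text \<open>A family in which each member has the next one as derivative is a table of all
  derivatives of \<open>g 0\<close>. Exhibiting such a table yields both a closed form for
  \<open>nth_deriv\<close> and smoothness.\<close>

lemma nth_deriv_eqI:
  assumes "\<And>j x. (g j has_vector_derivative g (Suc j) x) (at x)"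
  shows "nth_deriv j (g 0) = g j"
  by (induction j) (auto simp: nth_deriv_Suc intro!: vector_derivative_at assms)

lemma smooth_matrixI:
  assumes "\<And>j x. (g j has_vector_derivative g (Suc j) x) (at x)"
  shows "smooth_matrix_on UNIV (g 0)"
  unfolding smooth_matrix_on_def nth_deriv_eqI[of g, OF assms]
  using assms by (auto intro: differentiableI_vector)

text \<open>The Leibniz sums again form a table of derivatives; this is the passage from row j to
  row \<open>Suc j\<close>, ready for \<open>nth_deriv_eqI\<close>.\<close>

lemma leibniz_has_derivative:
  fixes g h :: "nat \<Rightarrow> real \<Rightarrow> complex^'n::finite^'n"
  assumes g: "\<And>j x. (g j has_vector_derivative g (Suc j) x) (at x)"
    and h: "\<And>j x. (h j has_vector_derivative h (Suc j) x) (at x)"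
  shows "((\<lambda>x. \<Sum>l\<le>j. real (j choose l) *\<^sub>R (g l x ** h (j - l) x)) has_vector_derivative
    (\<Sum>l\<le>Suc j. real (Suc j choose l) *\<^sub>R (g l x ** h (Suc j - l) x))) (at x)"
proof -
  define t where "t l = g l x ** h (Suc j - l) x" for l
  have "((\<lambda>x. \<Sum>l\<le>j. real (j choose l) *\<^sub>R (g l x ** h (j - l) x)) has_vector_derivative
    (\<Sum>l\<le>j. real (j choose l) *\<^sub>R (g l x ** h (Suc (j - l)) x + g (Suc l) x ** h (j - l) x))) (at x)"
    by (intro has_vector_derivative_sum
        bounded_linear.has_vector_derivative[OF bounded_linear_scaleR_right]
        bounded_bilinear.has_vector_derivative[OF bounded_bilinear_matrix_mult] g h)
  moreover have "(\<Sum>l\<le>j. real (j choose l) *\<^sub>R (g l x ** h (Suc (j - l)) x + g (Suc l) x ** h (j - l) x))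
      = (\<Sum>l\<le>j. real (j choose l) *\<^sub>R t l) + (\<Sum>l\<le>j. real (j choose l) *\<^sub>R t (Suc l))"
    by (simp add: t_def scaleR_add_right sum.distrib Suc_diff_le)
  \<comment> \<open>Pascal's rule splits row \<open>Suc j\<close>; the surplus top term drops out
    because \<open>j choose Suc j\<close> is 0.\<close>
  moreover have "(\<Sum>l\<le>Suc j. real (Suc j choose l) *\<^sub>R t l)
      = (\<Sum>l\<le>j. real (j choose l) *\<^sub>R t l) + (\<Sum>l\<le>j. real (j choose l) *\<^sub>R t (Suc l))"
  proof -
    have "(\<Sum>l\<le>Suc j. real (Suc j choose l) *\<^sub>R t l)
        = t 0 + (\<Sum>l\<le>j. real (j choose Suc l) *\<^sub>R t (Suc l)) + (\<Sum>l\<le>j. real (j choose l) *\<^sub>R t (Suc l))"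
      by (subst sum.atMost_Suc_shift) (simp add: algebra_simps sum.distrib)
    also have "t 0 + (\<Sum>l\<le>j. real (j choose Suc l) *\<^sub>R t (Suc l)) = (\<Sum>l\<le>Suc j. real (j choose l) *\<^sub>R t l)"
      by (subst sum.atMost_Suc_shift) simp
    also have "\<dots> = (\<Sum>l\<le>j. real (j choose l) *\<^sub>R t l)"
      by simp
    finally show ?thesis .
  qed
  ultimately show ?thesis by (simp add: t_def)
qed

lemma leibniz_nth_deriv:
  fixes g h :: "nat \<Rightarrow> real \<Rightarrow> complex^'n::finite^'n"
  assumes g: "\<And>j x. (g j has_vector_derivative g (Suc j) x) (at x)"
    and h: "\<And>j x. (h j has_vector_derivative h (Suc j) x) (at x)"
  shows "nth_deriv j (\<lambda>x. g 0 x ** h 0 x) = (\<lambda>x. \<Sum>l\<le>j. real (j choose l) *\<^sub>R (g l x ** h (j - l) x))"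
  using nth_deriv_eqI[of "\<lambda>j x. \<Sum>l\<le>j. real (j choose l) *\<^sub>R (g l x ** h (j - l) x)",
      OF leibniz_has_derivative[of g h, OF g h]] by simp

section \<open>Matrix polynomials\<close>

text \<open>The scalar lives in the entry ring, so for matrix polynomials it may itself be a
  polynomial, as in \<open>hermite_mat\<close>.\<close>

definition smat :: "'a::times \<Rightarrow> 'a^'n^'m \<Rightarrow> 'a^'n^'m" where
  "smat c A = map_matrix ((*) c) A"

definition adj_poly :: "'n::finite mat_poly \<Rightarrow> 'n mat_poly" where
  "adj_poly P = map_matrix (map_poly cnj) (transpose P)"

text \<open>Differentiation conjugated by the Gaussian: e^(-x^2) Q has derivative e^(-x^2)
  \<open>gderiv Q\<close>.\<close>

definition gderiv :: "'n::finite mat_poly \<Rightarrow> 'n mat_poly" where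
  "gderiv Q = map_matrix (\<lambda>p. pderiv p - [:0, 2:] * p) Q"

lemma poly_map_poly_cnj: "poly (map_poly cnj p) (of_real x) = cnj (poly p (of_real x))"
  by (induction p) (auto simp: map_poly_pCons)

lemma smat_nth [simp]: "smat c A $ i $ j = c * A $ i $ j"
  by (simp add: smat_def)

lemma mat_eval_nth [simp]: "mat_eval P x $ i $ j = poly (P $ i $ j) (of_real x)"
  by (simp add: mat_eval_def)

lemma mat_coeff_nth [simp]: "mat_coeff P k $ i $ j = coeff (P $ i $ j) k"
  by (simp add: mat_coeff_def)

lemma mat_const_nth [simp]: "mat_const A $ i $ j = [:A $ i $ j:]"
  by (simp add: mat_const_def)

lemma mat_pderiv_nth [simp]: "mat_pderiv P $ i $ j = pderiv (P $ i $ j)"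
  by (simp add: mat_pderiv_def)

lemma gderiv_nth [simp]: "gderiv P $ i $ j = pderiv (P $ i $ j) - [:0, 2:] * P $ i $ j"
  by (simp add: gderiv_def)

lemma adj_poly_nth [simp]: "adj_poly P $ i $ j = map_poly cnj (P $ j $ i)"
  by (simp add: adj_poly_def transpose_def)

lemma adj_mat_nth [simp]: "adj_mat A $ i $ j = cnj (A $ j $ i)"
  by (simp add: adj_mat_def transpose_def)

lemma mat_mult_nth: "(A ** B) $ i $ j = (\<Sum>k\<in>UNIV. A $ i $ k * B $ k $ j)"
  by (simp add: matrix_matrix_mult_def)

lemma mat_eval_mult: "mat_eval (A ** B) x = mat_eval A x ** mat_eval B x"
  by (simp add: vec_eq_iff mat_mult_nth poly_sum)

lemma mat_eval_add: "mat_eval (A + B) x = mat_eval A x + mat_eval B x"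
  by (simp add: vec_eq_iff)

lemma mat_eval_0 [simp]: "mat_eval 0 x = 0"
  by (simp add: vec_eq_iff)

lemma mat_eval_1 [simp]: "mat_eval (mat 1) x = mat 1"
  by (simp add: vec_eq_iff mat_def)

lemma mat_eval_sum: "mat_eval (sum f I) x = (\<Sum>i\<in>I. mat_eval (f i) x)"
  by (induction I rule: infinite_finite_induct) (auto simp: mat_eval_add)

lemma mat_eval_smat_of_nat: "mat_eval (smat (of_nat k) A) x = real k *\<^sub>R mat_eval A x"
  by (simp add: vec_eq_iff scaleR_conv_of_real[where 'a = complex])

lemma mat_eval_smat_of_int: "mat_eval (smat (of_int k) A) x = real_of_int k *\<^sub>R mat_eval A x"
  by (simp add: vec_eq_iff scaleR_conv_of_real[where 'a = complex])

lemma mat_eval_adj_poly: "mat_eval (adj_poly P) x = adj_mat (mat_eval P x)"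
  by (simp add: vec_eq_iff poly_map_poly_cnj)

text \<open>A nonzero entry of the difference would have finitely many roots, yet it vanishes on the
  whole real line. This carries identities of matrix functions back to matrix polynomials.\<close>

lemma mat_eval_inject:
  assumes "\<And>x. mat_eval P x = mat_eval Q x"
  shows "P = Q"
proof -
  have "P $ i $ j = Q $ i $ j" for i j
  proof (rule ccontr)
    assume "P $ i $ j \<noteq> Q $ i $ j"
    then have "finite {z. poly (P $ i $ j - Q $ i $ j) z = 0}"
      by (intro poly_roots_finite) simp
    moreover have "range of_real \<subseteq> {z. poly (P $ i $ j - Q $ i $ j) z = 0}"
      using arg_cong[OF assms, of "\<lambda>A. A $ i $ j"] by auto
    ultimately have "finite (range (of_real :: real \<Rightarrow> complex))"
      by (rule finite_subset[rotated])
    then show False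
      by (simp add: finite_image_iff inj_of_real infinite_UNIV_char_0)
  qed
  then show ?thesis by (simp add: vec_eq_iff)
qed

lemma poly_of_real_has_vector_derivative:
  "((\<lambda>x. poly p (of_real x)) has_vector_derivative poly (pderiv p) (of_real x)) (at x)"
  for p :: "complex poly"
  by (rule has_vector_derivative_real_field[OF poly_DERIV])

lemma mat_eval_has_vector_derivative:
  "(mat_eval P has_vector_derivative mat_eval (mat_pderiv P) x) (at x)"
  by (rule has_vector_derivative_matrixI) (simp add: poly_of_real_has_vector_derivative)

lemma mat_eval_higher_has_vector_derivative:
  "(mat_eval ((mat_pderiv ^^ j) P) has_vector_derivative mat_eval ((mat_pderiv ^^ Suc j) P) x) (at x)"
  using mat_eval_has_vector_derivative by simp

lemma nth_deriv_mat_eval: "nth_deriv j (mat_eval P) = mat_eval ((mat_pderiv ^^ j) P)"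
  using nth_deriv_eqI[of "\<lambda>j. mat_eval ((mat_pderiv ^^ j) P)", OF mat_eval_higher_has_vector_derivative]
  by simp

lemma smooth_mat_eval: "smooth_matrix_on UNIV (mat_eval P)"
  using smooth_matrixI[of "\<lambda>j. mat_eval ((mat_pderiv ^^ j) P)", OF mat_eval_higher_has_vector_derivative]
  by simp

lemma gauss_has_vector_derivative:
  "((\<lambda>x. exp (- x\<^sup>2) *\<^sub>R mat_eval P x) has_vector_derivative exp (- x\<^sup>2) *\<^sub>R mat_eval (gderiv P) x) (at x)"
proof -
  have "((\<lambda>x::real. exp (- x\<^sup>2)) has_field_derivative - (2 * x) * exp (- x\<^sup>2)) (at x)"
    by (auto intro!: derivative_eq_intros)
  from has_vector_derivative_scaleR[OF this mat_eval_has_vector_derivative]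
  show ?thesis
    by (rule has_vector_derivative_eq_rhs) (simp add: vec_eq_iff algebra_simps scaleR_conv_of_real[where 'a = complex])
qed

lemma gauss_higher_has_vector_derivative:
  "((\<lambda>x. exp (- x\<^sup>2) *\<^sub>R mat_eval ((gderiv ^^ j) P) x) has_vector_derivative
    exp (- x\<^sup>2) *\<^sub>R mat_eval ((gderiv ^^ Suc j) P) x) (at x)"
  using gauss_has_vector_derivative by simp

lemma nth_deriv_gauss:
  "nth_deriv j (\<lambda>x. exp (- x\<^sup>2) *\<^sub>R mat_eval P x) = (\<lambda>x. exp (- x\<^sup>2) *\<^sub>R mat_eval ((gderiv ^^ j) P) x)"
  using nth_deriv_eqI[of "\<lambda>j x. exp (- x\<^sup>2) *\<^sub>R mat_eval ((gderiv ^^ j) P) x", OF gauss_higher_has_vector_derivative]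
  by simp

lemma smooth_gauss: "smooth_matrix_on UNIV (\<lambda>x. exp (- x\<^sup>2) *\<^sub>R mat_eval P x)"
  using smooth_matrixI[of "\<lambda>j x. exp (- x\<^sup>2) *\<^sub>R mat_eval ((gderiv ^^ j) P) x", OF gauss_higher_has_vector_derivative]
  by simp

section \<open>Gaussian integrals\<close>

lemma gaussian_moment_has_integral:
  "has_bochner_integral lborel (\<lambda>x::real. exp (- x\<^sup>2) * x ^ (2 * k)) (sqrt pi * (fact (2 * k) / (2 ^ (2 * k) * fact k)))"
  "has_bochner_integral lborel (\<lambda>x::real. exp (- x\<^sup>2) * x ^ (2 * k + 1)) 0"
proof -
  show "has_bochner_integral lborel (\<lambda>x::real. exp (- x\<^sup>2) * x ^ (2 * k)) (sqrt pi * (fact (2 * k) / (2 ^ (2 * k) * fact k)))"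
    using has_bochner_integral_even_function[OF gaussian_moment_even_pos[where k=k]] by simp
  show "has_bochner_integral lborel (\<lambda>x::real. exp (- x\<^sup>2) * x ^ (2 * k + 1)) 0"
    using gaussian_moment_odd_pos by (rule has_bochner_integral_odd_function) simp
qed

definition gmom :: "nat \<Rightarrow> real" where
  "gmom k = (LINT x|lborel. exp (- x\<^sup>2) * x ^ k)"

lemma integrable_gaussian_moment: "integrable lborel (\<lambda>x::real. exp (- x\<^sup>2) * x ^ k)"
  using gaussian_moment_has_integral[of "k div 2"]
  by (cases "even k") (auto elim!: evenE oddE intro: integrable.intros)

lemma gmom_even: "gmom (2 * k) = sqrt pi * (fact (2 * k) / (2 ^ (2 * k) * fact k))"
  and gmom_odd: "gmom (2 * k + 1) = 0"
  using gaussian_moment_has_integral[of k] by (auto simp: gmom_def intro: has_bochner_integral_integral_eq)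

text \<open>Integration by parts for x^k, read off from the explicit moments. At k = 0 the truncated
  \<open>k - 1\<close> is harmless because its factor is 0.\<close>

lemma gmom_rec: "2 * gmom (Suc k) = of_nat k * gmom (k - 1)"
proof (cases "even k")
  case True
  then obtain l where k: "k = 2 * l" by (elim evenE)
  show ?thesis
  proof (cases l)
    case 0
    then show ?thesis using gmom_odd[of 0] k by simp
  next
    case (Suc m)
    then show ?thesis using gmom_odd[of l] gmom_odd[of m] k by simp
  qed
next
  case False
  then obtain l where k: "k = 2 * l + 1" by (elim oddE)
  have "2 * gmom (2 * Suc l) = real (2 * l + 1) * gmom (2 * l)"
    unfolding gmom_even
    by (simp add: field_simps del: of_nat_Suc)
       (simp add: algebra_simps)
  then show ?thesis using k by simp
qed

definition gint :: "complex poly \<Rightarrow> complex" where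
  "gint p = (LINT x|lborel. exp (- x\<^sup>2) *\<^sub>R poly p (of_real x))"

lemma integrable_gauss_poly: "integrable lborel (\<lambda>x. exp (- x\<^sup>2) *\<^sub>R poly p (complex_of_real x))"
proof -
  have "integrable lborel (\<lambda>x. \<Sum>i\<le>degree p. (exp (- x\<^sup>2) * x ^ i) *\<^sub>R coeff p i)"
    by (intro Bochner_Integration.integrable_sum integrable_scaleR_left integrable_gaussian_moment)
  then show ?thesis
    by (simp add: poly_altdef scaleR_conv_of_real sum_distrib_left algebra_simps)
qed

lemma gint_add: "gint (p + q) = gint p + gint q"
  using Bochner_Integration.integral_add[OF integrable_gauss_poly integrable_gauss_poly, of p q]
  by (simp add: gint_def scaleR_add_right)

lemma gint_diff: "gint (p - q) = gint p - gint q"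
  using Bochner_Integration.integral_diff[OF integrable_gauss_poly integrable_gauss_poly, of p q]
  by (simp add: gint_def scaleR_diff_right)

lemma gint_smult: "gint (smult c p) = c * gint p"
  by (simp add: gint_def flip: integral_mult_right_zero)

lemma gint_0 [simp]: "gint 0 = 0"
  by (simp add: gint_def)

lemma gint_sum: "gint (sum f I) = (\<Sum>i\<in>I. gint (f i))"
  by (induction I rule: infinite_finite_induct) (auto simp: gint_add)

lemma gint_cnj: "gint (map_poly cnj p) = cnj (gint p)"
  unfolding gint_def using integral_bounded_linear[OF bounded_linear_cnj integrable_gauss_poly, of p]
  by (simp add: poly_map_poly_cnj complex_cnj_scaleR)

lemma gint_monom: "gint (monom c k) = c * of_real (gmom k)"
proof -
  have "gint (monom c k) = (LINT x|lborel. (exp (- x\<^sup>2) * x ^ k) *\<^sub>R c)"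
    unfolding gint_def by (intro arg_cong[where f = "integral\<^sup>L lborel"] ext)
      (simp add: poly_monom scaleR_conv_of_real)
  also have "\<dots> = gmom k *\<^sub>R c"
    unfolding gmom_def by (rule integral_scaleR_left) (simp add: integrable_gaussian_moment)
  finally show ?thesis by (simp add: scaleR_conv_of_real)
qed

lemma pderiv_sum: "pderiv (sum f I) = (\<Sum>i\<in>I. pderiv (f i))"
  by (induction I rule: infinite_finite_induct) (auto simp: pderiv_add)

text \<open>The integrand is the derivative of e^(-x^2) p. By linearity only monomials matter, and
  for them the claim is \<open>gmom_rec\<close>.\<close>

lemma gint_gderiv: "gint (pderiv p - [:0, 2:] * p) = 0"
proof -
  have monom: "gint (pderiv (monom c k)) - gint ([:0, 2:] * monom c k) = 0" for c k
  proof -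
    have "[:0, 2:] * monom c k = monom (2 * c) (Suc k)"
      by (simp add: monom_Suc smult_monom)
    then have "gint (pderiv (monom c k)) - gint ([:0, 2:] * monom c k)
        = c * of_real (of_nat k * gmom (k - 1) - 2 * gmom (Suc k))"
      by (simp add: pderiv_monom gint_monom algebra_simps)
    then show ?thesis using gmom_rec[of k] by simp
  qed
  have "gint (pderiv p - [:0, 2:] * p) = gint (pderiv (\<Sum>i\<le>degree p. monom (coeff p i) i) - [:0, 2:] * (\<Sum>i\<le>degree p. monom (coeff p i) i))"
    by (simp only: poly_as_sum_of_monoms)
  also have "\<dots> = (\<Sum>i\<le>degree p. gint (pderiv (monom (coeff p i) i)) - gint ([:0, 2:] * monom (coeff p i) i))"
    by (simp only: gint_diff gint_sum pderiv_sum sum_distrib_left sum_subtractf)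
  finally show ?thesis by (simp only: monom sum.neutral_const)
qed

lemma gint_square:
  "gint (p * map_poly cnj p) = of_real (LINT x|lborel. exp (- x\<^sup>2) * (cmod (poly p (of_real x)))\<^sup>2)"
  "integrable lborel (\<lambda>x. exp (- x\<^sup>2) * (cmod (poly p (of_real x)))\<^sup>2)"
proof -
  define f where "f x = exp (- x\<^sup>2) * (cmod (poly p (of_real x)))\<^sup>2" for x :: real
  have f: "of_real (f x) = exp (- x\<^sup>2) *\<^sub>R poly (p * map_poly cnj p) (complex_of_real x)" for x
    by (simp add: f_def poly_map_poly_cnj scaleR_conv_of_real complex_norm_square[unfolded of_real_power] del: of_real_exp)
  have "integrable lborel (\<lambda>x. complex_of_real (f x))"
    unfolding f by (rule integrable_gauss_poly)
  then show "integrable lborel f"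
    by (simp add: complex_of_real_integrable_eq)
  show "gint (p * map_poly cnj p) = of_real (integral\<^sup>L lborel f)"
    unfolding gint_def f[symmetric] by simp
qed

text \<open>The integrand is nonnegative, so p vanishes almost everywhere on the line, whereas the
  roots of a nonzero p form a finite and hence null set.\<close>

lemma gint_definite:
  assumes "gint (p * map_poly cnj p) = 0"
  shows "p = 0"
proof (rule ccontr)
  assume p: "p \<noteq> 0"
  have "AE x in lborel. exp (- x\<^sup>2) * (cmod (poly p (of_real x)))\<^sup>2 = 0"
    using integral_nonneg_eq_0_iff_AE[OF gint_square(2)[of p]] assms by (simp add: gint_square(1))
  moreover have "countable {x::real. poly p (of_real x) = 0}"
    using finite_vimageI[OF poly_roots_finite[OF p], of "of_real :: real \<Rightarrow> complex"]
    by (intro countable_finite) (simp add: inj_of_real vimage_def)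
  then have "AE x in lborel. x \<notin> {x::real. poly p (of_real x) = 0}"
    by (intro AE_not_in countable_imp_null_set_lborel)
  ultimately have "AE x::real in lborel. False"
    by eventually_elim auto
  then show False by (simp add: eventually_False ae_filter_eq_bot_iff)
qed

lemma gint_square_nonneg: "gint (p * map_poly cnj p) = of_real (Re (gint (p * map_poly cnj p)))"
  "0 \<le> Re (gint (p * map_poly cnj p))"
  unfolding gint_square(1) by (auto intro!: Bochner_Integration.integral_nonneg)

section \<open>The matrix-valued Gaussian integral and integration by parts\<close>

definition glin :: "'n::finite mat_poly \<Rightarrow> complex^'n^'n" where
  "glin Q = map_matrix gint Q"

lemma glin_nth [simp]: "glin Q $ i $ j = gint (Q $ i $ j)"
  by (simp add: glin_def)

lemma integrable_gauss_mat: "integrable lborel (\<lambda>x. exp (- x\<^sup>2) *\<^sub>R mat_eval Q x)"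
  by (rule integrable_matrixI) (simp add: integrable_gauss_poly)

lemma integral_gauss_mat: "(LINT x|lborel. exp (- x\<^sup>2) *\<^sub>R mat_eval Q x) = glin Q"
  by (simp add: vec_eq_iff integral_entry[OF integrable_gauss_mat] gint_def)

lemma glin_add: "glin (A + B) = glin A + glin B"
  by (simp add: vec_eq_iff gint_add)

lemma glin_diff: "glin (A - B) = glin A - glin B"
  by (simp add: vec_eq_iff gint_diff)

lemma glin_0 [simp]: "glin 0 = 0"
  by (simp add: vec_eq_iff)

lemma glin_sum: "glin (sum f I) = (\<Sum>i\<in>I. glin (f i))"
  by (induction I rule: infinite_finite_induct) (auto simp: glin_add)

lemma glin_const_left: "glin (mat_const C ** A) = C ** glin A"
  by (simp add: vec_eq_iff mat_mult_nth gint_sum gint_smult)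

lemma glin_adj_poly: "glin (adj_poly A) = adj_mat (glin A)"
  by (simp add: vec_eq_iff gint_cnj)

lemma glin_gderiv: "glin (gderiv A) = 0"
  unfolding vec_eq_iff glin_nth gderiv_nth gint_gderiv by simp

lemma gderiv_mult: "gderiv (A ** B) = mat_pderiv A ** B + A ** gderiv B"
proof -
  have "pderiv (\<Sum>k\<in>UNIV. A $ i $ k * B $ k $ j) - [:0, 2:] * (\<Sum>k\<in>UNIV. A $ i $ k * B $ k $ j) =
     (\<Sum>k\<in>UNIV. pderiv (A $ i $ k) * B $ k $ j) + (\<Sum>k\<in>UNIV. A $ i $ k * (pderiv (B $ k $ j) - [:0, 2:] * B $ k $ j))" for i j
    unfolding sum.distrib[symmetric] sum_distrib_left pderiv_sum sum_subtractf[symmetric]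
    by (intro sum.cong refl) (simp only: pderiv_mult right_diff_distrib, simp only: algebra_simps)
  then show ?thesis
    by (simp only: vec_eq_iff mat_mult_nth gderiv_nth mat_pderiv_nth vector_add_component simp_thms)
qed

text \<open>By the product rule \<open>gderiv_mult\<close> the two sides differ by the integral of a
  full Gaussian derivative, which is zero.\<close>

lemma glin_pderiv_left: "glin (mat_pderiv A ** B) = - glin (A ** gderiv B)"
  using glin_gderiv[of "A ** B"] unfolding gderiv_mult glin_add by (simp add: eq_neg_iff_add_eq_0)

lemma glin_higher_pderiv_left: "glin ((mat_pderiv ^^ j) A ** B) = (-1) ^ j *\<^sub>R glin (A ** (gderiv ^^ j) B)"
proof (induction j arbitrary: B)
  case (Suc j)
  have "glin ((mat_pderiv ^^ Suc j) A ** B) = - glin ((mat_pderiv ^^ j) A ** gderiv B)"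
    by (simp add: glin_pderiv_left)
  also have "\<dots> = - ((-1) ^ j *\<^sub>R glin (A ** (gderiv ^^ Suc j) B))"
    unfolding Suc by (simp add: funpow_swap1)
  finally show ?case by simp
qed simp

lemma adj_poly_adj_poly [simp]: "adj_poly (adj_poly A) = A"
  by (simp add: vec_eq_iff map_poly_map_poly o_def)

lemma map_poly_cnj_mult: "map_poly cnj (p * q) = map_poly cnj p * map_poly cnj q"
  by (rule poly_eqI) (simp add: coeff_map_poly coeff_mult)

lemma map_poly_cnj_add: "map_poly cnj (p + q) = map_poly cnj p + map_poly cnj q"
  by (rule poly_eqI) (simp add: coeff_map_poly)

lemma map_poly_cnj_sum: "map_poly cnj (sum f I) = (\<Sum>i\<in>I. map_poly cnj (f i))"
  by (induction I rule: infinite_finite_induct) (auto simp: map_poly_cnj_add)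

lemma map_poly_cnj_pderiv: "map_poly cnj (pderiv p) = pderiv (map_poly cnj p)"
  by (rule poly_eqI) (simp add: coeff_map_poly coeff_pderiv)

lemma adj_poly_mult: "adj_poly (A ** B) = adj_poly B ** adj_poly A"
  by (simp add: vec_eq_iff mat_mult_nth map_poly_cnj_sum map_poly_cnj_mult mult.commute)

lemma adj_poly_add: "adj_poly (A + B) = adj_poly A + adj_poly B"
  by (simp add: vec_eq_iff map_poly_cnj_add)

lemma adj_poly_sum: "adj_poly (sum f I) = (\<Sum>i\<in>I. adj_poly (f i))"
  by (induction I rule: infinite_finite_induct) (auto simp: adj_poly_add vec_eq_iff)

lemma adj_poly_smat_of_int: "adj_poly (smat (of_int c) A) = smat (of_int c) (adj_poly A)"
  by (simp add: vec_eq_iff poly_eq_iff of_int_poly coeff_map_poly)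

lemma adj_poly_gderiv: "adj_poly (gderiv A) = gderiv (adj_poly A)"
proof -
  have "map_poly cnj (p - q) = map_poly cnj p - map_poly cnj q" for p q
    by (rule poly_eqI) (simp add: coeff_map_poly)
  then show ?thesis
    by (simp only: vec_eq_iff adj_poly_nth gderiv_nth map_poly_cnj_mult map_poly_cnj_pderiv)
      (simp add: map_poly_pCons)
qed

lemma adj_poly_higher_gderiv: "adj_poly ((gderiv ^^ j) A) = (gderiv ^^ j) (adj_poly A)"
  by (induction j) (simp_all add: adj_poly_gderiv)

section \<open>The pairing of a Gaussian weight\<close>

definition gweight :: "'n::finite mat_poly \<Rightarrow> real \<Rightarrow> complex^'n^'n" where
  "gweight M x = exp (- x\<^sup>2) *\<^sub>R mat_eval M x"

definition ip :: "'n::finite mat_poly \<Rightarrow> 'n mat_poly \<Rightarrow> 'n mat_poly \<Rightarrow> complex^'n^'n" where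
  "ip M P Q = glin (P ** M ** adj_poly Q)"

lemma gweight_eval: "mat_eval P x ** gweight M x ** adj_mat (mat_eval Q x)
    = exp (- x\<^sup>2) *\<^sub>R mat_eval (P ** M ** adj_poly Q) x"
  by (simp add: gweight_def mat_eval_mult mat_eval_adj_poly matrix_mult_scaleR_left matrix_mult_scaleR_right)

lemma mat_inner_gweight: "mat_inner UNIV (gweight M) (mat_eval P) (mat_eval Q) = ip M P Q"
  by (simp add: mat_inner_def gweight_eval integral_gauss_mat ip_def set_lebesgue_integral_def)

lemma matrix_add_rdistrib: "(A + B) ** C = A ** C + B ** C" for A B C :: "'a::semiring_1^'n::finite^'n"
  by (simp add: vec_eq_iff mat_mult_nth distrib_right sum.distrib)

lemma matrix_mult_0 [simp]: "0 ** C = 0" "C ** 0 = 0" for C :: "'a::semiring_1^'n::finite^'n"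
  by (simp_all add: vec_eq_iff mat_mult_nth)

lemma matrix_sum_rdistrib: "sum f I ** C = (\<Sum>i\<in>I. f i ** C)" for f :: "'b \<Rightarrow> 'a::semiring_1^'n::finite^'n" and C :: "'a^'n^'n"
  by (induction I rule: infinite_finite_induct) (simp_all add: matrix_add_rdistrib)

lemma matrix_sum_ldistrib: "C ** sum f I = (\<Sum>i\<in>I. C ** f i)" for f :: "'b \<Rightarrow> 'a::semiring_1^'n::finite^'n" and C :: "'a^'n^'n"
  by (induction I rule: infinite_finite_induct) (simp_all add: matrix_add_ldistrib)

lemma ip_add_left: "ip M (P + P') Q = ip M P Q + ip M P' Q"
  by (simp add: ip_def glin_add matrix_add_rdistrib)

lemma matrix_diff_rdistrib: "(A - B) ** C = A ** C - B ** C" for A B C :: "'a::ring_1^'n::finite^'n"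
  by (simp add: vec_eq_iff mat_mult_nth left_diff_distrib sum_subtractf)

lemma matrix_diff_ldistrib: "C ** (A - B) = C ** A - C ** B" for A B C :: "'a::ring_1^'n::finite^'n"
  by (simp add: vec_eq_iff mat_mult_nth right_diff_distrib sum_subtractf)

lemma ip_diff_left: "ip M (P - P') Q = ip M P Q - ip M P' Q"
  by (simp add: ip_def glin_diff matrix_diff_rdistrib)

lemma ip_const_left: "ip M (mat_const C ** P) Q = C ** ip M P Q"
  unfolding ip_def by (simp add: glin_const_left flip: matrix_mul_assoc)

lemma ip_herm:
  assumes "adj_poly M = M"
  shows "adj_mat (ip M P Q) = ip M Q P"
  unfolding ip_def glin_adj_poly[symmetric] by (simp add: adj_poly_mult assms matrix_mul_assoc)

lemma adj_mat_0 [simp]: "adj_mat 0 = 0"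
  by (simp add: vec_eq_iff)

lemma ip_eq_0_sym:
  assumes "adj_poly M = M" "ip M P Q = 0"
  shows "ip M Q P = 0"
  using ip_herm[OF assms(1), of P Q] assms(2) by simp

text \<open>With S = R T the pairing is the Gaussian integral of S times its adjoint. Each diagonal
  entry is a sum of squared norms of the entries in one row of S, so all of S vanishes, and T is
  cancelled by its right inverse.\<close>

lemma ip_definite:
  assumes M: "M = T ** adj_poly T" and T: "T ** T' = mat 1" and R: "ip M R R = 0"
  shows "R = 0"
proof -
  define S where "S = R ** T"
  have "glin (S ** adj_poly S) = 0"
    using R by (simp add: ip_def S_def M adj_poly_mult matrix_mul_assoc)
  then have "glin (S ** adj_poly S) $ i $ i = 0" for i
    by simp
  then have *: "(\<Sum>k\<in>UNIV. gint (S $ i $ k * map_poly cnj (S $ i $ k))) = 0" for i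
    by (simp add: mat_mult_nth gint_sum)
  have "S $ i $ k = 0" for i k
  proof -
    have "(\<Sum>k\<in>UNIV. Re (gint (S $ i $ k * map_poly cnj (S $ i $ k)))) = 0"
      using arg_cong[OF *[of i], of Re] by simp
    then have "Re (gint (S $ i $ k * map_poly cnj (S $ i $ k))) = 0"
      by (subst (asm) sum_nonneg_eq_0_iff) (auto simp: gint_square_nonneg(2))
    then show ?thesis
      using gint_square_nonneg(1)[of "S $ i $ k"] by (intro gint_definite) simp
  qed
  then have "R ** T = 0" by (simp add: S_def[symmetric] vec_eq_iff)
  then have "R ** (T ** T') = 0" by (simp add: matrix_mul_assoc vec_eq_iff mat_mult_nth)
  then show ?thesis by (simp add: T)
qed

section \<open>Differential operators\<close>

text \<open>Padding with zero coefficients lets operators of different orders share one range of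
  summation.\<close>

lemma act_fun_upto:
  assumes "degree D \<le> m"
  shows "act_fun f D x = (\<Sum>i\<le>m. nth_deriv i f x ** mat_eval (coeff D i) x)"
  unfolding act_fun_def using assms
  by (intro sum.mono_neutral_left) (auto simp: coeff_eq_0 vec_eq_iff mat_mult_nth)

lemma act_poly_upto:
  assumes "degree D \<le> m"
  shows "act_poly P D = (\<Sum>i\<le>m. (mat_pderiv ^^ i) P ** coeff D i)"
  unfolding act_poly_def using assms
  by (intro sum.mono_neutral_left) (auto simp: coeff_eq_0 vec_eq_iff mat_mult_nth)

lemma act_fun_add: "act_fun f (D + E) x = act_fun f D x + act_fun f E x"
proof -
  have "degree (D + E) \<le> max (degree D) (degree E)" by (rule degree_add_le_max)
  then show ?thesis
    by (simp add: act_fun_upto[of _ "max (degree D) (degree E)"] mat_eval_add matrix_add_ldistrib sum.distrib)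
qed

lemma act_fun_0 [simp]: "act_fun f 0 x = 0"
  by (simp add: act_fun_def vec_eq_iff mat_mult_nth)

lemma act_fun_sum: "act_fun f (sum D I) x = (\<Sum>i\<in>I. act_fun f (D i) x)"
  by (induction I rule: infinite_finite_induct) (auto simp: act_fun_add)

lemma act_fun_monom: "act_fun f (monom F k) x = nth_deriv k f x ** mat_eval F x"
proof -
  have "act_fun f (monom F k) x = (\<Sum>i\<le>k. if i = k then nth_deriv k f x ** mat_eval F x else 0)"
    unfolding act_fun_upto[OF degree_monom_le] by (intro sum.cong) (auto simp: vec_eq_iff mat_mult_nth)
  then show ?thesis by simp
qed

lemma act_fun_mat_eval: "act_fun (mat_eval P) D x = mat_eval (act_poly P D) x"
  by (simp add: act_fun_def act_poly_def nth_deriv_mat_eval mat_eval_sum mat_eval_mult)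

text \<open>The operator D followed by E: the l-th derivative of f^(i) F_i, with F_i the
  coefficients of D, is expanded by Leibniz and then multiplied by the l-th coefficient of
  E.\<close>

definition op_comp :: "'n::finite diff_op \<Rightarrow> 'n diff_op \<Rightarrow> 'n diff_op" where
  "op_comp D E = (\<Sum>l\<le>degree E. \<Sum>i\<le>degree D. \<Sum>k\<le>l.
     monom (smat (of_nat (l choose k)) ((mat_pderiv ^^ (l - k)) (coeff D i) ** coeff E l)) (k + i))"

lemma
  assumes f: "smooth_matrix_on UNIV f"
  shows smooth_act_fun: "smooth_matrix_on UNIV (act_fun f D)"
    and act_fun_op_comp: "act_fun (act_fun f D) E x = act_fun f (op_comp D E) x"
proof -
  \<comment> \<open>\<open>G l\<close> is the Leibniz expansion of the l-th derivative of f acted on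
    by D; the family is a table of derivatives.\<close>
  define G where "G l x = (\<Sum>i\<le>degree D. \<Sum>k\<le>l. real (l choose k) *\<^sub>R
    (nth_deriv (k + i) f x ** mat_eval ((mat_pderiv ^^ (l - k)) (coeff D i)) x))" for l x
  have "(G l has_vector_derivative G (Suc l) x) (at x)" for l x
    unfolding G_def
  proof (intro has_vector_derivative_sum)
    fix i
    show "((\<lambda>x. \<Sum>k\<le>l. real (l choose k) *\<^sub>R (nth_deriv (k + i) f x ** mat_eval ((mat_pderiv ^^ (l - k)) (coeff D i)) x))
      has_vector_derivative (\<Sum>k\<le>Suc l. real (Suc l choose k) *\<^sub>R
        (nth_deriv (k + i) f x ** mat_eval ((mat_pderiv ^^ (Suc l - k)) (coeff D i)) x))) (at x)"
      by (rule leibniz_has_derivative[of "\<lambda>k. nth_deriv (k + i) f" "\<lambda>k. mat_eval ((mat_pderiv ^^ k) (coeff D i))"])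
        (use smooth_nth_deriv[OF f] mat_eval_higher_has_vector_derivative in auto)
  qed
  note G = nth_deriv_eqI[of G, OF this] smooth_matrixI[of G, OF this]
  have G0: "G 0 = act_fun f D"
    by (simp add: fun_eq_iff G_def act_fun_def)
  then show "smooth_matrix_on UNIV (act_fun f D)"
    using G by simp
  have "act_fun (act_fun f D) E x = (\<Sum>l\<le>degree E. G l x ** mat_eval (coeff E l) x)"
    by (simp add: act_fun_def[of "act_fun f D"] G(1)[unfolded G0])
  also have "\<dots> = act_fun f (op_comp D E) x"
    by (simp add: op_comp_def G_def act_fun_sum act_fun_monom mat_eval_smat_of_nat mat_eval_mult
        matrix_mult_scaleR_left matrix_mult_scaleR_right matrix_mul_assoc
        matrix_sum_rdistrib)
  finally show "act_fun (act_fun f D) E x = act_fun f (op_comp D E) x" .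
qed

lemma act_poly_op_comp: "act_poly P (op_comp D E) = act_poly (act_poly P D) E"
proof (rule mat_eval_inject)
  fix x
  have "act_fun (mat_eval P) D = mat_eval (act_poly P D)"
    by (simp add: fun_eq_iff act_fun_mat_eval)
  then show "mat_eval (act_poly P (op_comp D E)) x = mat_eval (act_poly (act_poly P D) E) x"
    using act_fun_op_comp[OF smooth_mat_eval, of P D E x] by (simp add: act_fun_mat_eval)
qed

section \<open>The adjoint with respect to Gaussian weights\<close>

text \<open>The coefficient of f^(l) when the formal adjoint of D acts on f M e^(-x^2), with the
  Gaussian factored out: Leibniz distributes the j derivatives between f and the Gaussian
  part.\<close>

definition gadj_coeff :: "'n::finite mat_poly \<Rightarrow> 'n diff_op \<Rightarrow> nat \<Rightarrow> 'n mat_poly" where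
  "gadj_coeff M D l = (\<Sum>j\<in>{l..degree D}. smat (of_int ((-1) ^ j * int (j choose l)))
     ((gderiv ^^ (j - l)) (M ** adj_poly (coeff D j))))"

lemma act_formal_adjoint_gweight:
  assumes f: "smooth_matrix_on UNIV f"
  shows "act_formal_adjoint (\<lambda>y. f y ** gweight M y) D x
    = exp (- x\<^sup>2) *\<^sub>R (\<Sum>l\<le>degree D. nth_deriv l f x ** mat_eval (gadj_coeff M D l) x)"
proof -
  define B where "B j = M ** adj_poly (coeff D j)" for j
  have eq: "f y ** gweight M y ** adj_mat (mat_eval (coeff D j) y) = f y ** (exp (- y\<^sup>2) *\<^sub>R mat_eval (B j) y)" for j y
    by (simp add: B_def gweight_def mat_eval_mult mat_eval_adj_poly matrix_mult_scaleR_left matrix_mult_scaleR_right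
        matrix_mul_assoc)
  have nd: "nth_deriv j (\<lambda>y. f y ** (exp (- y\<^sup>2) *\<^sub>R mat_eval (B j) y))
     = (\<lambda>x. \<Sum>l\<le>j. real (j choose l) *\<^sub>R (nth_deriv l f x ** (exp (- x\<^sup>2) *\<^sub>R mat_eval ((gderiv ^^ (j - l)) (B j)) x)))" for j
    using leibniz_nth_deriv[of "\<lambda>l. nth_deriv l f" "\<lambda>l x. exp (- x\<^sup>2) *\<^sub>R mat_eval ((gderiv ^^ l) (B j)) x" j,
        OF smooth_nth_deriv[OF f] gauss_higher_has_vector_derivative] by simp
  have "act_formal_adjoint (\<lambda>y. f y ** gweight M y) D x = (\<Sum>j\<le>degree D. \<Sum>l\<le>j. exp (- x\<^sup>2) *\<^sub>R (
      nth_deriv l f x ** mat_eval (smat (of_int ((-1) ^ j * int (j choose l))) ((gderiv ^^ (j - l)) (B j))) x))"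
    unfolding act_formal_adjoint_def eq nd mat_eval_smat_of_int
    by (simp add: matrix_mult_scaleR_right scaleR_sum_right algebra_simps)
  \<comment> \<open>The summation order over the triangle is swapped to group the terms by the order
    l of the derivative that falls on f.\<close>
  also have "\<dots> = (\<Sum>l\<le>degree D. \<Sum>j\<in>{l..degree D}. exp (- x\<^sup>2) *\<^sub>R (
      nth_deriv l f x ** mat_eval (smat (of_int ((-1) ^ j * int (j choose l))) ((gderiv ^^ (j - l)) (B j))) x))"
    unfolding sum.Sigma[OF finite_atMost ballI[OF finite_atMost]] sum.Sigma[OF finite_atMost ballI[OF finite_atLeastAtMost]]
    by (rule sum.reindex_bij_witness[where i = prod.swap and j = prod.swap]) auto
  also have "\<dots> = exp (- x\<^sup>2) *\<^sub>R (\<Sum>l\<le>degree D. nth_deriv l f x ** mat_eval (gadj_coeff M D l) x)"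
    unfolding gadj_coeff_def mat_eval_sum B_def[symmetric]
    by (simp only: scaleR_sum_right bounded_bilinear.sum_right[OF bounded_bilinear_matrix_mult])
  finally show ?thesis .
qed

text \<open>This expresses that E is W2 D^* W1^(-1) for the weights e^(-x^2) M1 and e^(-x^2) M2.
  Multiplying by M1 on the right avoids inverting a polynomial matrix.\<close>

definition gadjoint :: "'n::finite mat_poly \<Rightarrow> 'n mat_poly \<Rightarrow> 'n diff_op \<Rightarrow> 'n diff_op \<Rightarrow> bool" where
  "gadjoint M1 M2 D E \<longleftrightarrow> degree E \<le> degree D \<and> (\<forall>l\<le>degree D. coeff E l ** M1 = gadj_coeff M2 D l)"

lemma act_formal_adjoint_gadjoint:
  assumes "gadjoint M1 M2 D E" and f: "smooth_matrix_on UNIV f"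
  shows "act_formal_adjoint (\<lambda>y. f y ** gweight M2 y) D x = act_fun f E x ** gweight M1 x"
proof -
  have "mat_eval (gadj_coeff M2 D l) x = mat_eval (coeff E l) x ** mat_eval M1 x" if "l \<le> degree D" for l
    using assms(1) that by (simp add: gadjoint_def flip: mat_eval_mult)
  then have "(\<Sum>l\<le>degree D. nth_deriv l f x ** mat_eval (gadj_coeff M2 D l) x)
      = (\<Sum>l\<le>degree D. nth_deriv l f x ** mat_eval (coeff E l) x ** mat_eval M1 x)"
    by (intro sum.cong) (simp_all add: matrix_mul_assoc)
  also have "\<dots> = act_fun f E x ** mat_eval M1 x"
    using assms(1) by (simp add: act_fun_upto[of E "degree D"] gadjoint_def
        matrix_sum_rdistrib)
  finally show ?thesis
    unfolding act_formal_adjoint_gweight[OF f] by (simp add: gweight_def matrix_mult_scaleR_right)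
qed

text \<open>\<open>matrix_inv\<close> is a choice among two-sided inverses, so its value has to be
  pinned down by uniqueness.\<close>

lemma matrix_inv_unique:
  fixes A B :: "complex^'n::finite^'n"
  assumes "A ** B = mat 1" "B ** A = mat 1"
  shows "matrix_inv A = B"
proof -
  have "\<exists>A'. A ** A' = mat 1 \<and> A' ** A = mat 1" using assms by blast
  from someI_ex[OF this] have "matrix_inv A ** A = mat 1" by (simp add: matrix_inv_def)
  then have "matrix_inv A ** A ** B = B" by simp
  then show ?thesis by (simp add: assms flip: matrix_mul_assoc)
qed

lemma act_darboux_adjoint_gadjoint:
  assumes "gadjoint (mat 1) M D E" and f: "smooth_matrix_on UNIV f"
  shows "act_darboux_adjoint (gweight (mat 1)) (gweight M) D f x = act_fun f E x"
proof -
  have *: "gweight (mat 1) x ** (exp (x\<^sup>2) *\<^sub>R mat 1) = (mat 1 :: complex^'n^'n)"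
       "(exp (x\<^sup>2) *\<^sub>R mat 1) ** gweight (mat 1) x = (mat 1 :: complex^'n^'n)"
    by (simp_all add: gweight_def matrix_mult_scaleR_left matrix_mult_scaleR_right flip: exp_add)
  then show ?thesis
    unfolding act_darboux_adjoint_def act_formal_adjoint_gadjoint[OF assms] matrix_inv_unique[OF *]
    by (simp only: matrix_mul_assoc[symmetric] * matrix_mul_rid)
qed

text \<open>Integration by parts moves the derivatives off P, term by term. The result is the
  adjoint of what the formal adjoint of D does to Q M2 e^(-x^2), and \<open>gadjoint\<close>
  identifies that with Q acted on by E, times M1.\<close>

lemma ip_gadjoint:
  fixes M1 M2 :: "'n::finite mat_poly"
  assumes adj: "gadjoint M1 M2 D E" and M: "adj_poly M1 = M1" "adj_poly M2 = M2"
  shows "ip M2 (act_poly P D) Q = ip M1 P (act_poly Q E)"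
proof -
  \<comment> \<open>Both sides are compared as functions: each, multiplied by the Gaussian, equals
    the formal adjoint action on Q times the second weight.\<close>
  have *: "(\<Sum>j\<le>degree D. smat (of_int ((-1) ^ j)) ((gderiv ^^ j) (Q ** M2 ** adj_poly (coeff D j)))) = act_poly Q E ** M1"
    (is "?L = ?R")
  proof (rule mat_eval_inject)
    fix x
    have "act_formal_adjoint (\<lambda>y. mat_eval Q y ** gweight M2 y) D x = exp (- x\<^sup>2) *\<^sub>R mat_eval ?L x"
    proof -
      have "(\<lambda>y. mat_eval Q y ** gweight M2 y ** adj_mat (mat_eval (coeff D j) y)) =
          (\<lambda>y. exp (- y\<^sup>2) *\<^sub>R mat_eval (Q ** M2 ** adj_poly (coeff D j)) y)" for j
        by (simp add: gweight_eval)
      then show ?thesis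
        unfolding act_formal_adjoint_def mat_eval_sum mat_eval_smat_of_int
        by (simp add: nth_deriv_gauss scaleR_sum_right mult.commute)
    qed
    moreover have "act_formal_adjoint (\<lambda>y. mat_eval Q y ** gweight M2 y) D x = exp (- x\<^sup>2) *\<^sub>R mat_eval ?R x"
      unfolding act_formal_adjoint_gadjoint[OF adj smooth_mat_eval] act_fun_mat_eval
      by (simp add: gweight_def mat_eval_mult matrix_mult_scaleR_right)
    ultimately show "mat_eval ?L x = mat_eval ?R x" by simp
  qed
  have sm: "glin (A ** smat (of_int c) B) = real_of_int c *\<^sub>R glin (A ** B)" for c and A B :: "'n mat_poly"
  proof -
    have "A ** smat (of_int c) B = mat_const (mat (of_int c)) ** (A ** B)"
      by (simp add: vec_eq_iff mat_mult_nth mat_def sum_distrib_left if_distrib if_distribR mult.left_commute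
          of_int_poly cong: if_cong)
    moreover have "mat (of_int c) ** X = real_of_int c *\<^sub>R X" for X :: "complex^'n^'n"
      by (simp add: vec_eq_iff mat_mult_nth mat_def if_distrib if_distribR scaleR_conv_of_real[where 'a = complex] cong: if_cong)
    ultimately show ?thesis by (simp add: glin_const_left)
  qed
  have "ip M2 (act_poly P D) Q = (\<Sum>j\<le>degree D. glin ((mat_pderiv ^^ j) P ** (coeff D j ** M2 ** adj_poly Q)))"
    unfolding ip_def act_poly_def
    by (simp add: matrix_mul_assoc glin_sum[symmetric] matrix_sum_rdistrib)
  also have "\<dots> = (\<Sum>j\<le>degree D. (-1) ^ j *\<^sub>R glin (P ** (gderiv ^^ j) (coeff D j ** M2 ** adj_poly Q)))"
    by (simp add: glin_higher_pderiv_left)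
  also have "\<dots> = glin (P ** (\<Sum>j\<le>degree D. smat (of_int ((-1) ^ j)) ((gderiv ^^ j) (coeff D j ** M2 ** adj_poly Q))))"
    unfolding matrix_sum_ldistrib glin_sum sm by simp
  \<comment> \<open>\<open>adj_poly\<close> reverses products and commutes with
    \<open>gderiv\<close>, and M2 is Hermitian.\<close>
  also have "(\<Sum>j\<le>degree D. smat (of_int ((-1) ^ j)) ((gderiv ^^ j) (coeff D j ** M2 ** adj_poly Q))) = adj_poly ?L"
    unfolding adj_poly_sum adj_poly_smat_of_int adj_poly_higher_gderiv
    by (simp add: adj_poly_mult M matrix_mul_assoc)
  also have "\<dots> = M1 ** adj_poly (act_poly Q E)"
    unfolding * by (simp add: adj_poly_mult M)
  finally show ?thesis by (simp add: ip_def matrix_mul_assoc)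
qed

section \<open>Degrees\<close>

text \<open>Degree below n with the zero polynomial counted as degree minus infinity, in contrast to
  \<open>mat_degree\<close>; in particular \<open>mdeg_lt 0\<close> holds for the zero polynomial
  only.\<close>

definition mdeg_lt :: "nat \<Rightarrow> 'n::finite mat_poly \<Rightarrow> bool" where
  "mdeg_lt n P \<longleftrightarrow> (\<forall>k\<ge>n. mat_coeff P k = 0)"

definition xpow :: "nat \<Rightarrow> complex^'n^'n \<Rightarrow> 'n::finite mat_poly" where
  "xpow n C = map_matrix (\<lambda>c. monom c n) C"

lemma xpow_nth [simp]: "xpow n C $ i $ j = monom (C $ i $ j) n"
  by (simp add: xpow_def)

lemma mat_coeff_add: "mat_coeff (A + B) k = mat_coeff A k + mat_coeff B k"
  by (simp add: vec_eq_iff)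

lemma mat_coeff_diff: "mat_coeff (A - B) k = mat_coeff A k - mat_coeff B k"
  by (simp add: vec_eq_iff)

lemma mat_coeff_0 [simp]: "mat_coeff 0 k = 0"
  by (simp add: vec_eq_iff)

lemma mat_coeff_sum: "mat_coeff (sum f I) k = (\<Sum>i\<in>I. mat_coeff (f i) k)"
  by (induction I rule: infinite_finite_induct) (auto simp: mat_coeff_add)

lemma mat_coeff_const_left: "mat_coeff (mat_const C ** A) k = C ** mat_coeff A k"
  by (simp add: vec_eq_iff mat_mult_nth coeff_sum)

lemma mat_coeff_xpow: "mat_coeff (xpow n C) k = (if k = n then C else 0)"
  by (simp add: vec_eq_iff)

lemma mdeg_lt_0 [simp]: "mdeg_lt n 0"
  by (simp add: mdeg_lt_def)

lemma mdeg_lt_zero_iff: "mdeg_lt 0 P \<longleftrightarrow> P = 0"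
  by (auto simp: mdeg_lt_def vec_eq_iff poly_eq_iff)

lemma mdeg_lt_add: "mdeg_lt n A \<Longrightarrow> mdeg_lt n B \<Longrightarrow> mdeg_lt n (A + B)"
  by (simp add: mdeg_lt_def mat_coeff_add)

lemma mdeg_lt_const_left: "mdeg_lt n A \<Longrightarrow> mdeg_lt n (mat_const C ** A)"
  by (simp add: mdeg_lt_def mat_coeff_const_left vec_eq_iff mat_mult_nth)

lemma mdeg_lt_mono: "mdeg_lt n A \<Longrightarrow> n \<le> m \<Longrightarrow> mdeg_lt m A"
  by (auto simp: mdeg_lt_def)

lemma mdeg_lt_xpow: "mdeg_lt (Suc n) (xpow n C)"
  by (simp add: mdeg_lt_def mat_coeff_xpow)

lemma mdeg_lt_reduce:
  assumes "mdeg_lt (Suc n) P" "mdeg_lt (Suc n) Q" "mat_coeff P n = mat_coeff Q n"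
  shows "mdeg_lt n (P - Q)"
  unfolding mdeg_lt_def
proof (intro allI impI)
  fix k assume "n \<le> k"
  then show "mat_coeff (P - Q) k = 0"
    using assms by (cases "k = n") (auto simp: mdeg_lt_def mat_coeff_diff)
qed

lemma degree_le_mat_degree: "degree (P $ i $ j) \<le> mat_degree P"
proof -
  have "(\<lambda>(i, j). degree (P $ i $ j)) (i, j) \<le> Max (range (\<lambda>(i, j). degree (P $ i $ j)))"
    by (rule Max_ge) auto
  then show ?thesis by (simp add: mat_degree_def)
qed

lemma mdeg_lt_Suc_mat_degree: "mdeg_lt (Suc (mat_degree P)) P"
proof -
  have "coeff (P $ i $ j) k = 0" if "Suc (mat_degree P) \<le> k" for i j k
    using that degree_le_mat_degree[of P i j] by (intro coeff_eq_0) simp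
  then show ?thesis by (simp add: mdeg_lt_def vec_eq_iff)
qed

lemma mat_degree_eqI:
  assumes "mdeg_lt (Suc n) P" "mat_coeff P n \<noteq> 0"
  shows "mat_degree P = n"
proof (rule antisym)
  have "degree (P $ i $ j) \<le> n" for i j
    using assms(1) by (intro degree_le) (auto simp: mdeg_lt_def vec_eq_iff)
  then show "mat_degree P \<le> n"
    by (auto simp: mat_degree_def)
  show "n \<le> mat_degree P"
    using assms(2) mdeg_lt_Suc_mat_degree[of P] not_less_eq_eq by (auto simp: mdeg_lt_def)
qed

text \<open>If the top coefficient vanished, every entry would have smaller degree than the maximum.
  When that maximum is 0 there is no smaller degree, and the polynomial is zero outright.\<close>

lemma mat_coeff_mat_degree_nonzero:
  assumes "P \<noteq> 0"
  shows "mat_coeff P (mat_degree P) \<noteq> 0"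
proof
  assume 0: "mat_coeff P (mat_degree P) = 0"
  then have lt: "mdeg_lt (mat_degree P) P"
    using mdeg_lt_reduce[of "mat_degree P" P 0] mdeg_lt_Suc_mat_degree[of P] by simp
  show False
  proof (cases "mat_degree P")
    case 0
    then show ?thesis using lt assms by (simp add: mdeg_lt_zero_iff)
  next
    case (Suc d)
    have "degree (P $ i $ j) \<le> d" for i j
      using lt by (intro degree_le) (auto simp: mdeg_lt_def vec_eq_iff Suc)
    then have "mat_degree P \<le> d" by (auto simp: mat_degree_def)
    then show ?thesis using Suc by simp
  qed
qed

text \<open>The falling factorial n (n-1) ... (n-i+1), with the subtractions done in the complex
  numbers so that it is a polynomial in n and vanishes by itself for n < i.\<close>

definition ffac :: "nat \<Rightarrow> nat \<Rightarrow> complex" where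
  "ffac n i = (\<Prod>t<i. of_nat n - of_nat t)"

lemma ffac_simps [simp]: "ffac n 0 = 1" "ffac n (Suc i) = ffac n i * (of_nat n - of_nat i)"
  by (simp_all add: ffac_def)

lemma ffac_eq_0: "n < i \<Longrightarrow> ffac n i = 0"
  by (auto simp: ffac_def intro!: bexI[of _ n])

lemma ffac_self: "ffac n n \<noteq> 0"
  by (simp add: ffac_def)

lemma higher_pderiv_monom: "(pderiv ^^ i) (monom c n) = monom (ffac n i * c) (n - i)" for c :: complex
proof (induction i)
  case (Suc i)
  show ?case
    by (cases "i \<le> n") (simp_all add: Suc pderiv_monom of_nat_diff ffac_eq_0 mult_ac)
qed simp

lemma higher_mat_pderiv_nth: "(mat_pderiv ^^ i) P $ a $ b = (pderiv ^^ i) (P $ a $ b)"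
  by (induction i) simp_all

lemma mat_pderiv_add: "(mat_pderiv ^^ i) (P + Q) = (mat_pderiv ^^ i) P + (mat_pderiv ^^ i) Q"
  by (induction i) (simp_all add: vec_eq_iff pderiv_add)

lemma mat_pderiv_const_left: "(mat_pderiv ^^ i) (mat_const C ** P) = mat_const C ** (mat_pderiv ^^ i) P"
  by (induction i) (simp_all add: vec_eq_iff mat_mult_nth pderiv_sum pderiv_smult)

section \<open>The action of an operator on powers of x\<close>

lemma act_poly_add: "act_poly (P + Q) D = act_poly P D + act_poly Q D"
  by (simp add: act_poly_def mat_pderiv_add matrix_add_rdistrib sum.distrib)

lemma act_poly_const_left: "act_poly (mat_const C ** P) D = mat_const C ** act_poly P D"
  by (simp add: act_poly_def mat_pderiv_const_left matrix_sum_ldistrib matrix_mul_assoc)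

lemma act_poly_diff: "act_poly (P - Q) D = act_poly P D - act_poly Q D"
  using act_poly_add[of "P - Q" Q D] by simp

lemma act_poly_0 [simp]: "act_poly 0 D = 0"
  using act_poly_diff[of 0 0 D] by simp

lemma mat_coeff_xpow_mult: "mat_coeff (xpow n C ** F) m = (if n \<le> m then C ** mat_coeff F (m - n) else 0)"
  by (auto simp: vec_eq_iff mat_mult_nth coeff_sum coeff_monom_mult)

lemma higher_mat_pderiv_xpow: "(mat_pderiv ^^ i) (xpow n C) = xpow (n - i) (smat (ffac n i) C)"
  by (simp add: vec_eq_iff higher_mat_pderiv_nth higher_pderiv_monom)

lemma smat_mult_left: "smat c A ** B = smat c (A ** B)" for c :: "'a::comm_semiring_1"
  by (simp add: vec_eq_iff mat_mult_nth sum_distrib_left mult.assoc)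

lemma smat_mult_right: "A ** smat c B = smat c (A ** B)" for c :: "'a::comm_semiring_1"
  by (simp add: vec_eq_iff mat_mult_nth sum_distrib_left mult.left_commute)

lemma smat_0 [simp]: "smat 0 A = 0" "smat c 0 = 0" for c :: "'a::comm_semiring_1" and A :: "'a^'n^'m"
  by (simp_all add: vec_eq_iff)

lemma mat_coeff_act_poly_xpow:
  "mat_coeff (act_poly (xpow n C) D) m =
    (\<Sum>i\<le>degree D. if n - i \<le> m then smat (ffac n i) (C ** mat_coeff (coeff D i) (m - (n - i))) else 0)"
  unfolding act_poly_def mat_coeff_sum higher_mat_pderiv_xpow mat_coeff_xpow_mult smat_mult_left ..

text \<open>Exactly the operators that never raise degrees: \<open>act_poly_mdeg_lt\<close> gives
  one direction, \<open>deg_nonincI\<close> the other.\<close>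

definition deg_noninc :: "'n::finite diff_op \<Rightarrow> bool" where
  "deg_noninc D \<longleftrightarrow> (\<forall>i k. i < k \<longrightarrow> mat_coeff (coeff D i) k = 0)"

text \<open>The coefficient of x^n in x^n acted on by D. If P_n is monic and D has it as an
  eigenfunction, this is the eigenvalue Lambda_n.\<close>

definition symb :: "'n::finite diff_op \<Rightarrow> nat \<Rightarrow> complex^'n^'n" where
  "symb D n = (\<Sum>i\<le>degree D. smat (ffac n i) (mat_coeff (coeff D i) i))"

text \<open>The coefficient of x^(n-1) in x^n acted on by D. The sum starts at 1 because at i = 0
  the truncated \<open>i - 1\<close> would wrongly pick up the constant term of the coefficient of
  order 0.\<close>

definition subsymb :: "'n::finite diff_op \<Rightarrow> nat \<Rightarrow> complex^'n^'n" where
  "subsymb D n = (\<Sum>i\<in>{1..degree D}. smat (ffac n i) (mat_coeff (coeff D i) (i - 1)))"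

lemma act_poly_xpow_mdeg_lt:
  assumes "deg_noninc D"
  shows "mdeg_lt (Suc n) (act_poly (xpow n C) D)"
  unfolding mdeg_lt_def mat_coeff_act_poly_xpow
proof (intro allI impI sum.neutral ballI)
  fix m i assume m: "Suc n \<le> m"
  show "(if n - i \<le> m then smat (ffac n i) (C ** mat_coeff (coeff D i) (m - (n - i))) else 0) = 0"
  proof (cases "i \<le> n")
    case True
    then have "mat_coeff (coeff D i) (m - (n - i)) = 0"
      using assms m by (simp add: deg_noninc_def)
    then show ?thesis by (simp add: vec_eq_iff mat_mult_nth)
  qed (auto simp: ffac_eq_0)
qed

lemma act_poly_xpow_top: "mat_coeff (act_poly (xpow n C) D) n = C ** symb D n"
  unfolding mat_coeff_act_poly_xpow symb_def matrix_sum_ldistrib smat_mult_right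
proof (intro sum.cong refl)
  fix i
  show "(if n - i \<le> n then smat (ffac n i) (C ** mat_coeff (coeff D i) (n - (n - i))) else 0)
      = smat (ffac n i) (C ** mat_coeff (coeff D i) i)"
    by (cases "i \<le> n") (auto simp: ffac_eq_0)
qed

lemma act_poly_xpow_sub: "mat_coeff (act_poly (xpow (Suc n) C) D) n = C ** subsymb D (Suc n)"
proof -
  \<comment> \<open>Truncated subtraction needs care twice: i = 0 is excluded by the condition, and
    for i > n + 1 the falling factorial is zero.\<close>
  have "(if Suc n - i \<le> n then smat (ffac (Suc n) i) (C ** mat_coeff (coeff D i) (n - (Suc n - i))) else 0)
      = (if 1 \<le> i then smat (ffac (Suc n) i) (C ** mat_coeff (coeff D i) (i - 1)) else 0)" for i
  proof (cases "i \<le> Suc n")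
    case True
    then have "Suc n - i \<le> n \<longleftrightarrow> 1 \<le> i" by auto
    moreover have "n - (Suc n - i) = i - 1" if "1 \<le> i" using True that by auto
    ultimately show ?thesis by auto
  qed (simp add: ffac_eq_0 del: ffac_simps)
  then have "mat_coeff (act_poly (xpow (Suc n) C) D) n =
     (\<Sum>i\<le>degree D. if 1 \<le> i then smat (ffac (Suc n) i) (C ** mat_coeff (coeff D i) (i - 1)) else 0)"
    unfolding mat_coeff_act_poly_xpow by simp
  also have "\<dots> = (\<Sum>i\<in>{1..degree D}. smat (ffac (Suc n) i) (C ** mat_coeff (coeff D i) (i - 1)))"
    by (intro sum.mono_neutral_cong_right) auto
  finally show ?thesis by (simp add: subsymb_def matrix_sum_ldistrib smat_mult_right)
qed

lemma mdeg_lt_split: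
  assumes "mdeg_lt (Suc n) P"
  obtains P' where "mdeg_lt n P'" "P = P' + xpow n (mat_coeff P n)"
proof
  show "mdeg_lt n (P - xpow n (mat_coeff P n))"
    by (rule mdeg_lt_reduce[OF assms mdeg_lt_xpow]) (simp add: mat_coeff_xpow)
qed simp

lemma act_poly_mdeg_lt:
  assumes "deg_noninc D" "mdeg_lt n P"
  shows "mdeg_lt n (act_poly P D)"
  using assms(2)
proof (induction n arbitrary: P)
  case (Suc n)
  then obtain P' where P': "mdeg_lt n P'" "P = P' + xpow n (mat_coeff P n)"
    by (elim mdeg_lt_split)
  have "mdeg_lt (Suc n) (act_poly P' D + act_poly (xpow n (mat_coeff P n)) D)"
    using Suc.IH[OF P'(1)] act_poly_xpow_mdeg_lt[OF assms(1)]
    by (intro mdeg_lt_add) (auto elim: mdeg_lt_mono)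
  then show ?case using P'(2) by (metis act_poly_add)
qed (simp add: mdeg_lt_zero_iff)

lemma act_poly_top:
  assumes D: "deg_noninc D" and P: "mdeg_lt (Suc n) P"
  shows "mat_coeff (act_poly P D) n = mat_coeff P n ** symb D n"
proof -
  obtain P' where P': "mdeg_lt n P'" "P = P' + xpow n (mat_coeff P n)"
    using mdeg_lt_split[OF P] .
  have "act_poly P D = act_poly P' D + act_poly (xpow n (mat_coeff P n)) D"
    using P'(2) by (metis act_poly_add)
  then show ?thesis
    using act_poly_mdeg_lt[OF D P'(1)] by (simp add: mat_coeff_add act_poly_xpow_top mdeg_lt_def)
qed

text \<open>Only the two top coefficients of P can reach degree n. For orthogonal polynomials this
  is the source of the equations that restrict D.\<close>

lemma act_poly_sub:
  assumes D: "deg_noninc D" and P: "mdeg_lt (Suc (Suc n)) P"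
  shows "mat_coeff (act_poly P D) n = mat_coeff P (Suc n) ** subsymb D (Suc n) + mat_coeff P n ** symb D n"
proof -
  obtain P' where P': "mdeg_lt (Suc n) P'" "P = P' + xpow (Suc n) (mat_coeff P (Suc n))"
    using mdeg_lt_split[OF P] .
  have "mat_coeff P n = mat_coeff P' n"
    using arg_cong[OF P'(2), of "\<lambda>A. mat_coeff A n"] by (simp add: mat_coeff_add mat_coeff_xpow)
  moreover have "act_poly P D = act_poly P' D + act_poly (xpow (Suc n) (mat_coeff P (Suc n))) D"
    using P'(2) by (metis act_poly_add)
  ultimately show ?thesis
    by (simp add: mat_coeff_add act_poly_xpow_sub act_poly_top[OF D P'(1)])
qed

text \<open>Testing on x^i times the identity is triangular: higher derivatives kill it, the lower
  coefficients vanish by induction, and i! times \<open>A i\<close> is left.\<close>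

lemma operator_coeffs_eq_0:
  assumes "\<And>P. (\<Sum>i\<le>m. (mat_pderiv ^^ i) P ** A i) = 0" "i \<le> m"
  shows "A i = 0"
  using assms(2)
proof (induction i rule: less_induct)
  case (less i)
  have "(mat_pderiv ^^ l) (xpow i (mat 1)) ** A l = (if l = i then smat [:ffac i i:] (A i) else 0)" if "l \<le> m" for l
  proof (cases l i rule: linorder_cases)
    case equal
    then show ?thesis
      by (simp add: higher_mat_pderiv_xpow vec_eq_iff mat_mult_nth mat_def if_distrib if_distribR monom_0 cong: if_cong)
  next
    case greater
    then have "xpow (i - l) (0 :: complex^'n^'n) = 0" by (simp add: vec_eq_iff)
    then show ?thesis using greater by (simp add: higher_mat_pderiv_xpow ffac_eq_0 vec_eq_iff mat_mult_nth)
  next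
    case less
    then show ?thesis using less.IH that by (auto simp: vec_eq_iff mat_mult_nth)
  qed
  then have "(\<Sum>l\<le>m. (mat_pderiv ^^ l) (xpow i (mat 1)) ** A l) = smat [:ffac i i:] (A i)"
    using less.prems by simp
  then show ?case using assms(1)[of "xpow i (mat 1)"] ffac_self[of i]
    by (simp add: vec_eq_iff)
qed

text \<open>The same triangular test: once the coefficients of order below i are bounded, they
  contribute nothing above degree i to x^i acted on by D, so the part of \<open>coeff D i\<close>
  above degree i is seen alone.\<close>

lemma deg_nonincI:
  assumes "\<And>n P. mdeg_lt n P \<Longrightarrow> mdeg_lt n (act_poly P D)"
  shows "deg_noninc D"
proof -
  have "mat_coeff (coeff D i) k = 0" if "i < k" for i k
    using that
  proof (induction i arbitrary: k rule: less_induct)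
    case (less i)
    show ?case
    proof (cases "i \<le> degree D")
      case True
      have "(if i - l \<le> k - 0 then smat (ffac i l) (mat 1 ** mat_coeff (coeff D l) (k - (i - l))) else 0)
         = (if l = i then smat (ffac i i) (mat_coeff (coeff D i) k) else 0)" for l
      proof (cases l i rule: linorder_cases)
        case less
        then show ?thesis using less.IH[of l "k - (i - l)"] less.prems by (auto simp: vec_eq_iff)
      qed (auto simp: ffac_eq_0)
      then have "mat_coeff (act_poly (xpow i (mat 1)) D) k = smat (ffac i i) (mat_coeff (coeff D i) k)"
        unfolding mat_coeff_act_poly_xpow using True by simp
      moreover have "mat_coeff (act_poly (xpow i (mat 1)) D) k = 0"
        using assms[OF mdeg_lt_xpow, of i "mat 1"] less.prems by (simp add: mdeg_lt_def)
      ultimately show ?thesis using ffac_self[of i] by (simp add: vec_eq_iff)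
    qed (simp add: coeff_eq_0)
  qed
  then show ?thesis by (simp add: deg_noninc_def)
qed

section \<open>Orthogonal polynomials\<close>

definition monic_seq :: "(nat \<Rightarrow> 'n::finite mat_poly) \<Rightarrow> bool" where
  "monic_seq P \<longleftrightarrow> (\<forall>n. mdeg_lt (Suc n) (P n) \<and> mat_coeff (P n) n = mat 1)"

lemma mat_1_neq_0: "(mat 1 :: complex^'n::finite^'n) \<noteq> 0"
  by (simp add: vec_eq_iff mat_def)

lemma monic_seq_iff: "monic_seq P \<longleftrightarrow> (\<forall>n. mat_degree (P n) = n \<and> mat_coeff (P n) n = mat 1)"
  unfolding monic_seq_def
  by (metis mat_degree_eqI mdeg_lt_Suc_mat_degree mat_1_neq_0)

text \<open>A monic sequence is a basis over left matrix coefficients: subtracting a multiple of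
  \<open>P n\<close> removes the coefficient of x^n.\<close>

lemma monic_seq_induct [consumes 2, case_names zero step]:
  assumes "monic_seq P" "mdeg_lt n Q"
    and "R 0" "\<And>A C k. k < n \<Longrightarrow> R A \<Longrightarrow> R (A + mat_const C ** P k)"
  shows "R Q"
  using assms(2,4)
proof (induction n arbitrary: Q)
  case 0
  then show ?case using assms(3) by (simp add: mdeg_lt_zero_iff)
next
  case (Suc n)
  define C where "C = mat_coeff Q n"
  have "mdeg_lt n (Q - mat_const C ** P n)"
    using assms(1) Suc.prems(1)
    by (intro mdeg_lt_reduce mdeg_lt_const_left) (auto simp: monic_seq_def mat_coeff_const_left C_def)
  then have "R (Q - mat_const C ** P n)"
    by (rule Suc.IH) (use Suc.prems(2) in auto)
  then have "R (Q - mat_const C ** P n + mat_const C ** P n)"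
    by (rule Suc.prems(2)[rotated]) simp
  then show ?case by simp
qed

text \<open>The factorization of M with an invertible T supplies definiteness of the pairing;
  orthogonality is stated against all lower degrees, the form in which it is applied.\<close>

locale gauss_orth =
  fixes M T T' :: "'n::finite mat_poly" and P :: "nat \<Rightarrow> 'n mat_poly"
  assumes M: "M = T ** adj_poly T" and T: "T ** T' = mat 1"
    and monic: "monic_seq P"
    and orth: "mdeg_lt n Q \<Longrightarrow> ip M (P n) Q = 0"
begin

lemma M_herm: "adj_poly M = M"
  by (simp add: M adj_poly_mult)

lemma orthogonal_to_lower_eq_0:
  assumes "mdeg_lt n R" "\<And>Q. mdeg_lt n Q \<Longrightarrow> ip M R Q = 0"
  shows "R = 0"
  using ip_definite[OF M T] assms by blast

text \<open>\<open>mops\<close> is a definite description, so uniqueness is due as well. The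
  difference of two candidates of index n has degree below n and is orthogonal to all polynomials of
  such degree, itself included.\<close>

lemma mops_eq: "mops UNIV (gweight M) = P"
  unfolding mops_def
proof (rule the_equality)
  have "ip M (P n) (P m) = 0" if "n \<noteq> m" for n m
  proof (cases "m < n")
    case True
    then have "mdeg_lt n (P m)"
      using monic mdeg_lt_mono[of "Suc m" "P m" n] by (simp add: monic_seq_def)
    then show ?thesis by (rule orth)
  next
    case False
    then have "mdeg_lt m (P n)"
      using monic that mdeg_lt_mono[of "Suc n" "P n" m] by (simp add: monic_seq_def)
    then show ?thesis using ip_eq_0_sym[OF M_herm orth] by blast
  qed
  then show "monic_orthogonal UNIV (gweight M) P"
    using monic by (simp add: monic_orthogonal_def monic_seq_iff mat_inner_gweight)
next
  fix P' assume "monic_orthogonal UNIV (gweight M) P'"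
  then have P': "monic_seq P'" "\<And>n m. n \<noteq> m \<Longrightarrow> ip M (P' n) (P' m) = 0"
    by (auto simp: monic_orthogonal_def monic_seq_iff mat_inner_gweight)
  have orth': "ip M Q (P' n) = 0" if "mdeg_lt n Q" for n Q
    using P'(1) that
  proof (induction rule: monic_seq_induct)
    case zero
    then show ?case by (simp add: ip_def vec_eq_iff mat_mult_nth)
  next
    case (step A C k)
    then show ?case using P'(2)[of k n] by (simp add: ip_add_left ip_const_left vec_eq_iff mat_mult_nth)
  qed
  have "P' n - P n = 0" for n
  proof (rule orthogonal_to_lower_eq_0)
    show "mdeg_lt n (P' n - P n)"
      using P'(1) monic by (intro mdeg_lt_reduce) (auto simp: monic_seq_def)
    show "ip M (P' n - P n) Q = 0" if "mdeg_lt n Q" for Q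
      using orth[OF that] ip_eq_0_sym[OF M_herm orth'[OF that]] by (simp add: ip_diff_left)
  qed
  then show "P' = P" by (simp add: fun_eq_iff)
qed

text \<open>The choice of \<open>symb D n\<close> cancels the leading terms. The remainder has
  degree below n, and passing D to the other side as E, which keeps degrees below n, shows that it
  is orthogonal to all lower degrees.\<close>

lemma act_poly_eigen:
  assumes D: "deg_noninc D" and E: "deg_noninc E"
    and adj: "\<And>A B. ip M (act_poly A D) B = ip M A (act_poly B E)"
  shows "act_poly (P n) D = mat_const (symb D n) ** P n"
proof -
  have Pn: "mdeg_lt (Suc n) (P n)" "mat_coeff (P n) n = mat 1"
    using monic by (auto simp: monic_seq_def)
  have "act_poly (P n) D - mat_const (symb D n) ** P n = 0"
  proof (rule orthogonal_to_lower_eq_0)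
    show "mdeg_lt n (act_poly (P n) D - mat_const (symb D n) ** P n)"
      using Pn act_poly_mdeg_lt[OF D Pn(1)]
      by (intro mdeg_lt_reduce mdeg_lt_const_left) (auto simp: act_poly_top[OF D Pn(1)] mat_coeff_const_left)
    show "ip M (act_poly (P n) D - mat_const (symb D n) ** P n) Q = 0" if "mdeg_lt n Q" for Q
      using orth[OF that] orth[OF act_poly_mdeg_lt[OF E that]]
      by (simp add: ip_diff_left ip_const_left adj vec_eq_iff mat_mult_nth)
  qed
  then show ?thesis by simp
qed

lemma bochner_algebraI:
  assumes "deg_noninc D" "deg_noninc E"
    and "\<And>A B. ip M (act_poly A D) B = ip M A (act_poly B E)"
  shows "D \<in> bochner_algebra UNIV (gweight M)"
  unfolding bochner_algebra_def mops_eq using act_poly_eigen[OF assms] by blast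

text \<open>Each P_k is sent to a multiple of itself and the P_k form a basis, so degrees cannot
  rise; comparing leading coefficients then identifies the eigenvalue.\<close>

lemma bochner_algebraD:
  assumes "D \<in> bochner_algebra UNIV (gweight M)"
  shows "deg_noninc D" and "act_poly (P n) D = mat_const (symb D n) ** P n"
proof -
  have P: "mdeg_lt (Suc n) (P n)" "mat_coeff (P n) n = mat 1" for n
    using monic by (auto simp: monic_seq_def)
  have eig: "\<exists>\<Lambda>. act_poly (P n) D = mat_const \<Lambda> ** P n" for n
    using assms by (simp add: bochner_algebra_def mops_eq)
  show D: "deg_noninc D"
  proof (rule deg_nonincI)
    fix n and Q :: "'n mat_poly" assume "mdeg_lt n Q"
    with monic show "mdeg_lt n (act_poly Q D)"
    proof (induction rule: monic_seq_induct)
      case (step A C k)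
      obtain \<Lambda> where "act_poly (P k) D = mat_const \<Lambda> ** P k" using eig by blast
      then show ?case
        using step P(1)[of k] by (auto simp: act_poly_add act_poly_const_left
            intro!: mdeg_lt_add mdeg_lt_const_left elim: mdeg_lt_mono)
    qed simp
  qed
  obtain \<Lambda> where \<Lambda>: "act_poly (P n) D = mat_const \<Lambda> ** P n" using eig by blast
  then have "symb D n = \<Lambda>"
    using act_poly_top[OF D P(1), of n] by (simp add: mat_coeff_const_left P)
  then show "act_poly (P n) D = mat_const (symb D n) ** P n"
    using \<Lambda> by simp
qed

end

section \<open>Hermite polynomials\<close>

text \<open>Monic Hermite polynomials in Rodrigues form: e^(-x^2) times the next one is -1/2 times
  the derivative of e^(-x^2) times the present one.\<close>

fun hermite :: "nat \<Rightarrow> complex poly" where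
  "hermite 0 = 1"
| "hermite (Suc n) = [:0, 1:] * hermite n - smult (1 / 2) (pderiv (hermite n))"

lemma coeff_hermite_high: "n < k \<Longrightarrow> coeff (hermite n) k = 0"
proof (induction n arbitrary: k)
  case (Suc n)
  then show ?case by (cases k) (auto simp: coeff_pderiv coeff_pCons)
qed auto

lemma coeff_hermite_top: "coeff (hermite n) n = 1"
  by (induction n) (auto simp: coeff_pderiv coeff_hermite_high)

text \<open>An instance of parity. It makes the subleading coefficient of a Hermite polynomial acted
  on by \<open>Vop a\<close> depend on \<open>subsymb\<close> alone.\<close>

lemma coeff_hermite_sub: "coeff (hermite (Suc n)) n = 0"
proof (induction n)
  case (Suc n)
  have "coeff (hermite (Suc (Suc n))) (Suc n) = coeff (hermite (Suc n)) n
      - 1 / 2 * (of_nat (Suc (Suc n)) * coeff (hermite (Suc n)) (Suc (Suc n)))"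
    by (subst hermite.simps) (simp add: coeff_pderiv del: hermite.simps)
  then show ?case using Suc coeff_hermite_high[of "Suc n" "Suc (Suc n)"] by (simp del: hermite.simps)
qed (simp add: coeff_pderiv)

text \<open>One integration by parts lowers both the Hermite index and the degree of q.\<close>

lemma gint_hermite:
  assumes "\<And>k. n \<le> k \<Longrightarrow> coeff q k = 0"
  shows "gint (hermite n * q) = 0"
  using assms
proof (induction n arbitrary: q)
  case 0
  then have "q = 0" by (auto simp: poly_eq_iff)
  then show ?case by simp
next
  case (Suc n)
  define h where "h = hermite n"
  have "gint (h * pderiv q) = 0"
    unfolding h_def using Suc.prems by (intro Suc.IH) (simp add: coeff_pderiv)
  moreover have "smult 2 (hermite (Suc n) * q) = h * pderiv q - (pderiv (h * q) - [:0, 2:] * (h * q))"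
  proof -
    have "smult 2 (hermite (Suc n)) = [:0, 2:] * h - pderiv h"
      by (simp add: h_def smult_diff_right)
    then have "smult 2 (hermite (Suc n) * q) = ([:0, 2:] * h - pderiv h) * q"
      by (metis mult_smult_left)
    also have "\<dots> = h * pderiv q - (pderiv (h * q) - [:0, 2:] * (h * q))"
      by (simp only: pderiv_mult) (simp only: algebra_simps)
    finally show ?thesis .
  qed
  ultimately have "gint (smult 2 (hermite (Suc n) * q)) = 0"
    by (simp only: gint_diff[of "h * pderiv q"] gint_gderiv) simp
  then show ?case by (simp only: gint_smult) simp
qed

definition hermite_mat :: "nat \<Rightarrow> 'n::finite mat_poly" where
  "hermite_mat n = smat (hermite n) (mat 1)"

lemma monic_seq_hermite_mat: "monic_seq hermite_mat"
  by (auto simp: monic_seq_def mdeg_lt_def hermite_mat_def vec_eq_iff mat_def coeff_hermite_top coeff_hermite_high)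

lemma hermite_mat_sub: "mat_coeff (hermite_mat (Suc n)) n = 0"
  by (simp add: hermite_mat_def vec_eq_iff mat_def coeff_hermite_sub del: hermite.simps)

lemma adj_poly_1 [simp]: "adj_poly (mat 1) = mat 1"
  by (auto simp: vec_eq_iff mat_def)

interpretation hermite: gauss_orth "mat 1" "mat 1" "mat 1" "hermite_mat :: nat \<Rightarrow> 'n::finite mat_poly"
proof
  fix n and Q :: "'n mat_poly"
  assume "mdeg_lt n Q"
  then have "gint (hermite n * map_poly cnj (Q $ j $ i)) = 0" for i j
    by (intro gint_hermite) (simp add: coeff_map_poly mdeg_lt_def vec_eq_iff)
  then show "ip (mat 1) (hermite_mat n) Q = 0"
    by (simp add: ip_def hermite_mat_def smat_mult_left vec_eq_iff)
qed (auto simp: monic_seq_hermite_mat)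

section \<open>The operators\<close>

definition mat2 :: "'a \<Rightarrow> 'a \<Rightarrow> 'a \<Rightarrow> 'a \<Rightarrow> 'a::zero^2^2" where
  "mat2 p q r s = vector [vector [p, q], vector [r, s]]"

lemma mat2_nth [simp]:
  "mat2 p q r s $ 1 $ 1 = p" "mat2 p q r s $ 1 $ 2 = q" "mat2 p q r s $ 2 $ 1 = r" "mat2 p q r s $ 2 $ 2 = s"
  by (simp_all add: mat2_def)

lemma mat2_eqI: "A = B" if "A $ 1 $ 1 = B $ 1 $ 1" "A $ 1 $ 2 = B $ 1 $ 2" "A $ 2 $ 1 = B $ 2 $ 1" "A $ 2 $ 2 = B $ 2 $ 2"
  for A B :: "'a^2^2"
  using that by (simp add: vec_eq_iff forall_2)

lemma mat2_eq_iff: "mat2 p q r s = mat2 p' q' r' s' \<longleftrightarrow> p = p' \<and> q = q' \<and> r = r' \<and> s = s'"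
  by (metis mat2_nth)

lemma mat2_0: "mat2 0 0 0 0 = 0"
  by (rule mat2_eqI) simp_all

lemma mat2_mult: "mat2 p q r s ** mat2 p' q' r' s' =
    mat2 (p * p' + q * r') (p * q' + q * s') (r * p' + s * r') (r * q' + s * s')"
  for p :: "'a::semiring_1"
  by (rule mat2_eqI) (simp_all add: mat_mult_nth sum_2)

lemma mat2_add: "mat2 p q r s + mat2 p' q' r' s' = mat2 (p + p') (q + q') (r + r') (s + s')"
  for p :: "'a::monoid_add"
  by (rule mat2_eqI) simp_all

lemma smat_mat2: "smat c (mat2 p q r s) = mat2 (c * p) (c * q) (c * r) (c * s)"
  for p :: "'a::mult_zero"
  by (rule mat2_eqI) simp_all

lemma gderiv_mat2: "gderiv (mat2 p q r s) = mat2 (pderiv p - [:0, 2:] * p) (pderiv q - [:0, 2:] * q)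
    (pderiv r - [:0, 2:] * r) (pderiv s - [:0, 2:] * s)"
  by (rule mat2_eqI) (simp_all only: gderiv_nth mat2_nth)

lemma adj_poly_mat2: "adj_poly (mat2 p q r s) = mat2 (map_poly cnj p) (map_poly cnj r) (map_poly cnj q) (map_poly cnj s)"
  by (rule mat2_eqI) simp_all

lemma mat_1_mat2: "(mat 1 :: 'a::semiring_1^2^2) = mat2 1 0 0 1"
  by (rule mat2_eqI) (simp_all add: mat_def)

definition Tmat :: "complex \<Rightarrow> 2 mat_poly" where
  "Tmat a = mat2 [:1, 0, a^2:] [:0, a:] [:0, a:] [:1:]"

definition Tinv :: "complex \<Rightarrow> 2 mat_poly" where
  "Tinv a = mat2 [:1:] [:0, - a:] [:0, - a:] [:1, 0, a^2:]"

definition Mmat :: "complex \<Rightarrow> 2 mat_poly" where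
  "Mmat a = mat2 [:1, 0, 3 * a^2, 0, a^4:] [:0, 2 * a, 0, a^3:] [:0, 2 * a, 0, a^3:] [:1, 0, a^2:]"

text \<open>\<open>Vop\<close> sends Hermite polynomials to multiples of the orthogonal polynomials of the weight,
  \<open>Nop\<close> is its adjoint and \<open>Dop\<close> is symmetric. They are scaled by \<open>8\<close>, \<open>8\<close> and \<open>4\<close> to clear
  denominators.\<close>

definition Vop :: "complex \<Rightarrow> 2 diff_op" where
  "Vop a = [:
    mat2 [:16:] 0 0 [:16:],
    mat2 [:0, 8 * a^2:] [:- 16 * a - 12 * a^3:] [:- 16 * a - 12 * a^3:] [:0, 24 * a^2 + 12 * a^4:],
    mat2 [:6 * a^4:] [:0, - 12 * a^3 - 6 * a^5:] [:0, - 12 * a^3 - 6 * a^5:] [:6 * a^4, 0, 12 * a^4 + 6 * a^6:],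
    mat2 [:0, 2 * a^4:] [:4 * a^3, 0, - 2 * a^5:] [:4 * a^3, 0, - 2 * a^5:] [:0, - 2 * a^4, 0, 2 * a^6:],
    mat2 [:- (a^4):] [:0, a^5:] [:0, a^5:] [:- (a^4), 0, - (a^6):]:]"

definition Nop :: "complex \<Rightarrow> 2 diff_op" where
  "Nop a = [:
    mat2 [:16 + 24 * a^2 + 12 * a^4:] 0 0 [:16 + 8 * a^2:],
    mat2 [:0, 24 * a^2 + 36 * a^4 + 12 * a^6:] [:16 * a + 12 * a^3:] [:16 * a + 12 * a^3:] [:0, 8 * a^2:],
    mat2 [:- 12 * a^4 - 12 * a^6, 0, 12 * a^4 + 12 * a^6:] [:0, 12 * a^3 + 6 * a^5:] [:0, 12 * a^3 + 6 * a^5:] 0,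
    mat2 [:0, - 2 * a^4 - 8 * a^6, 0, 2 * a^6:] [:- 4 * a^3 - 4 * a^5, 0, 2 * a^5:] [:- 4 * a^3 - 4 * a^5, 0, 2 * a^5:] [:0, 2 * a^4:],
    mat2 [:- (a^4), 0, - (a^6):] [:0, - (a^5):] [:0, - (a^5):] [:- (a^4):]:]"

definition Dop :: "complex \<Rightarrow> 2 diff_op" where
  "Dop a = [:
    mat2 0 0 0 [:- 16 - 4 * a^2:],
    mat2 [:0, 16 + 12 * a^2:] [:- 32 * a - 24 * a^3:] 0 [:0, 16 + 4 * a^2:],
    mat2 [:- 8 + 12 * a^4, 0, 4 * a^2:] [:0, - 24 * a^3 - 12 * a^5:] 0 [:- 8 - 12 * a^2, 0, 4 * a^2:],
    mat2 [:0, - 4 * a^2 + 4 * a^4:] [:4 * a^3, 0, - 4 * a^5:] [:4 * a^3:] [:0, - 4 * a^2 - 4 * a^4:],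
    mat2 [:a^2:] 0 0 [:a^2:]:]"

lemma Tmat_Tinv: "Tmat a ** Tinv a = mat 1"
  by (simp add: Tmat_def Tinv_def mat2_mult mat_1_mat2 mat2_eq_iff power2_eq_square flip: one_pCons)

lemma Mmat_eq:
  assumes "cnj a = a"
  shows "Mmat a = Tmat a ** adj_poly (Tmat a)"
  using assms by (simp add: Tmat_def Mmat_def adj_poly_mat2 map_poly_pCons mat2_mult mat2_eq_iff eval_nat_numeral)

lemma degree_Vop: "a \<noteq> 0 \<Longrightarrow> degree (Vop a) = 4"
  and degree_Nop: "a \<noteq> 0 \<Longrightarrow> degree (Nop a) = 4"
  and degree_Dop: "a \<noteq> 0 \<Longrightarrow> degree (Dop a) = 4"
  by (simp_all add: Vop_def Nop_def Dop_def mat2_eq_iff flip: mat2_0)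

lemma le_4_iff: "l \<le> 4 \<longleftrightarrow> l \<in> {0, 1, 2, 3, 4 :: nat}"
  by auto

lemma sum_to_4:
  "(\<Sum>i\<in>{0..4::nat}. f i) = f 0 + f 1 + f 2 + f 3 + f 4"
  "(\<Sum>i\<in>{1..4::nat}. f i) = f 1 + f 2 + f 3 + f 4"
  "(\<Sum>i\<in>{2..4::nat}. f i) = f 2 + f 3 + f 4"
  "(\<Sum>i\<in>{3..4::nat}. f i) = f 3 + f 4"
  "(\<Sum>i\<in>{4..4::nat}. f i) = f 4"
  by (simp_all add: eval_nat_numeral add_ac)

section \<open>Coefficients of \<open>Vop\<close> and the Gaussian derivatives in its
  adjoint\<close>

lemma coeff_Vop_0: "coeff (Vop a) 0 = mat2 [:16:] 0 0 [:16:]"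
  by (simp add: Vop_def coeff_pCons eval_nat_numeral)

lemma coeff_Vop_1: "coeff (Vop a) 1 = mat2 [:0, 8 * a^2:] [:- 16 * a - 12 * a^3:] [:- 16 * a - 12 * a^3:] [:0, 24 * a^2 + 12 * a^4:]"
  by (simp add: Vop_def coeff_pCons eval_nat_numeral)

lemma coeff_Vop_2: "coeff (Vop a) 2 = mat2 [:6 * a^4:] [:0, - 12 * a^3 - 6 * a^5:] [:0, - 12 * a^3 - 6 * a^5:] [:6 * a^4, 0, 12 * a^4 + 6 * a^6:]"
  by (simp add: Vop_def coeff_pCons eval_nat_numeral)

lemma coeff_Vop_3: "coeff (Vop a) 3 = mat2 [:0, 2 * a^4:] [:4 * a^3, 0, - 2 * a^5:] [:4 * a^3, 0, - 2 * a^5:] [:0, - 2 * a^4, 0, 2 * a^6:]"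
  by (simp add: Vop_def coeff_pCons eval_nat_numeral)

lemma coeff_Vop_4: "coeff (Vop a) 4 = mat2 [:- (a^4):] [:0, a^5:] [:0, a^5:] [:- (a^4), 0, - (a^6):]"
  by (simp add: Vop_def coeff_pCons eval_nat_numeral)

lemma Vop_adj_0:
  assumes "cnj a = a"
  shows "Mmat a ** adj_poly (coeff (Vop a) 0) = mat2 [:16, 0, 48 * a^2, 0, 16 * a^4:] [:0, 32 * a, 0, 16 * a^3:] [:0, 32 * a, 0, 16 * a^3:] [:16, 0, 16 * a^2:]"
  unfolding coeff_Vop_0 using assms by (simp add: Mmat_def adj_poly_mat2 map_poly_pCons mat2_mult mat2_eq_iff; simp add: eval_nat_numeral algebra_simps)

lemma Vop_adj_1:
  assumes "cnj a = a"
  shows "Mmat a ** adj_poly (coeff (Vop a) 1) = mat2 [:0, - 24 * a^2 - 24 * a^4, 0, 8 * a^4 - 12 * a^6, 0, 8 * a^6:] [:- 16 * a - 12 * a^3, 0, - 12 * a^5, 0, 8 * a^5:] [:- 16 * a - 12 * a^3, 0, - 12 * a^5, 0, 8 * a^5:] [:0, - 8 * a^2 - 12 * a^4, 0, 8 * a^4:]"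
  unfolding coeff_Vop_1 using assms by (simp add: Mmat_def adj_poly_mat2 map_poly_pCons mat2_mult mat2_eq_iff; simp add: eval_nat_numeral algebra_simps)

text \<open>In \<open>Vop_gderiv_j_k\<close> the right side is the k-th \<open>gderiv\<close> of M
  times the adjoint of the j-th coefficient of \<open>Vop\<close>. The adjoint is assembled from
  these as linear combinations; \<open>Dop_gderiv_j_k\<close> follows the same scheme.\<close>

lemma Vop_gderiv_1_1: "gderiv (mat2 [:0, - 24 * a^2 - 24 * a^4, 0, 8 * a^4 - 12 * a^6, 0, 8 * a^6:] [:- 16 * a - 12 * a^3, 0, - 12 * a^5, 0, 8 * a^5:] [:- 16 * a - 12 * a^3, 0, - 12 * a^5, 0, 8 * a^5:] [:0, - 8 * a^2 - 12 * a^4, 0, 8 * a^4:]) =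
    mat2 [:- 24 * a^2 - 24 * a^4, 0, 48 * a^2 + 72 * a^4 - 36 * a^6, 0, - 16 * a^4 + 64 * a^6, 0, - 16 * a^6:] [:0, 32 * a + 24 * a^3 - 24 * a^5, 0, 56 * a^5, 0, - 16 * a^5:] [:0, 32 * a + 24 * a^3 - 24 * a^5, 0, 56 * a^5, 0, - 16 * a^5:] [:- 8 * a^2 - 12 * a^4, 0, 16 * a^2 + 48 * a^4, 0, - 16 * a^4:]" for a :: complex
  by (simp add: gderiv_mat2 pderiv_pCons mat2_eq_iff; simp add: algebra_simps)

lemma Vop_adj_2:
  assumes "cnj a = a"
  shows "Mmat a ** adj_poly (coeff (Vop a) 2) = mat2 [:6 * a^4, 0, - 24 * a^4 + 6 * a^6, 0, - 12 * a^6:] [:0, - 12 * a^3 + 6 * a^5, 0, - 12 * a^5:] [:0, - 12 * a^3 + 6 * a^5, 0, - 12 * a^5:] [:6 * a^4, 0, - 12 * a^4:]"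
  unfolding coeff_Vop_2 using assms by (simp add: Mmat_def adj_poly_mat2 map_poly_pCons mat2_mult mat2_eq_iff; simp add: eval_nat_numeral algebra_simps)

lemma Vop_gderiv_2_1: "gderiv (mat2 [:6 * a^4, 0, - 24 * a^4 + 6 * a^6, 0, - 12 * a^6:] [:0, - 12 * a^3 + 6 * a^5, 0, - 12 * a^5:] [:0, - 12 * a^3 + 6 * a^5, 0, - 12 * a^5:] [:6 * a^4, 0, - 12 * a^4:]) =
    mat2 [:0, - 60 * a^4 + 12 * a^6, 0, 48 * a^4 - 60 * a^6, 0, 24 * a^6:] [:- 12 * a^3 + 6 * a^5, 0, 24 * a^3 - 48 * a^5, 0, 24 * a^5:] [:- 12 * a^3 + 6 * a^5, 0, 24 * a^3 - 48 * a^5, 0, 24 * a^5:] [:0, - 36 * a^4, 0, 24 * a^4:]" for a :: complex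
  by (simp add: gderiv_mat2 pderiv_pCons mat2_eq_iff; simp add: algebra_simps)

lemma Vop_gderiv_2_2: "gderiv (mat2 [:0, - 60 * a^4 + 12 * a^6, 0, 48 * a^4 - 60 * a^6, 0, 24 * a^6:] [:- 12 * a^3 + 6 * a^5, 0, 24 * a^3 - 48 * a^5, 0, 24 * a^5:] [:- 12 * a^3 + 6 * a^5, 0, 24 * a^3 - 48 * a^5, 0, 24 * a^5:] [:0, - 36 * a^4, 0, 24 * a^4:]) =
    mat2 [:- 60 * a^4 + 12 * a^6, 0, 264 * a^4 - 204 * a^6, 0, - 96 * a^4 + 240 * a^6, 0, - 48 * a^6:] [:0, 72 * a^3 - 108 * a^5, 0, - 48 * a^3 + 192 * a^5, 0, - 48 * a^5:] [:0, 72 * a^3 - 108 * a^5, 0, - 48 * a^3 + 192 * a^5, 0, - 48 * a^5:] [:- 36 * a^4, 0, 144 * a^4, 0, - 48 * a^4:]" for a :: complex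
  by (simp add: gderiv_mat2 pderiv_pCons mat2_eq_iff; simp add: algebra_simps)

lemma Vop_adj_3:
  assumes "cnj a = a"
  shows "Mmat a ** adj_poly (coeff (Vop a) 3) = mat2 [:0, 10 * a^4, 0, 6 * a^6:] [:4 * a^3, 0, 6 * a^5:] [:4 * a^3, 0, 6 * a^5:] [:0, 6 * a^4:]"
  unfolding coeff_Vop_3 using assms by (simp add: Mmat_def adj_poly_mat2 map_poly_pCons mat2_mult mat2_eq_iff; simp add: eval_nat_numeral algebra_simps)

lemma Vop_gderiv_3_1: "gderiv (mat2 [:0, 10 * a^4, 0, 6 * a^6:] [:4 * a^3, 0, 6 * a^5:] [:4 * a^3, 0, 6 * a^5:] [:0, 6 * a^4:]) =
    mat2 [:10 * a^4, 0, - 20 * a^4 + 18 * a^6, 0, - 12 * a^6:] [:0, - 8 * a^3 + 12 * a^5, 0, - 12 * a^5:] [:0, - 8 * a^3 + 12 * a^5, 0, - 12 * a^5:] [:6 * a^4, 0, - 12 * a^4:]" for a :: complex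
  by (simp add: gderiv_mat2 pderiv_pCons mat2_eq_iff; simp add: algebra_simps)

lemma Vop_gderiv_3_2: "gderiv (mat2 [:10 * a^4, 0, - 20 * a^4 + 18 * a^6, 0, - 12 * a^6:] [:0, - 8 * a^3 + 12 * a^5, 0, - 12 * a^5:] [:0, - 8 * a^3 + 12 * a^5, 0, - 12 * a^5:] [:6 * a^4, 0, - 12 * a^4:]) =
    mat2 [:0, - 60 * a^4 + 36 * a^6, 0, 40 * a^4 - 84 * a^6, 0, 24 * a^6:] [:- 8 * a^3 + 12 * a^5, 0, 16 * a^3 - 60 * a^5, 0, 24 * a^5:] [:- 8 * a^3 + 12 * a^5, 0, 16 * a^3 - 60 * a^5, 0, 24 * a^5:] [:0, - 36 * a^4, 0, 24 * a^4:]" for a :: complex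
  by (simp add: gderiv_mat2 pderiv_pCons mat2_eq_iff; simp add: algebra_simps)

lemma Vop_gderiv_3_3: "gderiv (mat2 [:0, - 60 * a^4 + 36 * a^6, 0, 40 * a^4 - 84 * a^6, 0, 24 * a^6:] [:- 8 * a^3 + 12 * a^5, 0, 16 * a^3 - 60 * a^5, 0, 24 * a^5:] [:- 8 * a^3 + 12 * a^5, 0, 16 * a^3 - 60 * a^5, 0, 24 * a^5:] [:0, - 36 * a^4, 0, 24 * a^4:]) =
    mat2 [:- 60 * a^4 + 36 * a^6, 0, 240 * a^4 - 324 * a^6, 0, - 80 * a^4 + 288 * a^6, 0, - 48 * a^6:] [:0, 48 * a^3 - 144 * a^5, 0, - 32 * a^3 + 216 * a^5, 0, - 48 * a^5:] [:0, 48 * a^3 - 144 * a^5, 0, - 32 * a^3 + 216 * a^5, 0, - 48 * a^5:] [:- 36 * a^4, 0, 144 * a^4, 0, - 48 * a^4:]" for a :: complex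
  by (simp add: gderiv_mat2 pderiv_pCons mat2_eq_iff; simp add: algebra_simps)

lemma Vop_adj_4:
  assumes "cnj a = a"
  shows "Mmat a ** adj_poly (coeff (Vop a) 4) = mat2 [:- (a^4), 0, - (a^6):] [:0, - (a^5):] [:0, - (a^5):] [:- (a^4):]"
  unfolding coeff_Vop_4 using assms by (simp add: Mmat_def adj_poly_mat2 map_poly_pCons mat2_mult mat2_eq_iff; simp add: eval_nat_numeral algebra_simps)

lemma Vop_gderiv_4_1: "gderiv (mat2 [:- (a^4), 0, - (a^6):] [:0, - (a^5):] [:0, - (a^5):] [:- (a^4):]) =
    mat2 [:0, 2 * a^4 - 2 * a^6, 0, 2 * a^6:] [:- (a^5), 0, 2 * a^5:] [:- (a^5), 0, 2 * a^5:] [:0, 2 * a^4:]" for a :: complex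
  by (simp add: gderiv_mat2 pderiv_pCons mat2_eq_iff; simp add: algebra_simps)

lemma Vop_gderiv_4_2: "gderiv (mat2 [:0, 2 * a^4 - 2 * a^6, 0, 2 * a^6:] [:- (a^5), 0, 2 * a^5:] [:- (a^5), 0, 2 * a^5:] [:0, 2 * a^4:]) =
    mat2 [:2 * a^4 - 2 * a^6, 0, - 4 * a^4 + 10 * a^6, 0, - 4 * a^6:] [:0, 6 * a^5, 0, - 4 * a^5:] [:0, 6 * a^5, 0, - 4 * a^5:] [:2 * a^4, 0, - 4 * a^4:]" for a :: complex
  by (simp add: gderiv_mat2 pderiv_pCons mat2_eq_iff; simp add: algebra_simps)

lemma Vop_gderiv_4_3: "gderiv (mat2 [:2 * a^4 - 2 * a^6, 0, - 4 * a^4 + 10 * a^6, 0, - 4 * a^6:] [:0, 6 * a^5, 0, - 4 * a^5:] [:0, 6 * a^5, 0, - 4 * a^5:] [:2 * a^4, 0, - 4 * a^4:]) =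
    mat2 [:0, - 12 * a^4 + 24 * a^6, 0, 8 * a^4 - 36 * a^6, 0, 8 * a^6:] [:6 * a^5, 0, - 24 * a^5, 0, 8 * a^5:] [:6 * a^5, 0, - 24 * a^5, 0, 8 * a^5:] [:0, - 12 * a^4, 0, 8 * a^4:]" for a :: complex
  by (simp add: gderiv_mat2 pderiv_pCons mat2_eq_iff; simp add: algebra_simps)

lemma Vop_gderiv_4_4: "gderiv (mat2 [:0, - 12 * a^4 + 24 * a^6, 0, 8 * a^4 - 36 * a^6, 0, 8 * a^6:] [:6 * a^5, 0, - 24 * a^5, 0, 8 * a^5:] [:6 * a^5, 0, - 24 * a^5, 0, 8 * a^5:] [:0, - 12 * a^4, 0, 8 * a^4:]) =
    mat2 [:- 12 * a^4 + 24 * a^6, 0, 48 * a^4 - 156 * a^6, 0, - 16 * a^4 + 112 * a^6, 0, - 16 * a^6:] [:0, - 60 * a^5, 0, 80 * a^5, 0, - 16 * a^5:] [:0, - 60 * a^5, 0, 80 * a^5, 0, - 16 * a^5:] [:- 12 * a^4, 0, 48 * a^4, 0, - 16 * a^4:]" for a :: complex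
  by (simp add: gderiv_mat2 pderiv_pCons mat2_eq_iff; simp add: algebra_simps)

section \<open>The same data for \<open>Dop\<close>\<close>

lemma coeff_Dop_0: "coeff (Dop a) 0 = mat2 0 0 0 [:- 16 - 4 * a^2:]"
  by (simp add: Dop_def coeff_pCons eval_nat_numeral)

lemma coeff_Dop_1: "coeff (Dop a) 1 = mat2 [:0, 16 + 12 * a^2:] [:- 32 * a - 24 * a^3:] 0 [:0, 16 + 4 * a^2:]"
  by (simp add: Dop_def coeff_pCons eval_nat_numeral)

lemma coeff_Dop_2: "coeff (Dop a) 2 = mat2 [:- 8 + 12 * a^4, 0, 4 * a^2:] [:0, - 24 * a^3 - 12 * a^5:] 0 [:- 8 - 12 * a^2, 0, 4 * a^2:]"
  by (simp add: Dop_def coeff_pCons eval_nat_numeral)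

lemma coeff_Dop_3: "coeff (Dop a) 3 = mat2 [:0, - 4 * a^2 + 4 * a^4:] [:4 * a^3, 0, - 4 * a^5:] [:4 * a^3:] [:0, - 4 * a^2 - 4 * a^4:]"
  by (simp add: Dop_def coeff_pCons eval_nat_numeral)

lemma coeff_Dop_4: "coeff (Dop a) 4 = mat2 [:a^2:] 0 0 [:a^2:]"
  by (simp add: Dop_def coeff_pCons eval_nat_numeral)

lemma Dop_adj_0:
  assumes "cnj a = a"
  shows "Mmat a ** adj_poly (coeff (Dop a) 0) = mat2 0 [:0, - 32 * a - 8 * a^3, 0, - 16 * a^3 - 4 * a^5:] 0 [:- 16 - 4 * a^2, 0, - 16 * a^2 - 4 * a^4:]"
  unfolding coeff_Dop_0 using assms by (simp add: Mmat_def adj_poly_mat2 map_poly_pCons mat2_mult mat2_eq_iff; simp add: eval_nat_numeral algebra_simps)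

lemma Dop_adj_1:
  assumes "cnj a = a"
  shows "Mmat a ** adj_poly (coeff (Dop a) 1) = mat2 [:0, 16 - 52 * a^2 - 48 * a^4, 0, 48 * a^2 + 4 * a^4 - 24 * a^6, 0, 16 * a^4 + 12 * a^6:] [:0, 0, 32 * a + 8 * a^3, 0, 16 * a^3 + 4 * a^5:] [:- 32 * a - 24 * a^3, 0, 32 * a - 8 * a^3 - 24 * a^5, 0, 16 * a^3 + 12 * a^5:] [:0, 16 + 4 * a^2, 0, 16 * a^2 + 4 * a^4:]"
  unfolding coeff_Dop_1 using assms by (simp add: Mmat_def adj_poly_mat2 map_poly_pCons mat2_mult mat2_eq_iff; simp add: eval_nat_numeral algebra_simps)

lemma Dop_gderiv_1_1: "gderiv (mat2 [:0, 16 - 52 * a^2 - 48 * a^4, 0, 48 * a^2 + 4 * a^4 - 24 * a^6, 0, 16 * a^4 + 12 * a^6:] [:0, 0, 32 * a + 8 * a^3, 0, 16 * a^3 + 4 * a^5:] [:- 32 * a - 24 * a^3, 0, 32 * a - 8 * a^3 - 24 * a^5, 0, 16 * a^3 + 12 * a^5:] [:0, 16 + 4 * a^2, 0, 16 * a^2 + 4 * a^4:]) =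
    mat2 [:16 - 52 * a^2 - 48 * a^4, 0, - 32 + 248 * a^2 + 108 * a^4 - 72 * a^6, 0, - 96 * a^2 + 72 * a^4 + 108 * a^6, 0, - 32 * a^4 - 24 * a^6:] [:0, 64 * a + 16 * a^3, 0, - 64 * a + 48 * a^3 + 16 * a^5, 0, - 32 * a^3 - 8 * a^5:] [:0, 128 * a + 32 * a^3 - 48 * a^5, 0, - 64 * a + 80 * a^3 + 96 * a^5, 0, - 32 * a^3 - 24 * a^5:] [:16 + 4 * a^2, 0, - 32 + 40 * a^2 + 12 * a^4, 0, - 32 * a^2 - 8 * a^4:]" for a :: complex
  by (simp add: gderiv_mat2 pderiv_pCons mat2_eq_iff; simp add: algebra_simps)

lemma Dop_adj_2:
  assumes "cnj a = a"
  shows "Mmat a ** adj_poly (coeff (Dop a) 2) = mat2 [:- 8 + 12 * a^4, 0, - 20 * a^2 - 48 * a^4 + 12 * a^6, 0, 4 * a^4 - 24 * a^6, 0, 4 * a^6:] [:0, - 16 * a - 24 * a^3, 0, - 12 * a^5, 0, 4 * a^5:] [:0, - 16 * a - 24 * a^3 + 12 * a^5, 0, - 24 * a^5, 0, 4 * a^5:] [:- 8 - 12 * a^2, 0, - 4 * a^2 - 12 * a^4, 0, 4 * a^4:]"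
  unfolding coeff_Dop_2 using assms by (simp add: Mmat_def adj_poly_mat2 map_poly_pCons mat2_mult mat2_eq_iff; simp add: eval_nat_numeral algebra_simps)

lemma Dop_gderiv_2_1: "gderiv (mat2 [:- 8 + 12 * a^4, 0, - 20 * a^2 - 48 * a^4 + 12 * a^6, 0, 4 * a^4 - 24 * a^6, 0, 4 * a^6:] [:0, - 16 * a - 24 * a^3, 0, - 12 * a^5, 0, 4 * a^5:] [:0, - 16 * a - 24 * a^3 + 12 * a^5, 0, - 24 * a^5, 0, 4 * a^5:] [:- 8 - 12 * a^2, 0, - 4 * a^2 - 12 * a^4, 0, 4 * a^4:]) =
    mat2 [:0, 16 - 40 * a^2 - 120 * a^4 + 24 * a^6, 0, 40 * a^2 + 112 * a^4 - 120 * a^6, 0, - 8 * a^4 + 72 * a^6, 0, - 8 * a^6:] [:- 16 * a - 24 * a^3, 0, 32 * a + 48 * a^3 - 36 * a^5, 0, 44 * a^5, 0, - 8 * a^5:] [:- 16 * a - 24 * a^3 + 12 * a^5, 0, 32 * a + 48 * a^3 - 96 * a^5, 0, 68 * a^5, 0, - 8 * a^5:] [:0, 16 + 16 * a^2 - 24 * a^4, 0, 8 * a^2 + 40 * a^4, 0, - 8 * a^4:]" for a :: complex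
  by (simp add: gderiv_mat2 pderiv_pCons mat2_eq_iff; simp add: algebra_simps)

lemma Dop_gderiv_2_2: "gderiv (mat2 [:0, 16 - 40 * a^2 - 120 * a^4 + 24 * a^6, 0, 40 * a^2 + 112 * a^4 - 120 * a^6, 0, - 8 * a^4 + 72 * a^6, 0, - 8 * a^6:] [:- 16 * a - 24 * a^3, 0, 32 * a + 48 * a^3 - 36 * a^5, 0, 44 * a^5, 0, - 8 * a^5:] [:- 16 * a - 24 * a^3 + 12 * a^5, 0, 32 * a + 48 * a^3 - 96 * a^5, 0, 68 * a^5, 0, - 8 * a^5:] [:0, 16 + 16 * a^2 - 24 * a^4, 0, 8 * a^2 + 40 * a^4, 0, - 8 * a^4:]) =
    mat2 [:16 - 40 * a^2 - 120 * a^4 + 24 * a^6, 0, - 32 + 200 * a^2 + 576 * a^4 - 408 * a^6, 0, - 80 * a^2 - 264 * a^4 + 600 * a^6, 0, 16 * a^4 - 200 * a^6, 0, 16 * a^6:] [:0, 96 * a + 144 * a^3 - 72 * a^5, 0, - 64 * a - 96 * a^3 + 248 * a^5, 0, - 136 * a^5, 0, 16 * a^5:] [:0, 96 * a + 144 * a^3 - 216 * a^5, 0, - 64 * a - 96 * a^3 + 464 * a^5, 0, - 184 * a^5, 0, 16 * a^5:] [:16 + 16 * a^2 - 24 * a^4, 0, - 32 - 8 * a^2 + 168 * a^4, 0, - 16 * a^2 - 120 * a^4, 0, 16 * a^4:]" for a :: complex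
  by (simp add: gderiv_mat2 pderiv_pCons mat2_eq_iff; simp add: algebra_simps)

lemma Dop_adj_3:
  assumes "cnj a = a"
  shows "Mmat a ** adj_poly (coeff (Dop a) 3) = mat2 [:0, - 4 * a^2 + 12 * a^4, 0, - 12 * a^4 + 8 * a^6, 0, - 4 * a^6:] [:4 * a^3, 0, - 8 * a^3 + 4 * a^5, 0, - 4 * a^5:] [:4 * a^3, 0, - 8 * a^3 + 8 * a^5, 0, - 4 * a^5:] [:0, - 4 * a^2 + 4 * a^4, 0, - 4 * a^4:]"
  unfolding coeff_Dop_3 using assms by (simp add: Mmat_def adj_poly_mat2 map_poly_pCons mat2_mult mat2_eq_iff; simp add: eval_nat_numeral algebra_simps)

lemma Dop_gderiv_3_1: "gderiv (mat2 [:0, - 4 * a^2 + 12 * a^4, 0, - 12 * a^4 + 8 * a^6, 0, - 4 * a^6:] [:4 * a^3, 0, - 8 * a^3 + 4 * a^5, 0, - 4 * a^5:] [:4 * a^3, 0, - 8 * a^3 + 8 * a^5, 0, - 4 * a^5:] [:0, - 4 * a^2 + 4 * a^4, 0, - 4 * a^4:]) =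
    mat2 [:- 4 * a^2 + 12 * a^4, 0, 8 * a^2 - 60 * a^4 + 24 * a^6, 0, 24 * a^4 - 36 * a^6, 0, 8 * a^6:] [:0, - 24 * a^3 + 8 * a^5, 0, 16 * a^3 - 24 * a^5, 0, 8 * a^5:] [:0, - 24 * a^3 + 16 * a^5, 0, 16 * a^3 - 32 * a^5, 0, 8 * a^5:] [:- 4 * a^2 + 4 * a^4, 0, 8 * a^2 - 20 * a^4, 0, 8 * a^4:]" for a :: complex
  by (simp add: gderiv_mat2 pderiv_pCons mat2_eq_iff; simp add: algebra_simps)

lemma Dop_gderiv_3_2: "gderiv (mat2 [:- 4 * a^2 + 12 * a^4, 0, 8 * a^2 - 60 * a^4 + 24 * a^6, 0, 24 * a^4 - 36 * a^6, 0, 8 * a^6:] [:0, - 24 * a^3 + 8 * a^5, 0, 16 * a^3 - 24 * a^5, 0, 8 * a^5:] [:0, - 24 * a^3 + 16 * a^5, 0, 16 * a^3 - 32 * a^5, 0, 8 * a^5:] [:- 4 * a^2 + 4 * a^4, 0, 8 * a^2 - 20 * a^4, 0, 8 * a^4:]) =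
    mat2 [:0, 24 * a^2 - 144 * a^4 + 48 * a^6, 0, - 16 * a^2 + 216 * a^4 - 192 * a^6, 0, - 48 * a^4 + 120 * a^6, 0, - 16 * a^6:] [:- 24 * a^3 + 8 * a^5, 0, 96 * a^3 - 88 * a^5, 0, - 32 * a^3 + 88 * a^5, 0, - 16 * a^5:] [:- 24 * a^3 + 16 * a^5, 0, 96 * a^3 - 128 * a^5, 0, - 32 * a^3 + 104 * a^5, 0, - 16 * a^5:] [:0, 24 * a^2 - 48 * a^4, 0, - 16 * a^2 + 72 * a^4, 0, - 16 * a^4:]" for a :: complex
  by (simp add: gderiv_mat2 pderiv_pCons mat2_eq_iff; simp add: algebra_simps)

lemma Dop_gderiv_3_3: "gderiv (mat2 [:0, 24 * a^2 - 144 * a^4 + 48 * a^6, 0, - 16 * a^2 + 216 * a^4 - 192 * a^6, 0, - 48 * a^4 + 120 * a^6, 0, - 16 * a^6:] [:- 24 * a^3 + 8 * a^5, 0, 96 * a^3 - 88 * a^5, 0, - 32 * a^3 + 88 * a^5, 0, - 16 * a^5:] [:- 24 * a^3 + 16 * a^5, 0, 96 * a^3 - 128 * a^5, 0, - 32 * a^3 + 104 * a^5, 0, - 16 * a^5:] [:0, 24 * a^2 - 48 * a^4, 0, - 16 * a^2 + 72 * a^4, 0, - 16 * a^4:]) =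
    mat2 [:24 * a^2 - 144 * a^4 + 48 * a^6, 0, - 96 * a^2 + 936 * a^4 - 672 * a^6, 0, 32 * a^2 - 672 * a^4 + 984 * a^6, 0, 96 * a^4 - 352 * a^6, 0, 32 * a^6:] [:0, 240 * a^3 - 192 * a^5, 0, - 320 * a^3 + 528 * a^5, 0, 64 * a^3 - 272 * a^5, 0, 32 * a^5:] [:0, 240 * a^3 - 288 * a^5, 0, - 320 * a^3 + 672 * a^5, 0, 64 * a^3 - 304 * a^5, 0, 32 * a^5:] [:24 * a^2 - 48 * a^4, 0, - 96 * a^2 + 312 * a^4, 0, 32 * a^2 - 224 * a^4, 0, 32 * a^4:]" for a :: complex
  by (simp add: gderiv_mat2 pderiv_pCons mat2_eq_iff; simp add: algebra_simps)

lemma Dop_adj_4: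
  assumes "cnj a = a"
  shows "Mmat a ** adj_poly (coeff (Dop a) 4) = mat2 [:a^2, 0, 3 * a^4, 0, a^6:] [:0, 2 * a^3, 0, a^5:] [:0, 2 * a^3, 0, a^5:] [:a^2, 0, a^4:]"
  unfolding coeff_Dop_4 using assms by (simp add: Mmat_def adj_poly_mat2 map_poly_pCons mat2_mult mat2_eq_iff; simp add: eval_nat_numeral algebra_simps)

lemma Dop_gderiv_4_1: "gderiv (mat2 [:a^2, 0, 3 * a^4, 0, a^6:] [:0, 2 * a^3, 0, a^5:] [:0, 2 * a^3, 0, a^5:] [:a^2, 0, a^4:]) =
    mat2 [:0, - 2 * a^2 + 6 * a^4, 0, - 6 * a^4 + 4 * a^6, 0, - 2 * a^6:] [:2 * a^3, 0, - 4 * a^3 + 3 * a^5, 0, - 2 * a^5:] [:2 * a^3, 0, - 4 * a^3 + 3 * a^5, 0, - 2 * a^5:] [:0, - 2 * a^2 + 2 * a^4, 0, - 2 * a^4:]" for a :: complex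
  by (simp add: gderiv_mat2 pderiv_pCons mat2_eq_iff; simp add: algebra_simps)

lemma Dop_gderiv_4_2: "gderiv (mat2 [:0, - 2 * a^2 + 6 * a^4, 0, - 6 * a^4 + 4 * a^6, 0, - 2 * a^6:] [:2 * a^3, 0, - 4 * a^3 + 3 * a^5, 0, - 2 * a^5:] [:2 * a^3, 0, - 4 * a^3 + 3 * a^5, 0, - 2 * a^5:] [:0, - 2 * a^2 + 2 * a^4, 0, - 2 * a^4:]) =
    mat2 [:- 2 * a^2 + 6 * a^4, 0, 4 * a^2 - 30 * a^4 + 12 * a^6, 0, 12 * a^4 - 18 * a^6, 0, 4 * a^6:] [:0, - 12 * a^3 + 6 * a^5, 0, 8 * a^3 - 14 * a^5, 0, 4 * a^5:] [:0, - 12 * a^3 + 6 * a^5, 0, 8 * a^3 - 14 * a^5, 0, 4 * a^5:] [:- 2 * a^2 + 2 * a^4, 0, 4 * a^2 - 10 * a^4, 0, 4 * a^4:]" for a :: complex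
  by (simp add: gderiv_mat2 pderiv_pCons mat2_eq_iff; simp add: algebra_simps)

lemma Dop_gderiv_4_3: "gderiv (mat2 [:- 2 * a^2 + 6 * a^4, 0, 4 * a^2 - 30 * a^4 + 12 * a^6, 0, 12 * a^4 - 18 * a^6, 0, 4 * a^6:] [:0, - 12 * a^3 + 6 * a^5, 0, 8 * a^3 - 14 * a^5, 0, 4 * a^5:] [:0, - 12 * a^3 + 6 * a^5, 0, 8 * a^3 - 14 * a^5, 0, 4 * a^5:] [:- 2 * a^2 + 2 * a^4, 0, 4 * a^2 - 10 * a^4, 0, 4 * a^4:]) =
    mat2 [:0, 12 * a^2 - 72 * a^4 + 24 * a^6, 0, - 8 * a^2 + 108 * a^4 - 96 * a^6, 0, - 24 * a^4 + 60 * a^6, 0, - 8 * a^6:] [:- 12 * a^3 + 6 * a^5, 0, 48 * a^3 - 54 * a^5, 0, - 16 * a^3 + 48 * a^5, 0, - 8 * a^5:] [:- 12 * a^3 + 6 * a^5, 0, 48 * a^3 - 54 * a^5, 0, - 16 * a^3 + 48 * a^5, 0, - 8 * a^5:] [:0, 12 * a^2 - 24 * a^4, 0, - 8 * a^2 + 36 * a^4, 0, - 8 * a^4:]" for a :: complex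
  by (simp add: gderiv_mat2 pderiv_pCons mat2_eq_iff; simp add: algebra_simps)

lemma Dop_gderiv_4_4: "gderiv (mat2 [:0, 12 * a^2 - 72 * a^4 + 24 * a^6, 0, - 8 * a^2 + 108 * a^4 - 96 * a^6, 0, - 24 * a^4 + 60 * a^6, 0, - 8 * a^6:] [:- 12 * a^3 + 6 * a^5, 0, 48 * a^3 - 54 * a^5, 0, - 16 * a^3 + 48 * a^5, 0, - 8 * a^5:] [:- 12 * a^3 + 6 * a^5, 0, 48 * a^3 - 54 * a^5, 0, - 16 * a^3 + 48 * a^5, 0, - 8 * a^5:] [:0, 12 * a^2 - 24 * a^4, 0, - 8 * a^2 + 36 * a^4, 0, - 8 * a^4:]) =
    mat2 [:12 * a^2 - 72 * a^4 + 24 * a^6, 0, - 48 * a^2 + 468 * a^4 - 336 * a^6, 0, 16 * a^2 - 336 * a^4 + 492 * a^6, 0, 48 * a^4 - 176 * a^6, 0, 16 * a^6:] [:0, 120 * a^3 - 120 * a^5, 0, - 160 * a^3 + 300 * a^5, 0, 32 * a^3 - 144 * a^5, 0, 16 * a^5:] [:0, 120 * a^3 - 120 * a^5, 0, - 160 * a^3 + 300 * a^5, 0, 32 * a^3 - 144 * a^5, 0, 16 * a^5:] [:12 * a^2 - 24 * a^4, 0, - 48 * a^2 + 156 * a^4, 0, 16 * a^2 - 112 * a^4, 0, 16 * a^4:]" for a :: complex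
  by (simp add: gderiv_mat2 pderiv_pCons mat2_eq_iff; simp add: algebra_simps)

text \<open>With this and the next two lemmas, the iterates, index differences and binomials in
  \<open>gadj_coeff\<close> take the shape in which the tabulated derivatives rewrite them.\<close>

lemma funpow_num:
  "(f ^^ 0) x = x" "(f ^^ 1) x = f x" "(f ^^ 2) x = f (f x)" "(f ^^ 3) x = f (f (f x))" "(f ^^ 4) x = f (f (f (f x)))"
  by (simp_all add: eval_nat_numeral)

lemma diff_num:
  "2 - 1 = (1::nat)" "3 - 1 = (2::nat)" "3 - 2 = (1::nat)" "4 - 1 = (3::nat)" "4 - 2 = (2::nat)" "4 - 3 = (1::nat)"
  "m - 0 = m" "m - m = (0::nat)"
  by simp_all

lemma binomial_num:
  "(m choose 0) = 1" "(m choose m) = 1"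
  
  "(2 choose 1) = 2" "(3 choose 1) = 3" "(3 choose 2) = 3" "(4 choose 1) = 4" "(4 choose 2) = 6" "(4 choose 3) = 4"
  by (simp_all add: eval_nat_numeral)

section \<open>The adjoints of \<open>Vop\<close> and \<open>Dop\<close>, one coefficient at a
  time\<close>

lemma gadj_coeff_Vop_0:
  assumes a: "cnj a = a" "a \<noteq> 0"
  shows "coeff (Nop a) 0 ** mat 1 = gadj_coeff (Mmat a) (Vop a) 0"
  unfolding gadj_coeff_def degree_Vop[OF a(2)] sum_to_4 Vop_adj_0[OF a(1)] Vop_adj_1[OF a(1)] Vop_adj_2[OF a(1)] Vop_adj_3[OF a(1)] Vop_adj_4[OF a(1)]
  by (simp only: diff_num funpow_num binomial_num Vop_gderiv_1_1 Vop_gderiv_2_1 Vop_gderiv_2_2 Vop_gderiv_3_1 Vop_gderiv_3_2 Vop_gderiv_3_3 Vop_gderiv_4_1 Vop_gderiv_4_2 Vop_gderiv_4_3 Vop_gderiv_4_4;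
      simp add: smat_mat2 of_int_poly mat2_add;
      simp add: Nop_def coeff_pCons mat2_mult mat_1_mat2 mat2_eq_iff;
      simp add: eval_nat_numeral algebra_simps)

lemma gadj_coeff_Vop_1:
  assumes a: "cnj a = a" "a \<noteq> 0"
  shows "coeff (Nop a) 1 ** mat 1 = gadj_coeff (Mmat a) (Vop a) 1"
  unfolding gadj_coeff_def degree_Vop[OF a(2)] sum_to_4 Vop_adj_1[OF a(1)] Vop_adj_2[OF a(1)] Vop_adj_3[OF a(1)] Vop_adj_4[OF a(1)]
  by (simp only: diff_num funpow_num binomial_num Vop_gderiv_2_1 Vop_gderiv_3_1 Vop_gderiv_3_2 Vop_gderiv_4_1 Vop_gderiv_4_2 Vop_gderiv_4_3;
      simp add: smat_mat2 of_int_poly mat2_add;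
      simp add: Nop_def coeff_pCons mat2_mult mat_1_mat2 mat2_eq_iff;
      simp add: eval_nat_numeral algebra_simps)

lemma gadj_coeff_Vop_2:
  assumes a: "cnj a = a" "a \<noteq> 0"
  shows "coeff (Nop a) 2 ** mat 1 = gadj_coeff (Mmat a) (Vop a) 2"
  unfolding gadj_coeff_def degree_Vop[OF a(2)] sum_to_4 Vop_adj_2[OF a(1)] Vop_adj_3[OF a(1)] Vop_adj_4[OF a(1)]
  by (simp only: diff_num funpow_num binomial_num Vop_gderiv_3_1 Vop_gderiv_4_1 Vop_gderiv_4_2;
      simp add: smat_mat2 of_int_poly mat2_add;
      simp add: Nop_def coeff_pCons mat2_mult mat_1_mat2 mat2_eq_iff;
      simp add: eval_nat_numeral algebra_simps)

lemma gadj_coeff_Vop_3: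
  assumes a: "cnj a = a" "a \<noteq> 0"
  shows "coeff (Nop a) 3 ** mat 1 = gadj_coeff (Mmat a) (Vop a) 3"
  unfolding gadj_coeff_def degree_Vop[OF a(2)] sum_to_4 Vop_adj_3[OF a(1)] Vop_adj_4[OF a(1)]
  by (simp only: diff_num funpow_num binomial_num Vop_gderiv_4_1;
      simp add: smat_mat2 of_int_poly mat2_add;
      simp add: Nop_def coeff_pCons mat2_mult mat_1_mat2 mat2_eq_iff;
      simp add: eval_nat_numeral algebra_simps)

lemma gadj_coeff_Vop_4:
  assumes a: "cnj a = a" "a \<noteq> 0"
  shows "coeff (Nop a) 4 ** mat 1 = gadj_coeff (Mmat a) (Vop a) 4"
  unfolding gadj_coeff_def degree_Vop[OF a(2)] sum_to_4 Vop_adj_4[OF a(1)]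
  by (simp only: diff_num funpow_num binomial_num ;
      simp add: smat_mat2 of_int_poly mat2_add;
      simp add: Nop_def coeff_pCons mat2_mult mat_1_mat2 mat2_eq_iff;
      simp add: eval_nat_numeral algebra_simps)

lemma gadj_coeff_Dop_0:
  assumes a: "cnj a = a" "a \<noteq> 0"
  shows "coeff (Dop a) 0 ** Mmat a = gadj_coeff (Mmat a) (Dop a) 0"
  \<comment> \<open>The products on the right mention \<open>coeff (Dop a) 0\<close> too, so they
    are replaced first and only the occurrence on the left is expanded afterwards.\<close>
  unfolding gadj_coeff_def degree_Dop[OF a(2)] sum_to_4 Dop_adj_0[OF a(1)] Dop_adj_1[OF a(1)] Dop_adj_2[OF a(1)] Dop_adj_3[OF a(1)] Dop_adj_4[OF a(1)] unfolding coeff_Dop_0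
  by (simp only: diff_num funpow_num binomial_num Dop_gderiv_1_1 Dop_gderiv_2_1 Dop_gderiv_2_2 Dop_gderiv_3_1 Dop_gderiv_3_2 Dop_gderiv_3_3 Dop_gderiv_4_1 Dop_gderiv_4_2 Dop_gderiv_4_3 Dop_gderiv_4_4;
      simp add: smat_mat2 of_int_poly mat2_add;
      simp add: Mmat_def mat2_mult mat2_eq_iff;
      simp add: eval_nat_numeral algebra_simps)

lemma gadj_coeff_Dop_1:
  assumes a: "cnj a = a" "a \<noteq> 0"
  shows "coeff (Dop a) 1 ** Mmat a = gadj_coeff (Mmat a) (Dop a) 1"
  unfolding gadj_coeff_def degree_Dop[OF a(2)] sum_to_4 Dop_adj_1[OF a(1)] Dop_adj_2[OF a(1)] Dop_adj_3[OF a(1)] Dop_adj_4[OF a(1)] unfolding coeff_Dop_1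
  by (simp only: diff_num funpow_num binomial_num Dop_gderiv_2_1 Dop_gderiv_3_1 Dop_gderiv_3_2 Dop_gderiv_4_1 Dop_gderiv_4_2 Dop_gderiv_4_3;
      simp add: smat_mat2 of_int_poly mat2_add;
      simp add: Mmat_def mat2_mult mat2_eq_iff;
      simp add: eval_nat_numeral algebra_simps)

lemma gadj_coeff_Dop_2:
  assumes a: "cnj a = a" "a \<noteq> 0"
  shows "coeff (Dop a) 2 ** Mmat a = gadj_coeff (Mmat a) (Dop a) 2"
  unfolding gadj_coeff_def degree_Dop[OF a(2)] sum_to_4 Dop_adj_2[OF a(1)] Dop_adj_3[OF a(1)] Dop_adj_4[OF a(1)] unfolding coeff_Dop_2
  by (simp only: diff_num funpow_num binomial_num Dop_gderiv_3_1 Dop_gderiv_4_1 Dop_gderiv_4_2;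
      simp add: smat_mat2 of_int_poly mat2_add;
      simp add: Mmat_def mat2_mult mat2_eq_iff;
      simp add: eval_nat_numeral algebra_simps)

lemma gadj_coeff_Dop_3:
  assumes a: "cnj a = a" "a \<noteq> 0"
  shows "coeff (Dop a) 3 ** Mmat a = gadj_coeff (Mmat a) (Dop a) 3"
  unfolding gadj_coeff_def degree_Dop[OF a(2)] sum_to_4 Dop_adj_3[OF a(1)] Dop_adj_4[OF a(1)] unfolding coeff_Dop_3
  by (simp only: diff_num funpow_num binomial_num Dop_gderiv_4_1;
      simp add: smat_mat2 of_int_poly mat2_add;
      simp add: Mmat_def mat2_mult mat2_eq_iff;
      simp add: eval_nat_numeral algebra_simps)

lemma gadj_coeff_Dop_4:
  assumes a: "cnj a = a" "a \<noteq> 0"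
  shows "coeff (Dop a) 4 ** Mmat a = gadj_coeff (Mmat a) (Dop a) 4"
  unfolding gadj_coeff_def degree_Dop[OF a(2)] sum_to_4 Dop_adj_4[OF a(1)] unfolding coeff_Dop_4
  by (simp only: diff_num funpow_num binomial_num ;
      simp add: smat_mat2 of_int_poly mat2_add;
      simp add: Mmat_def mat2_mult mat2_eq_iff;
      simp add: eval_nat_numeral algebra_simps)

lemma gadjoint_Vop_Nop: "cnj a = a \<Longrightarrow> a \<noteq> 0 \<Longrightarrow> gadjoint (mat 1) (Mmat a) (Vop a) (Nop a)"
  by (simp add: gadjoint_def degree_Vop degree_Nop le_4_iff gadj_coeff_Vop_0 gadj_coeff_Vop_1[unfolded One_nat_def]
      gadj_coeff_Vop_2 gadj_coeff_Vop_3 gadj_coeff_Vop_4 del: matrix_mul_rid)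

lemma gadjoint_Dop: "cnj a = a \<Longrightarrow> a \<noteq> 0 \<Longrightarrow> gadjoint (Mmat a) (Mmat a) (Dop a) (Dop a)"
  by (simp add: gadjoint_def degree_Dop le_4_iff gadj_coeff_Dop_0 gadj_coeff_Dop_1[unfolded One_nat_def]
      gadj_coeff_Dop_2 gadj_coeff_Dop_3 gadj_coeff_Dop_4)

section \<open>Degree bounds and symbols of the operators\<close>

lemma mat_coeff_mat2: "mat_coeff (mat2 p q r s) k = mat2 (coeff p k) (coeff q k) (coeff r k) (coeff s k)"
  by (rule mat2_eqI) simp_all

lemma deg_noninc_quartic:
  assumes "\<And>k. 0 < k \<Longrightarrow> mat_coeff A0 k = 0" "\<And>k. 1 < k \<Longrightarrow> mat_coeff A1 k = 0" "\<And>k. 2 < k \<Longrightarrow> mat_coeff A2 k = 0"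
    "\<And>k. 3 < k \<Longrightarrow> mat_coeff A3 k = 0" "\<And>k. 4 < k \<Longrightarrow> mat_coeff A4 k = 0"
  shows "deg_noninc [:A0, A1, A2, A3, A4:]"
  using assms by (auto simp: deg_noninc_def coeff_pCons eval_nat_numeral split: nat.split)

lemma deg_noninc_Vop: "deg_noninc (Vop a)"
  unfolding Vop_def
  by (rule deg_noninc_quartic; simp add: mat_coeff_mat2; auto simp: coeff_pCons mat2_0 split: nat.split)

lemma deg_noninc_Nop: "deg_noninc (Nop a)"
  unfolding Nop_def
  by (rule deg_noninc_quartic; simp add: mat_coeff_mat2; auto simp: coeff_pCons mat2_0 split: nat.split)

lemma deg_noninc_Dop: "deg_noninc (Dop a)"
  unfolding Dop_def
  by (rule deg_noninc_quartic; simp add: mat_coeff_mat2; auto simp: coeff_pCons mat2_0 split: nat.split)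

lemma ffac_num:
  "ffac n 1 = of_nat n" "ffac n 2 = of_nat n * (of_nat n - 1)" "ffac n 3 = of_nat n * (of_nat n - 1) * (of_nat n - 2)"
  "ffac n 4 = of_nat n * (of_nat n - 1) * (of_nat n - 2) * (of_nat n - 3)"
  by (simp_all add: eval_nat_numeral)

lemma coeff_num:
  "coeff (pCons c p) 1 = coeff p 0" "coeff (pCons c p) 2 = coeff p 1" "coeff (pCons c p) 3 = coeff p 2"
  "coeff (pCons c p) 4 = coeff p 3"
  by (simp_all add: eval_nat_numeral)

lemma symb_Vop:
  assumes "a \<noteq> 0"
  shows "symb (Vop a) n = mat2 (16 + 8 * a^2 * of_nat n) 0 0 (16 + (24 * a^2 + 12 * a^4) * of_nat n +
    (12 * a^4 + 6 * a^6) * (of_nat n * (of_nat n - 1)) + 2 * a^6 * (of_nat n * (of_nat n - 1) * (of_nat n - 2)))"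
  unfolding symb_def degree_Vop[OF assms] atMost_atLeast0 sum_to_4 ffac_num coeff_Vop_0 coeff_Vop_1 coeff_Vop_2
    coeff_Vop_3 coeff_Vop_4 mat_coeff_mat2 smat_mat2 mat2_add coeff_num
  by (simp add: mat2_eq_iff mult_ac)

text \<open>In the i-th coefficient of \<open>Vop\<close> the diagonal entries have the parity of i
  and the antidiagonal entries the opposite parity. Hence \<open>symb\<close> is diagonal and
  \<open>subsymb\<close> antidiagonal.\<close>

lemma subsymb_Vop:
  assumes "a \<noteq> 0"
  defines "s \<equiv> \<lambda>n. - ((16 * a + 12 * a^3) * of_nat n + (12 * a^3 + 6 * a^5) * (of_nat n * (of_nat n - 1))
      + 2 * a^5 * (of_nat n * (of_nat n - 1) * (of_nat n - 2)))"
  shows "subsymb (Vop a) n = mat2 0 (s n) (s n) 0"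
proof -
  have m: "1 - 1 = (0::nat)" "2 - 1 = (1::nat)" "3 - 1 = (2::nat)" "4 - 1 = (3::nat)" by simp_all
  show ?thesis
    unfolding subsymb_def degree_Vop[OF assms(1)] sum_to_4 ffac_num coeff_Vop_0 coeff_Vop_1 coeff_Vop_2
      coeff_Vop_3 coeff_Vop_4 mat_coeff_mat2 smat_mat2 mat2_add m coeff_num s_def
    by (simp add: mat2_eq_iff algebra_simps)
qed

text \<open>The order is 4 but the eigenvalues are only quadratic in n, since the coefficients of
  orders 3 and 4 have degrees below 3 and 4. The second entry is the first one at n - 1, a pattern
  that reappears in \<open>diagonal_recurrence\<close>.\<close>

lemma symb_Dop:
  assumes "a \<noteq> 0"
  shows "symb (Dop a) n = mat2 ((16 + 12 * a^2) * of_nat n + 4 * a^2 * (of_nat n * (of_nat n - 1))) 0 0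
    (- 16 - 4 * a^2 + (16 + 4 * a^2) * of_nat n + 4 * a^2 * (of_nat n * (of_nat n - 1)))"
  unfolding symb_def degree_Dop[OF assms] atMost_atLeast0 sum_to_4 ffac_num coeff_Dop_0 coeff_Dop_1 coeff_Dop_2
    coeff_Dop_3 coeff_Dop_4 mat_coeff_mat2 smat_mat2 mat2_add coeff_num
  by (simp add: mat2_eq_iff mult_ac)

text \<open>With \<open>b = 2 + a\<^sup>2 n\<close> these entries are \<open>8 b\<close> and \<open>2 (b\<^sup>3 - a\<^sup>4 b + 2 a\<^sup>4)\<close>.\<close>

definition lamb1 :: "complex \<Rightarrow> nat \<Rightarrow> complex" where
  "lamb1 a n = 16 + 8 * a^2 * of_nat n"

definition lamb2 :: "complex \<Rightarrow> nat \<Rightarrow> complex" where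
  "lamb2 a n = 16 + (24 * a^2 + 12 * a^4) * of_nat n +
    (12 * a^4 + 6 * a^6) * (of_nat n * (of_nat n - 1)) + 2 * a^6 * (of_nat n * (of_nat n - 1) * (of_nat n - 2))"

text \<open>Written in falling factorials, both entries have nonnegative coefficients for real a and
  constant term 16, and falling factorials of natural numbers are nonnegative. In powers of n the
  linear coefficient of \<open>lamb2\<close> may be negative.\<close>

lemma lamb_nonzero:
  fixes r :: real
  shows "lamb1 (of_real r) n \<noteq> 0" and "lamb2 (of_real r) n \<noteq> 0"
proof -
  have n2: "0 \<le> real n * (real n - 1)" by (cases n) auto
  have n3: "0 \<le> real n * (real n - 1) * (real n - 2)"
  proof (cases "n \<le> 1")
    case True
    then have "n = 0 \<or> n = 1" by auto
    then show ?thesis by auto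
  next
    case False
    then show ?thesis by (intro mult_nonneg_nonneg) auto
  qed
  have "lamb1 (of_real r) n = of_real (16 + 8 * r^2 * real n)"
    by (simp add: lamb1_def)
  moreover have "0 < 16 + 8 * r^2 * real n" by (intro add_pos_nonneg) auto
  ultimately show "lamb1 (of_real r) n \<noteq> 0" by (metis less_irrefl of_real_eq_0_iff)
  have "lamb2 (of_real r) n = of_real (16 + (24 * r^2 + 12 * r^4) * real n +
    (12 * r^4 + 6 * r^6) * (real n * (real n - 1)) + 2 * r^6 * (real n * (real n - 1) * (real n - 2)))"
    by (simp add: lamb2_def)
  moreover have "0 < 16 + (24 * r^2 + 12 * r^4) * real n +
    (12 * r^4 + 6 * r^6) * (real n * (real n - 1)) + 2 * r^6 * (real n * (real n - 1) * (real n - 2))"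
    using n2 n3 by (intro add_pos_nonneg mult_nonneg_nonneg[of "_ + _"] mult_nonneg_nonneg[of "2 * r^6"]) auto
  ultimately show "lamb2 (of_real r) n \<noteq> 0" by (metis less_irrefl of_real_eq_0_iff)
qed

definition lambinv :: "complex \<Rightarrow> nat \<Rightarrow> complex^2^2" where
  "lambinv a n = mat2 (inverse (lamb1 a n)) 0 0 (inverse (lamb2 a n))"

definition Pseq :: "complex \<Rightarrow> nat \<Rightarrow> 2 mat_poly" where
  "Pseq a n = mat_const (lambinv a n) ** act_poly (hermite_mat n) (Vop a)"

lemma symb_Vop_lambinv:
  fixes r :: real
  assumes "r \<noteq> 0" "a = of_real r"
  shows "lambinv a n ** symb (Vop a) n = mat 1" and "symb (Vop a) n ** lambinv a n = mat 1"
  using lamb_nonzero[of r n] assms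
  by (simp_all add: lambinv_def symb_Vop mat2_mult mat_1_mat2 mat2_eq_iff flip: lamb1_def lamb2_def)

lemma Pseq_sub:
  fixes r :: real
  assumes "r \<noteq> 0" "a = of_real r"
  shows "mat_coeff (Pseq a (Suc n)) n = lambinv a (Suc n) ** subsymb (Vop a) (Suc n)"
  using monic_seq_hermite_mat[where 'a = 2] by (simp add: Pseq_def mat_coeff_const_left act_poly_sub[OF deg_noninc_Vop] monic_seq_def hermite_mat_sub)

text \<open>Orthogonality is inherited from the Hermite polynomials: moving \<open>Vop a\<close>
  across the pairing turns Q into Q acted on by \<open>Nop a\<close>, still of degree below
  n.\<close>

lemma gauss_orth_Pseq:
  fixes r :: real
  assumes r: "r \<noteq> 0" "a = of_real r"
  shows "gauss_orth (Mmat a) (Tmat a) (Tinv a) (Pseq a)"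
proof
  have a: "cnj a = a" "a \<noteq> 0" using r by auto
  show M: "Mmat a = Tmat a ** adj_poly (Tmat a)" by (rule Mmat_eq[OF a(1)])
  show "Tmat a ** Tinv a = mat 1" by (rule Tmat_Tinv)
  have h: "mdeg_lt (Suc n) (hermite_mat n :: 2 mat_poly)" "mat_coeff (hermite_mat n :: 2 mat_poly) n = mat 1" for n
    using monic_seq_hermite_mat[where 'a = 2] by (auto simp: monic_seq_def)
  show "monic_seq (Pseq a)"
    unfolding monic_seq_def Pseq_def
    using act_poly_mdeg_lt[OF deg_noninc_Vop h(1)]
    by (auto simp: mdeg_lt_const_left mat_coeff_const_left act_poly_top[OF deg_noninc_Vop h(1)] h symb_Vop_lambinv[OF r])
  fix n Q assume "mdeg_lt n (Q :: 2 mat_poly)"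
  then have "ip (mat 1) (hermite_mat n) (act_poly Q (Nop a)) = 0"
    by (intro hermite.orth act_poly_mdeg_lt[OF deg_noninc_Nop])
  moreover have "adj_poly (Mmat a) = Mmat a"
    unfolding M by (simp add: adj_poly_mult)
  ultimately show "ip (Mmat a) (Pseq a n) Q = 0"
    by (simp add: Pseq_def ip_const_left ip_gadjoint[OF gadjoint_Vop_Nop[OF a] adj_poly_1])
qed

section \<open>Weight matrices\<close>

lemma pos_def_scaleR:
  assumes "pos_def A" "0 < r"
  shows "pos_def (r *\<^sub>R A)"
proof -
  have "(\<Sum>i\<in>UNIV. \<Sum>j\<in>UNIV. cnj (v $ i) * (r *\<^sub>R A) $ i $ j * v $ j)
      = r *\<^sub>R (\<Sum>i\<in>UNIV. \<Sum>j\<in>UNIV. cnj (v $ i) * A $ i $ j * v $ j)" for v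
    by (simp add: scaleR_sum_right)
  moreover have "adj_mat (r *\<^sub>R A) = r *\<^sub>R adj_mat A"
    by (simp add: vec_eq_iff)
  ultimately show ?thesis using assms by (simp add: pos_def_def)
qed

text \<open>The quadratic form is the squared norm of the row vector u = v^* A, which is nonzero
  because A is invertible.\<close>

lemma pos_def_mult_adj_mat:
  fixes A A' :: "complex^'n::finite^'n"
  assumes "A ** A' = mat 1"
  shows "pos_def (A ** adj_mat A)"
  unfolding pos_def_def
proof (intro conjI allI impI)
  show "adj_mat (A ** adj_mat A) = A ** adj_mat A"
    by (simp add: vec_eq_iff mat_mult_nth mult.commute)
  fix v :: "complex^'n" assume v: "v \<noteq> 0"
  define u where "u k = (\<Sum>i\<in>UNIV. cnj (v $ i) * A $ i $ k)" for k
  have "(\<Sum>i\<in>UNIV. \<Sum>j\<in>UNIV. cnj (v $ i) * (A ** adj_mat A) $ i $ j * v $ j)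
      = (\<Sum>i\<in>UNIV. \<Sum>j\<in>UNIV. \<Sum>k\<in>UNIV. (cnj (v $ i) * A $ i $ k) * (v $ j * cnj (A $ j $ k)))"
    by (simp add: mat_mult_nth sum_distrib_left sum_distrib_right mult_ac)
  also have "\<dots> = (\<Sum>i\<in>UNIV. \<Sum>k\<in>UNIV. \<Sum>j\<in>UNIV. (cnj (v $ i) * A $ i $ k) * (v $ j * cnj (A $ j $ k)))"
    by (intro sum.cong refl sum.swap)
  also have "\<dots> = (\<Sum>k\<in>UNIV. \<Sum>i\<in>UNIV. \<Sum>j\<in>UNIV. (cnj (v $ i) * A $ i $ k) * (v $ j * cnj (A $ j $ k)))"
    by (rule sum.swap)
  also have "\<dots> = (\<Sum>k\<in>UNIV. u k * cnj (u k))"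
    by (simp only: u_def cnj_sum complex_cnj_mult complex_cnj_cnj sum_product)
  also have "\<dots> = of_real (\<Sum>k\<in>UNIV. (cmod (u k))\<^sup>2)"
    by (simp add: complex_norm_square[unfolded of_real_power])
  finally have eq: "Re (\<Sum>i\<in>UNIV. \<Sum>j\<in>UNIV. cnj (v $ i) * (A ** adj_mat A) $ i $ j * v $ j) = (\<Sum>k\<in>UNIV. (cmod (u k))\<^sup>2)"
    by simp
  have "\<exists>k. u k \<noteq> 0"
  proof (rule ccontr)
    assume "\<not> (\<exists>k. u k \<noteq> 0)"
    \<comment> \<open>Multiplying u = 0 by A' on the right gives back the conjugate of v.\<close>
    then have "0 = (\<Sum>k\<in>UNIV. u k * A' $ k $ j)" for j by simp
    also have "\<dots> j = (\<Sum>i\<in>UNIV. cnj (v $ i) * (A ** A') $ i $ j)" for j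
      unfolding u_def mat_mult_nth sum_distrib_left sum_distrib_right
      by (subst sum.swap) (simp add: mult_ac)
    also have "\<dots> j = cnj (v $ j)" for j
      by (simp add: assms mat_def if_distrib if_distribR cong: if_cong)
    finally have "v = 0" by (metis (no_types, lifting) complex_cnj_zero_iff vec_eq_iff zero_index)
    then show False using v by simp
  qed
  then show "0 < Re (\<Sum>i\<in>UNIV. \<Sum>j\<in>UNIV. cnj (v $ i) * (A ** adj_mat A) $ i $ j * v $ j)"
    unfolding eq by (auto intro!: sum_pos2)
qed

lemma weight_matrix_gweight:
  assumes "M = T ** adj_poly T" "T ** T' = mat 1"
  shows "weight_matrix UNIV (gweight M)"
  unfolding weight_matrix_def
proof (intro conjI ballI allI)
  show "smooth_matrix_on UNIV (gweight M)"
    using smooth_gauss[of M] unfolding gweight_def[abs_def] .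
  show "pos_def (gweight M x)" for x
  proof -
    have "mat_eval T x ** mat_eval T' x = mat 1"
      by (simp add: assms(2) flip: mat_eval_mult)
    then show ?thesis
      unfolding gweight_def assms(1) mat_eval_mult mat_eval_adj_poly
      by (intro pos_def_scaleR pos_def_mult_adj_mat) auto
  qed
  show "set_integrable lborel UNIV (\<lambda>x. x ^ k *\<^sub>R gweight M x)" for k
  proof -
    \<comment> \<open>The power x^k is absorbed into the polynomial matrix, so every moment is a
      Gaussian integral of a polynomial.\<close>
    have "x ^ k *\<^sub>R gweight M x = exp (- x\<^sup>2) *\<^sub>R mat_eval (smat (monom 1 k) M) x" for x
      by (simp add: gweight_def vec_eq_iff poly_monom scaleR_conv_of_real[where 'a = complex])
    then show ?thesis
      using integrable_gauss_mat by (simp add: set_integrable_def)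
  qed
qed

section \<open>The Darboux transformation\<close>

text \<open>The leading coefficient is multiplied on the right by the invertible
  \<open>symb (Vop a) n\<close>, so it stays nonzero even when it is a singular matrix.\<close>

lemma degree_preserving_Vop:
  fixes r :: real
  assumes r: "r \<noteq> 0" "a = of_real r"
  shows "degree_preserving (Vop a)"
  unfolding degree_preserving_def
proof (intro allI impI)
  fix P :: "2 mat_poly" assume "P \<noteq> 0"
  define n where "n = mat_degree P"
  have P: "mdeg_lt (Suc n) P" "mat_coeff P n \<noteq> 0"
    using mdeg_lt_Suc_mat_degree[of P] mat_coeff_mat_degree_nonzero[OF \<open>P \<noteq> 0\<close>] by (auto simp: n_def)
  have "mat_coeff (act_poly P (Vop a)) n \<noteq> 0"
  proof
    assume "mat_coeff (act_poly P (Vop a)) n = 0"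
    then have "mat_coeff P n ** (symb (Vop a) n ** lambinv a n) = 0"
      by (simp add: act_poly_top[OF deg_noninc_Vop P(1)] matrix_mul_assoc)
    then show False using P(2) by (simp add: symb_Vop_lambinv[OF r])
  qed
  moreover have "mdeg_lt (Suc n) (act_poly P (Vop a))"
    by (rule act_poly_mdeg_lt[OF deg_noninc_Vop P(1)])
  ultimately show "act_poly P (Vop a) \<noteq> 0 \<and> mat_degree (act_poly P (Vop a)) = mat_degree P"
    using mat_degree_eqI unfolding n_def[symmetric] by auto
qed

lemma strong_darboux_Mmat:
  fixes r :: real
  assumes r: "r \<noteq> 0" "a = of_real r"
  shows "strong_darboux UNIV (gweight (mat 1)) (gweight (Mmat a))"
proof -
  have a: "cnj a = a" "a \<noteq> 0" using r by auto
  have M: "adj_poly (Mmat a) = Mmat a"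
    by (simp add: Mmat_eq[OF a(1)] adj_poly_mult)
  define D where "D = op_comp (Vop a) (Nop a)"
  note adj = ip_gadjoint[OF gadjoint_Vop_Nop[OF a] adj_poly_1 M]
  have act: "act_darboux_adjoint (gweight (mat 1)) (gweight (Mmat a)) (Vop a) f x = act_fun f (Nop a) x"
    if "smooth_matrix_on UNIV f" for f x
    by (rule act_darboux_adjoint_gadjoint[OF gadjoint_Vop_Nop[OF a] that])
  have N: "act_darboux_adjoint (gweight (mat 1)) (gweight (Mmat a)) (Vop a) (mat_eval Q) = mat_eval (act_poly Q (Nop a))" for Q
    by (simp add: fun_eq_iff act[OF smooth_mat_eval] act_fun_mat_eval)
  \<comment> \<open>Both sides equal the pairing with weight M of A and B, each acted on by
    \<open>Vop a\<close>.\<close>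
  have selfadj: "ip (mat 1) (act_poly A D) B = ip (mat 1) A (act_poly B D)" for A B
  proof -
    have "ip (mat 1) (act_poly A D) B = adj_mat (ip (mat 1) B (act_poly (act_poly A (Vop a)) (Nop a)))"
      by (simp add: D_def act_poly_op_comp ip_herm)
    also have "\<dots> = ip (Mmat a) (act_poly A (Vop a)) (act_poly B (Vop a))"
      by (simp add: ip_herm[OF M] flip: adj)
    finally show ?thesis by (simp add: adj D_def act_poly_op_comp)
  qed
  have D: "deg_noninc D"
    unfolding D_def by (rule deg_nonincI)
      (auto simp: act_poly_op_comp intro: act_poly_mdeg_lt deg_noninc_Vop deg_noninc_Nop)
  have DW: "D \<in> bochner_algebra UNIV (gweight (mat 1))"
    by (rule hermite.bochner_algebraI[OF D D selfadj])
  have "lead_coeff (Vop a) = mat2 [:- (a^4):] [:0, a^5:] [:0, a^5:] [:- (a^4), 0, - (a^6):]"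
    unfolding degree_Vop[OF a(2)] by (rule coeff_Vop_4)
  \<comment> \<open>The x^2 terms a^10 x^2 from the diagonal and the antidiagonal cancel.\<close>
  then have "det (lead_coeff (Vop a)) = [:a^8:]"
    by (simp add: det_2 eval_nat_numeral)
  then have det: "det (lead_coeff (Vop a)) \<noteq> 0" using a by simp
  show ?thesis
    unfolding strong_darboux_def
  proof (intro conjI exI[of _ "Vop a"] bexI[OF _ DW] allI impI ballI)
    show "open_interval (UNIV :: real set)" by (simp add: open_interval_def is_interval_univ)
    show "weight_matrix UNIV (gweight (mat 1))"
      by (rule weight_matrix_gweight[of _ "mat 1" "mat 1"]) simp_all
    show "weight_matrix UNIV (gweight (Mmat a))"
      by (rule weight_matrix_gweight[OF Mmat_eq[OF a(1)] Tmat_Tinv])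
    show "degree_preserving (Vop a)" by (rule degree_preserving_Vop[OF r])
    show "det (lead_coeff (Vop a)) \<noteq> 0" by (rule det)
    \<comment> \<open>The adjoint is applied to f acted on by \<open>Vop a\<close>, so it is the
      smoothness of that function which is needed here.\<close>
    show "act_fun f D x = act_darboux_adjoint (gweight (mat 1)) (gweight (Mmat a)) (Vop a) (act_fun f (Vop a)) x"
      if "smooth_matrix_on UNIV f" for f x
      unfolding act[OF smooth_act_fun[OF that]] D_def by (rule act_fun_op_comp[OF that, symmetric])
    show "set_integrable lborel UNIV (\<lambda>x. mat_eval P x ** gweight (mat 1) x **
        adj_mat (act_darboux_adjoint (gweight (mat 1)) (gweight (Mmat a)) (Vop a) (mat_eval Q) x))" for P Q
      unfolding N gweight_eval using integrable_gauss_mat by (simp add: set_integrable_def)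
    show "mat_inner UNIV (gweight (Mmat a)) (mat_eval (act_poly P (Vop a))) (mat_eval Q)
        = mat_inner UNIV (gweight (mat 1)) (mat_eval P) (act_darboux_adjoint (gweight (mat 1)) (gweight (Mmat a)) (Vop a) (mat_eval Q))" for P Q
      unfolding N mat_inner_gweight by (rule adj)
  qed
qed

lemma Dop_bochner:
  fixes r :: real
  assumes r: "r \<noteq> 0" "a = of_real r"
  shows "Dop a \<in> bochner_algebra UNIV (gweight (Mmat a))"
proof -
  have a: "cnj a = a" "a \<noteq> 0" using r by auto
  interpret gauss_orth "Mmat a" "Tmat a" "Tinv a" "Pseq a"
    by (rule gauss_orth_Pseq[OF r])
  show ?thesis
    by (rule bochner_algebraI[OF deg_noninc_Dop deg_noninc_Dop])
      (rule ip_gadjoint[OF gadjoint_Dop[OF a] M_herm M_herm])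
qed

section \<open>Operators of order less than four\<close>

text \<open>\<open>ffac n i\<close> as a polynomial in n. Its degree i is what converts the order of
  an operator into a degree bound in n.\<close>

definition falling_poly :: "nat \<Rightarrow> complex poly" where
  "falling_poly i = (\<Prod>t<i. [:- of_nat t, 1:])"

lemma poly_falling_poly: "poly (falling_poly i) (of_nat n) = ffac n i"
  by (simp add: falling_poly_def ffac_def poly_prod)

lemma degree_falling_poly: "degree (falling_poly i) = i"
  by (simp add: falling_poly_def degree_prod_eq_sum_degree)

lemma degree_sum_smult_falling_poly:
  assumes "\<And>i. i \<in> I \<Longrightarrow> i \<le> d"
  shows "degree (\<Sum>i\<in>I. smult (c i) (falling_poly i)) \<le> d"
proof (cases "finite I")
  case True
  then show ?thesis
    using assms by (intro degree_sum_le order_trans[OF degree_smult_le]) (auto simp: degree_falling_poly)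
qed simp

lemma symb_poly:
  obtains p where "degree p \<le> degree D" "\<And>n. symb D n $ i $ j = poly p (of_nat n)"
proof
  show "degree (\<Sum>l\<le>degree D. smult (mat_coeff (coeff D l) l $ i $ j) (falling_poly l)) \<le> degree D"
    by (rule degree_sum_smult_falling_poly) simp
qed (simp add: symb_def poly_sum poly_falling_poly mult.commute)

lemma subsymb_poly:
  obtains p where "degree p \<le> degree D" "\<And>n. subsymb D n $ i $ j = poly p (of_nat n)"
proof
  show "degree (\<Sum>l\<in>{1..degree D}. smult (mat_coeff (coeff D l) (l - 1) $ i $ j) (falling_poly l)) \<le> degree D"
    by (rule degree_sum_smult_falling_poly) simp
qed (simp add: subsymb_def poly_sum poly_falling_poly mult.commute)

text \<open>Positive integers are the points at hand: the equations below involve the coefficient of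
  x^n in the polynomial of index n + 1.\<close>

lemma poly_eqI_nat:
  fixes f g :: "complex poly"
  assumes "\<And>n. poly f (of_nat (Suc n)) = poly g (of_nat (Suc n))"
  shows "f = g"
proof (rule ccontr)
  assume "f \<noteq> g"
  then have "finite {z. poly (f - g) z = 0}"
    by (intro poly_roots_finite) simp
  moreover have "range (\<lambda>n. of_nat (Suc n)) \<subseteq> {z. poly (f - g) z = 0}"
    using assms by auto
  ultimately have "finite (range (\<lambda>n. of_nat (Suc n) :: complex))"
    by (rule finite_subset[rotated])
  moreover have "inj (\<lambda>n. of_nat (Suc n) :: complex)"
    by (rule injI) (metis of_nat_eq_iff Suc_inject)
  ultimately show False
    by (simp add: finite_image_iff)
qed

lemma cubic_poly:
  assumes "degree p \<le> 3"
  shows "p = [:coeff p 0, coeff p 1, coeff p 2, coeff p 3:]"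
proof (rule poly_eqI)
  fix k :: nat
  consider "k = 0" | "k = 1" | "k = 2" | "k = 3" | "3 < k" by linarith
  then show "coeff p k = coeff [:coeff p 0, coeff p 1, coeff p 2, coeff p 3:] k"
  proof cases
    case 5
    then have "coeff p k = 0" using assms by (intro coeff_eq_0) simp
    then show ?thesis using 5 by (auto simp: coeff_pCons split: nat.split)
  qed (simp_all add: coeff_num numeral_eq_Suc)
qed

lemma degree_eq_0_obtain:
  fixes f g :: "complex poly"
  assumes "degree (f * g) \<le> degree f" "f \<noteq> 0"
  obtains c where "g = [:c:]"
proof (cases "g = 0")
  case True
  then show ?thesis using that[of 0] by simp
next
  case False
  then have "degree g = 0" using assms by (simp add: degree_mult_eq)
  then show ?thesis using that by (meson degree_eq_zeroE)
qed

section \<open>Numerator and denominators of the subleading coefficient, as polynomials in n\<close>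

definition shift :: "complex poly \<Rightarrow> complex poly" where
  "shift p = pcompose p [:- 1, 1:]"

lemma poly_shift: "poly (shift p) (of_nat (Suc n)) = poly p (of_nat n)"
  by (simp add: shift_def poly_pcompose)

text \<open>\<open>bpoly\<close> and \<open>cpoly\<close> are \<open>lamb1\<close> and
  \<open>lamb2\<close> as polynomials in n, and \<open>spoly\<close> is the antidiagonal entry of
  \<open>subsymb (Vop a)\<close>. The subleading coefficient of P_n thus has antidiagonal entries
  \<open>spoly\<close>/\<open>bpoly\<close> and \<open>spoly\<close>/\<open>cpoly\<close>.\<close>

definition bpoly :: "complex \<Rightarrow> complex poly" where
  "bpoly a = [:16, 8 * a^2:]"

definition spoly :: "complex \<Rightarrow> complex poly" where
  "spoly a = - [:0, 16 * a - 2 * a^5, 12 * a^3, 2 * a^5:]"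

definition cpoly :: "complex \<Rightarrow> complex poly" where
  "cpoly a = [:16, 24 * a^2 - 2 * a^6, 12 * a^4, 2 * a^6:]"

lemma lamb1_poly: "lamb1 a n = poly (bpoly a) (of_nat n)"
  by (simp add: lamb1_def bpoly_def)

lemma lamb2_poly: "lamb2 a n = poly (cpoly a) (of_nat n)"
  by (simp add: lamb2_def cpoly_def algebra_simps)

lemma subsymb_Vop_poly:
  assumes "a \<noteq> 0"
  shows "subsymb (Vop a) n = mat2 0 (poly (spoly a) (of_nat n)) (poly (spoly a) (of_nat n)) 0"
  by (simp add: subsymb_Vop[OF assms] spoly_def mat2_eq_iff algebra_simps)

text \<open>An explicit Bezout identity with a nonzero constant certifies coprimality, uniformly in
  the parameter a.\<close>

lemma bezout_dvd_cancel:
  fixes f g :: "complex poly"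
  assumes "f * u + g * v = [:e:]" "e \<noteq> 0" "f dvd g * x"
  shows "f dvd x"
proof -
  have "smult e x = (f * u + g * v) * x"
    by (simp add: assms(1))
  also have "\<dots> = f * (u * x) + (g * x) * v"
    by (simp add: algebra_simps)
  finally have "f dvd smult e x"
    using assms(3) by simp
  then show ?thesis using assms(2) by (simp add: dvd_smult_iff)
qed

lemma cpoly_eq: "cpoly a = bpoly a - smult a (spoly a)"
  by (simp add: cpoly_def bpoly_def spoly_def eval_nat_numeral algebra_simps)

text \<open>At the root -2/a^2 of \<open>bpoly\<close> (for a nonzero) the value of
  \<open>spoly\<close> is -4 a^3; the quadratic factor is the quotient of \<open>spoly\<close> + 4
  a^3 by \<open>bpoly\<close>.\<close>

lemma bpoly_spoly_bezout: "bpoly a * [:a^3 / 4, - a, - (a^3) / 4:] - spoly a = [:4 * a^3:]"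
  by (simp add: bpoly_def spoly_def eval_nat_numeral algebra_simps)

text \<open>Since \<open>cpoly\<close> = \<open>bpoly\<close> - a \<open>spoly\<close>, the one
  identity \<open>bpoly_spoly_bezout\<close> yields coprimality of all three pairs.\<close>

lemma
  assumes a: "a \<noteq> 0"
  shows bpoly_dvd_spoly_mult: "bpoly a dvd spoly a * x \<Longrightarrow> bpoly a dvd x"
    and cpoly_dvd_spoly_mult: "cpoly a dvd spoly a * x \<Longrightarrow> cpoly a dvd x"
    and cpoly_dvd_bpoly_mult: "cpoly a dvd bpoly a * x \<Longrightarrow> cpoly a dvd x"
    and bpoly_dvd_cpoly_mult: "bpoly a dvd cpoly a * x \<Longrightarrow> bpoly a dvd x"
proof -
  define B where "B = [:a^3 / 4, - a, - (a^3) / 4:]"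
  have nz: "4 * a^3 \<noteq> 0" using a by simp
  have bs: "bpoly a * B + spoly a * (- 1) = [:4 * a^3:]"
    using bpoly_spoly_bezout[of a] by (simp add: B_def)
  have cs: "cpoly a * B + spoly a * (smult a B - 1) = [:4 * a^3:]"
    using bs by (simp add: cpoly_eq algebra_simps)
  have s: "spoly a = smult (1 / a) (bpoly a - cpoly a)"
    using a by (simp add: cpoly_eq)
  have cb: "cpoly a * [:1 / a:] + bpoly a * (B - [:1 / a:]) = [:4 * a^3:]"
    using bs unfolding s by (simp add: algebra_simps smult_diff_right)
  show "bpoly a dvd spoly a * x \<Longrightarrow> bpoly a dvd x"
    by (rule bezout_dvd_cancel[OF bs nz])
  show "cpoly a dvd spoly a * x \<Longrightarrow> cpoly a dvd x"
    by (rule bezout_dvd_cancel[OF cs nz])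
  show "cpoly a dvd bpoly a * x \<Longrightarrow> cpoly a dvd x"
    by (rule bezout_dvd_cancel[OF cb nz])
  show "bpoly a dvd cpoly a * x \<Longrightarrow> bpoly a dvd x"
    by (rule bezout_dvd_cancel[OF trans[OF add.commute cb] nz])
qed

lemma degree_spoly: "a \<noteq> 0 \<Longrightarrow> degree (spoly a) = 3"
  and degree_cpoly: "a \<noteq> 0 \<Longrightarrow> degree (cpoly a) = 3"
  and degree_bpoly: "a \<noteq> 0 \<Longrightarrow> degree (bpoly a) = 1"
  by (simp_all add: spoly_def cpoly_def bpoly_def)

text \<open>Here p and t are the diagonal entries of Lambda_n. Cancelling \<open>spoly\<close> makes
  p(n) - t(n-1) and t(n) - p(n-1) constant multiples of \<open>bpoly\<close> and
  \<open>cpoly\<close>, and the second constant turns out to be 0. The surviving solutions are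
  multiples of the eigenvalues of \<open>Dop\<close>, plus a constant.\<close>

lemma diagonal_recurrence:
  assumes a: "a \<noteq> 0"
    and deg: "degree p \<le> 3" "degree t \<le> 3" "degree R12 \<le> 3" "degree R21 \<le> 3"
    and eq12: "bpoly a * R12 = spoly a * (p - shift t)"
    and eq21: "cpoly a * R21 = spoly a * (t - shift p)"
  obtains k p0 where "p = smult k [:0, 16 + 8 * a^2, 4 * a^2:] + [:p0:]" "t = shift p"
proof -
  have nz: "bpoly a \<noteq> 0" "cpoly a \<noteq> 0" "spoly a \<noteq> 0"
    using degree_bpoly[OF a] degree_cpoly[OF a] degree_spoly[OF a] by auto
  have "bpoly a dvd spoly a * (p - shift t)" by (metis eq12 dvd_triv_left)
  then have "bpoly a dvd p - shift t"
    by (rule bpoly_dvd_spoly_mult[OF a])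
  then obtain Y where Y: "p - shift t = bpoly a * Y" by (elim dvdE)
  then have "R12 = spoly a * Y"
    using eq12 nz by (simp add: mult.left_commute)
  \<comment> \<open>The order bound enters here: \<open>R12\<close> has degree at most 3, and
    \<open>spoly\<close> already has degree 3.\<close>
  then obtain y where y: "Y = [:y:]"
    using degree_eq_0_obtain[of "spoly a" Y] deg nz by (metis degree_spoly[OF a])
  have "cpoly a dvd spoly a * (t - shift p)" by (metis eq21 dvd_triv_left)
  then have "cpoly a dvd t - shift p"
    by (rule cpoly_dvd_spoly_mult[OF a])
  then obtain X where X: "t - shift p = cpoly a * X" by (elim dvdE)
  then have "R21 = spoly a * X"
    using eq21 nz by (simp add: mult.left_commute)
  then obtain x where x: "X = [:x:]"
    using degree_eq_0_obtain[of "spoly a" X] deg nz by (metis degree_spoly[OF a])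
  obtain p0 p1 p2 p3 where p: "p = [:p0, p1, p2, p3:]" using cubic_poly[OF deg(1)] by blast
  obtain t0 t1 t2 t3 where t: "t = [:t0, t1, t2, t3:]" using cubic_poly[OF deg(2)] by blast
  \<comment> \<open>\<open>bpoly\<close> times a constant has no cubic term, while that of
    \<open>cpoly\<close> is 2 a^6; the two cubic comparisons force x = 0.\<close>
  have "p3 - t3 = 0"
    using arg_cong[OF Y, of "\<lambda>f. coeff f 3"] unfolding p t y bpoly_def shift_def
    by (simp add: pcompose_pCons coeff_num del: One_nat_def)
  moreover have "t3 - p3 = 2 * a^6 * x"
    using arg_cong[OF X, of "\<lambda>f. coeff f 3"] unfolding p t x cpoly_def shift_def
    by (simp add: pcompose_pCons coeff_num del: One_nat_def)
  ultimately have "x = 0" using a by (simp add: algebra_simps)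
  then have tp: "t = shift p" using X x by simp
  \<comment> \<open>Eliminating t leaves the difference p(n) - p(n-2), whose coefficients determine
    p up to its constant term.\<close>
  have "p - shift (shift p) = bpoly a * [:y:]" using Y y tp by simp
  then have "6 * p3 = 0" "4 * p2 - 12 * p3 = 8 * a^2 * y" "2 * p1 - 4 * p2 + 8 * p3 = 16 * y"
    unfolding p bpoly_def shift_def
    by (auto simp: pcompose_pCons algebra_simps)
  then have p3: "p3 = 0" and "4 * p2 = 4 * (2 * a^2 * y)" and *: "2 * p1 - 4 * p2 = 16 * y"
    by simp_all
  then have p2: "p2 = 2 * a^2 * y" by simp
  have "2 * p1 = 2 * (8 * y + 4 * a^2 * y)"
    using * unfolding p2 by (simp add: algebra_simps)
  then have p1: "p1 = 8 * y + 4 * a^2 * y"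
    by (metis mult_cancel_left zero_neq_numeral)
  then have "p = smult (y / 2) [:0, 16 + 8 * a^2, 4 * a^2:] + [:p0:]"
    by (simp add: p p1 p2 p3 field_simps)
  then show ?thesis using tp that by blast
qed

text \<open>Here q and r are the off-diagonal entries of Lambda_n. The first equation makes q a
  constant multiple of \<open>cpoly\<close> and the shift of r one of \<open>bpoly\<close>. The
  second then demands divisibility with the roles of shifted and unshifted exchanged, which no
  nonzero constants permit.\<close>

lemma off_diagonal_vanishes:
  assumes a: "a \<noteq> 0"
    and deg: "degree q \<le> 3" "degree R11 \<le> 3"
    and eq11: "bpoly a * cpoly a * R11 + cpoly a * spoly a * shift r = bpoly a * spoly a * q"
    and eq22: "bpoly a * cpoly a * R22 + bpoly a * spoly a * shift q = cpoly a * spoly a * r"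
  shows "q = 0" and "r = 0"
proof -
  have nz: "bpoly a \<noteq> 0" "cpoly a \<noteq> 0" "spoly a \<noteq> 0"
    using degree_bpoly[OF a] degree_cpoly[OF a] degree_spoly[OF a] by auto
  note cancel = bpoly_dvd_spoly_mult[OF a] cpoly_dvd_spoly_mult[OF a] cpoly_dvd_bpoly_mult[OF a] bpoly_dvd_cpoly_mult[OF a]
  have "cpoly a dvd bpoly a * spoly a * q"
    unfolding eq11[symmetric] by (simp add: mult.assoc)
  then have "cpoly a dvd q"
    unfolding mult.assoc by (rule cancel(2)[OF cancel(3)])
  then obtain Z where Z: "q = cpoly a * Z" by (elim dvdE)
  then obtain z where z: "Z = [:z:]"
    using degree_eq_0_obtain[of "cpoly a" Z] deg nz by (metis degree_cpoly[OF a])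
  have "cpoly a * (bpoly a * R11 + spoly a * shift r) = cpoly a * (bpoly a * spoly a * Z)"
    using eq11 Z by (simp add: algebra_simps)
  then have eq: "bpoly a * R11 + spoly a * shift r = bpoly a * spoly a * Z"
    using nz by (metis mult_cancel_left)
  then have "spoly a * shift r = bpoly a * (spoly a * Z - R11)"
    by (simp add: algebra_simps)
  then have "bpoly a dvd spoly a * shift r" by simp
  then have "bpoly a dvd shift r"
    by (rule cancel(1))
  then obtain V where V: "shift r = bpoly a * V" by (elim dvdE)
  have "bpoly a * R11 = bpoly a * (spoly a * (Z - V))"
    using eq V by (simp add: algebra_simps)
  then have "R11 = spoly a * (Z - V)" using nz by (metis mult_cancel_left)
  then obtain v' where v': "Z - V = [:v':]"
    using degree_eq_0_obtain[of "spoly a" "Z - V"] deg nz by (metis degree_spoly[OF a])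
  have "V = Z - (Z - V)" by simp
  also have "\<dots> = [:z - v':]" unfolding v' unfolding z by simp
  finally have v: "V = [:z - v':]" .
  \<comment> \<open>Undoing the shift makes r a multiple of b(n+1), with b = \<open>bpoly a\<close>;
    its remainder modulo b is the constant 8 a^2 (z - v').\<close>
  have "r = pcompose (shift r) [:1, 1:]"
    by (simp add: shift_def pcompose_assoc[symmetric] pcompose_pCons)
  also have "\<dots> = smult (z - v') (bpoly a) + [:8 * a^2 * (z - v'):]"
    unfolding V v by (simp add: bpoly_def pcompose_pCons algebra_simps)
  finally have r: "r = smult (z - v') (bpoly a) + [:8 * a^2 * (z - v'):]" .
  have "bpoly a dvd cpoly a * spoly a * r"
    unfolding eq22[symmetric] by (simp add: mult.assoc)
  then have "bpoly a dvd r"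
    unfolding mult.assoc by (rule cancel(1)[OF cancel(4)])
  then have "bpoly a dvd [:8 * a^2 * (z - v'):]"
    unfolding r by (simp add: dvd_add_right_iff dvd_smult)
  then have "8 * a^2 * (z - v') = 0"
    using dvd_imp_degree_le[of "bpoly a" "[:8 * a^2 * (z - v'):]"] degree_bpoly[OF a] by fastforce
  then have "z - v' = 0" using a by simp
  then show r0: "r = 0" using r by simp
  have "bpoly a * (cpoly a * R22 + spoly a * shift q) = 0"
    using eq22 r0 by (simp add: algebra_simps)
  then have "cpoly a * R22 + spoly a * shift q = 0" using nz by simp
  then have "cpoly a dvd spoly a * shift q"
    by (metis add_eq_0_iff2 dvd_minus_iff dvd_triv_left)
  then have "cpoly a dvd shift q"
    by (rule cancel(2))
  moreover have "shift q = smult z (shift (cpoly a))"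
    by (simp add: Z z shift_def pcompose_smult)
  \<comment> \<open>The difference of \<open>cpoly\<close> and its shift is of degree 2 with leading
    coefficient -6 a^6 before scaling by z, too small to be a nonzero multiple of
    \<open>cpoly\<close>.\<close>
  ultimately have "cpoly a dvd smult z (shift (cpoly a)) - smult z (cpoly a)"
    by (simp add: dvd_diff dvd_smult)
  also have "smult z (shift (cpoly a)) - smult z (cpoly a)
      = smult z [:- 24 * a^2 + 12 * a^4, - 24 * a^4 + 6 * a^6, - 6 * a^6:]"
    by (simp add: shift_def cpoly_def pcompose_pCons algebra_simps)
  finally have "cpoly a dvd smult z [:- 24 * a^2 + 12 * a^4, - 24 * a^4 + 6 * a^6, - 6 * a^6:]" .
  moreover have "degree (smult z [:- 24 * a^2 + 12 * a^4, - 24 * a^4 + 6 * a^6, - 6 * a^6:]) < degree (cpoly a)"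
    unfolding degree_cpoly[OF a] by (rule le_less_trans[OF degree_smult_le]) simp
  ultimately have "smult z [:- 24 * a^2 + 12 * a^4, - 24 * a^4 + 6 * a^6, - 6 * a^6:] = 0"
    using dvd_imp_degree_le leD by blast
  then have "z = 0" using a by simp
  then show "q = 0" using Z z by simp
qed

lemma bochner_order_lt_4:
  fixes r :: real
  assumes r: "r \<noteq> 0" "a = of_real r"
    and D: "D \<in> bochner_algebra UNIV (gweight (Mmat a))" "degree D < 4"
  shows "degree D = 0"
proof -
  have a: "cnj a = a" "a \<noteq> 0" using r by auto
  interpret gauss_orth "Mmat a" "Tmat a" "Tinv a" "Pseq a"
    by (rule gauss_orth_Pseq[OF r])
  note dD = bochner_algebraD[OF D(1)]
  note dD4 = bochner_algebraD[OF Dop_bochner[OF r]]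
  have P: "mdeg_lt (Suc n) (Pseq a n)" "mat_coeff (Pseq a n) n = mat 1" for n
    using monic by (auto simp: monic_seq_def)
  obtain p where p: "degree p \<le> degree D" "\<And>n. symb D n $ 1 $ 1 = poly p (of_nat n)"
    using symb_poly[of D 1 1] by blast
  obtain q where q: "degree q \<le> degree D" "\<And>n. symb D n $ 1 $ 2 = poly q (of_nat n)"
    using symb_poly[of D 1 2] by blast
  obtain u where u: "degree u \<le> degree D" "\<And>n. symb D n $ 2 $ 1 = poly u (of_nat n)"
    using symb_poly[of D 2 1] by blast
  obtain t where t: "degree t \<le> degree D" "\<And>n. symb D n $ 2 $ 2 = poly t (of_nat n)"
    using symb_poly[of D 2 2] by blast
  obtain R11 where R11: "degree R11 \<le> degree D" "\<And>n. subsymb D n $ 1 $ 1 = poly R11 (of_nat n)"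
    using subsymb_poly[of D 1 1] by blast
  obtain R12 where R12: "degree R12 \<le> degree D" "\<And>n. subsymb D n $ 1 $ 2 = poly R12 (of_nat n)"
    using subsymb_poly[of D 1 2] by blast
  obtain R21 where R21: "degree R21 \<le> degree D" "\<And>n. subsymb D n $ 2 $ 1 = poly R21 (of_nat n)"
    using subsymb_poly[of D 2 1] by blast
  obtain R22 where R22: "degree R22 \<le> degree D" "\<And>n. subsymb D n $ 2 $ 2 = poly R22 (of_nat n)"
    using subsymb_poly[of D 2 2] by blast
  have symbD: "symb D n = mat2 (poly p (of_nat n)) (poly q (of_nat n)) (poly u (of_nat n)) (poly t (of_nat n))" for n
    by (rule mat2_eqI) (simp_all add: p q u t)
  have subsymbD: "subsymb D n = mat2 (poly R11 (of_nat n)) (poly R12 (of_nat n)) (poly R21 (of_nat n)) (poly R22 (of_nat n))" for n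
    by (rule mat2_eqI) (simp_all add: R11 R12 R21 R22)
  have eqs:
    "poly (bpoly a * cpoly a * R11 + cpoly a * spoly a * shift u) (of_nat (Suc n)) = poly (bpoly a * spoly a * q) (of_nat (Suc n))"
    "poly (bpoly a * R12) (of_nat (Suc n)) = poly (spoly a * (p - shift t)) (of_nat (Suc n))"
    "poly (cpoly a * R21) (of_nat (Suc n)) = poly (spoly a * (t - shift p)) (of_nat (Suc n))"
    "poly (bpoly a * cpoly a * R22 + bpoly a * spoly a * shift q) (of_nat (Suc n)) = poly (cpoly a * spoly a * u) (of_nat (Suc n))" for n
  proof -
    define m :: complex where "m = of_nat (Suc n)"
    define b c s where "b = poly (bpoly a) m" and "c = poly (cpoly a) m" and "s = poly (spoly a) m"
    have sh: "poly (shift f) m = poly f (of_nat n)" for f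
      unfolding m_def by (rule poly_shift)
    have nz: "b \<noteq> 0" "c \<noteq> 0"
      using lamb_nonzero[of r "Suc n"] unfolding b_def c_def m_def r(2) lamb1_poly lamb2_poly by auto
    define Q where "Q = mat_coeff (Pseq a (Suc n)) n"
    have Q: "Q = mat2 0 (s / b) (s / c) 0"
      unfolding Q_def Pseq_sub[OF r] lambinv_def subsymb_Vop_poly[OF a(2)] lamb1_poly lamb2_poly
      by (simp add: mat2_mult mat2_eq_iff b_def c_def s_def m_def divide_inverse mult.commute)
    \<comment> \<open>The coefficient of x^n in the eigenvalue equation for index n + 1: on the left
      Q meets the eigenvalue of index n, on the right that of index n + 1. This mismatch is the
      origin of \<open>shift\<close>.\<close>
    have "subsymb D (Suc n) + Q ** symb D n = mat_coeff (act_poly (Pseq a (Suc n)) D) n"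
      using act_poly_sub[OF dD(1) P(1)[of "Suc n"]] by (simp add: P(2) Q_def)
    also have "\<dots> = symb D (Suc n) ** Q"
      unfolding dD(2) mat_coeff_const_left Q_def ..
    finally have "mat2 (poly R11 m) (poly R12 m) (poly R21 m) (poly R22 m)
        + mat2 0 (s / b) (s / c) 0 ** mat2 (poly p (of_nat n)) (poly q (of_nat n)) (poly u (of_nat n)) (poly t (of_nat n))
        = mat2 (poly p m) (poly q m) (poly u m) (poly t m) ** mat2 0 (s / b) (s / c) 0"
      unfolding symbD subsymbD Q m_def .
    then have "poly R11 m + s / b * poly u (of_nat n) = poly q m * (s / c)"
      "poly R12 m + s / b * poly t (of_nat n) = poly p m * (s / b)"
      "poly R21 m + s / c * poly p (of_nat n) = poly t m * (s / c)"
      "poly R22 m + s / c * poly q (of_nat n) = poly u m * (s / b)"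
      by (simp_all only: mat2_mult mat2_add mat2_eq_iff mult_zero_left mult_zero_right add_0 add_0_right)
    then show
      "poly (bpoly a * cpoly a * R11 + cpoly a * spoly a * shift u) (of_nat (Suc n)) = poly (bpoly a * spoly a * q) (of_nat (Suc n))"
      "poly (bpoly a * R12) (of_nat (Suc n)) = poly (spoly a * (p - shift t)) (of_nat (Suc n))"
      "poly (cpoly a * R21) (of_nat (Suc n)) = poly (spoly a * (t - shift p)) (of_nat (Suc n))"
      "poly (bpoly a * cpoly a * R22 + bpoly a * spoly a * shift q) (of_nat (Suc n)) = poly (cpoly a * spoly a * u) (of_nat (Suc n))"
      unfolding poly_mult poly_add poly_diff m_def[symmetric] sh b_def[symmetric] c_def[symmetric] s_def[symmetric]
      using nz by (simp_all add: field_simps)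
  qed
  have deg: "degree p \<le> 3" "degree q \<le> 3" "degree t \<le> 3" "degree R11 \<le> 3" "degree R12 \<le> 3" "degree R21 \<le> 3"
    using p(1) q(1) t(1) R11(1) R12(1) R21(1) D(2) by linarith+
  have qu: "q = 0" "u = 0"
    using off_diagonal_vanishes[OF a(2) deg(2,4)] poly_eqI_nat[OF eqs(1)] poly_eqI_nat[OF eqs(4)] by blast+
  obtain k p0 where kp: "p = smult k [:0, 16 + 8 * a^2, 4 * a^2:] + [:p0:]" "t = shift p"
    using diagonal_recurrence[OF a(2) deg(1,3,5,6) poly_eqI_nat[OF eqs(2)] poly_eqI_nat[OF eqs(3)]] .
  \<comment> \<open>The constant \<open>p0\<close> survives the shift unchanged, so both diagonal
    entries carry the same additive constant and it acts as a scalar.\<close>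
  have symb_eq: "mat_const (symb D n) = smat [:k:] (mat_const (symb (Dop a) n)) + smat [:p0:] (mat 1)" for n
    unfolding symbD symb_Dop[OF a(2)] qu kp(2)
    by (rule mat2_eqI) (simp_all add: kp(1) shift_def poly_pcompose mat_def algebra_simps power2_eq_square)
  \<comment> \<open>D - k \<open>Dop a\<close> - p0 kills each P_n because all eigenvalues agree,
    and the P_n span everything.\<close>
  have zero: "act_poly A D - smat [:k:] (act_poly A (Dop a)) - smat [:p0:] A = 0" for A
    using monic mdeg_lt_Suc_mat_degree[of A]
  proof (induction rule: monic_seq_induct)
    case zero
    then show ?case by simp
  next
    case (step A C l)
    have smat_add: "smat d (X + Y) = smat d X + smat d Y" for d and X Y :: "2 mat_poly"
      by (simp add: vec_eq_iff distrib_left)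
    have "act_poly (Pseq a l) D = smat [:k:] (act_poly (Pseq a l) (Dop a)) + smat [:p0:] (Pseq a l)"
      unfolding dD(2) dD4(2) symb_eq by (simp add: matrix_add_rdistrib smat_mult_left)
    then have "act_poly (mat_const C ** Pseq a l) D
        = smat [:k:] (act_poly (mat_const C ** Pseq a l) (Dop a)) + smat [:p0:] (mat_const C ** Pseq a l)"
      by (simp add: act_poly_const_left matrix_add_ldistrib smat_mult_right)
    with step.IH show ?case by (simp add: act_poly_add smat_add algebra_simps)
  qed
  \<comment> \<open>The coefficients of D - k \<open>Dop a\<close> - p0; the scalar contributes at
    order 0 only.\<close>
  define A where "A i = coeff D i - smat [:k:] (coeff (Dop a) i) - (if i = 0 then smat [:p0:] (mat 1) else 0)" for i
  have "(\<Sum>i\<le>4. (mat_pderiv ^^ i) X ** A i) = 0" for X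
  proof -
    have smat_sum: "smat d (sum f I) = (\<Sum>i\<in>I. smat d (f i))" for d and f :: "nat \<Rightarrow> 2 mat_poly" and I
      by (induction I rule: infinite_finite_induct) (auto simp: vec_eq_iff distrib_left)
    have if0: "(mat_pderiv ^^ i) X ** (if i = 0 then smat [:p0:] (mat 1) else 0) = (if i = 0 then smat [:p0:] X else 0)" for i
      by (simp add: smat_mult_right)
    have "(\<Sum>i\<le>4. (mat_pderiv ^^ i) X ** A i) = act_poly X D - smat [:k:] (act_poly X (Dop a)) - smat [:p0:] X"
      unfolding A_def matrix_diff_ldistrib sum_subtractf smat_mult_right if0
        act_poly_upto[OF less_imp_le[OF D(2)]] act_poly_upto[OF eq_refl[OF degree_Dop[OF a(2)]]] smat_sum
      by simp
    then show ?thesis using zero by simp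
  qed
  then have A: "A i = 0" if "i \<le> 4" for i
    using operator_coeffs_eq_0 that by blast
  \<comment> \<open>At order 4 only \<open>Dop a\<close> contributes, with a^2 times the identity,
    so k must vanish and D is the scalar p0.\<close>
  have "coeff D 4 = 0" using D(2) by (simp add: coeff_eq_0)
  then have "smat [:k:] (coeff (Dop a) 4) = 0" using A[of 4] by (simp add: A_def)
  then have "k = 0" using a(2) by (simp add: coeff_Dop_4 smat_mat2 mat2_eq_iff flip: mat2_0)
  have "coeff D i = 0" if "0 < i" for i
  proof (cases "i \<le> 4")
    case True
    then show ?thesis using A[of i] that \<open>k = 0\<close> by (simp add: A_def)
  next
    case False
    then show ?thesis using D(2) by (intro coeff_eq_0) simp
  qed
  then have "degree D \<le> 0" by (intro degree_le) auto
  then show ?thesis by simp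
qed

theorem mainTheorem13:
  fixes a :: real and W W0 :: "real \<Rightarrow> complex^2^2"
  assumes "a \<noteq> 0"
    and "W = (\<lambda>x. exp (- (x\<^sup>2)) *\<^sub>R
      vector [vector [of_real (a^4 * x^4 + 3 * a^2 * x^2 + 1), of_real (a^3 * x^3 + 2 * a * x)],
              vector [of_real (a^3 * x^3 + 2 * a * x), of_real (a^2 * x^2 + 1)]])"
    and "W0 = (\<lambda>x. exp (- (x\<^sup>2)) *\<^sub>R mat 1)"
  shows "strong_darboux UNIV W0 W \<and>
    (\<exists>D \<in> bochner_algebra UNIV W. degree D = 4) \<and>
    \<not> (\<exists>D \<in> bochner_algebra UNIV W. 0 < degree D \<and> degree D < 4) \<and>
    \<not> solves_bochner_problem UNIV W"
proof -
  have W: "W = gweight (Mmat (of_real a))"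
  proof
    fix x
    have "mat_eval (Mmat (of_real a)) x = mat2 (of_real (a^4 * x^4 + 3 * a^2 * x^2 + 1)) (of_real (a^3 * x^3 + 2 * a * x))
        (of_real (a^3 * x^3 + 2 * a * x)) (of_real (a^2 * x^2 + 1))"
      by (rule mat2_eqI) (simp_all add: Mmat_def eval_nat_numeral algebra_simps)
    then show "W x = gweight (Mmat (of_real a)) x"
      by (simp add: assms(2) gweight_def mat2_def)
  qed
  have W0: "W0 = gweight (mat 1)"
    by (simp add: fun_eq_iff assms(3) gweight_def)
  have "strong_darboux UNIV W0 W"
    unfolding W W0 by (rule strong_darboux_Mmat[OF assms(1) refl])
  moreover have "\<exists>D \<in> bochner_algebra UNIV W. degree D = 4"
    unfolding W using Dop_bochner[OF assms(1) refl] degree_Dop[of "of_real a"] assms(1) by auto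
  moreover have "\<not> (\<exists>D \<in> bochner_algebra UNIV W. 0 < degree D \<and> degree D < 4)"
    unfolding W using bochner_order_lt_4[OF assms(1) refl] by force
  ultimately show ?thesis
    unfolding solves_bochner_problem_def by force
qed

end
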